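(* Let $E\subset\mathbb{C}^{\mathbb{Z}}$ be a Banach space of sequences satisfying (i)–(iii) of the context, and suppose that at least one of $S$, $S^{-1}$ is bounded on $E$. 1) If $M\in\mu(E)$, then $\overline{\widetilde{M}(\sigma(S))}\subset\sigma(M)$. 2) If $M\in\mathfrak{S}$, then $\sigma(M)=\overline{\widetilde{M}(\sigma(S))}$.
   Context: $F(\mathbb{Z})$ is the set of complex sequences on $\mathbb{Z}$ with finitely many non-zero terms. $E\subset\mathbb{C}^{\mathbb{Z}}$ is a Banach space with $F(\mathbb{Z})\subset E$ such that: (i) $F(\mathbb{Z})$ is dense in $E$; (ii) for every $n\in\mathbb{Z}$ the map $x\mapsto x(n)$ is continuous from $E$ to $\mathbb{C}$; (iii) for every $z\in\mathbb{T}=\{z\in\mathbb{C}:|z|=1\}$, $\psi_z(E)\subset E$, where $\psi_z(x)=(x(n)z^n)_{n\in\mathbb{Z}}$, and $\sup_{z\in\mathbb{T}}\|\psi_z\|<+\infty$. $S:\mathbb{C}^{\mathbb{Z}}\to\mathbb{C}^{\mathbb{Z}}$ is the shift $(Sx)(n)=x(n-1)$, and $(S^{-1}x)(n)=x(n+1)$. One says $S$ (resp. $S^{-1}$) is bounded if $S(E)\subset E$ (resp. $S^{-1}(E)\subset E$); its restriction to $E$ is then a bounded operator. If $S$ is bounded, $\sigma(S)$ and $\rho(S)$ denote the spectrum and spectral radius of $S|_E$; if $S$ is not bounded, they denote the spectrum and spectral radius of the smallest closed extension of $S|_{F(\mathbb{Z})}$ as an operator in $E$. The same conventions are used for $S^{-1}$.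 It is known that $\sigma(S)=\{z\in\mathbb{C}: 1/\rho(S^{-1})\le|z|\le\rho(S)\}$, with $\rho(S)=+\infty$ if $S$ is not bounded and $\rho(S^{-1})=+\infty$ (so $1/\rho(S^{-1})=0$) if $S^{-1}$ is not bounded. A multiplier on $E$ is a bounded operator $M$ on $E$ with $MSa=SMa$ for all $a\in F(\mathbb{Z})$; $\mu(E)$ is the space of multipliers. $\sigma(M)$ is the spectrum of $M$ as a bounded operator on $E$. Let $e_0$ be the sequence with $e_0(0)=1$ and $e_0(n)=0$ for $n\ne0$, and let $\widehat{M}=M(e_0)$. The symbol of $M$ is $\widetilde{M}(z)=\sum_{n\in\mathbb{Z}}\widehat{M}(n)z^n$. It is known that for every $r>0$ with $C_r=\{|z|=r\}\subset\sigma(S)$, $\widetilde{M}$ is a function in $L^\infty(C_r)$ (that is, $(\widehat{M}(n)r^n)_n$ is the sequence of Fourier coefficients of a function in $L^\infty(\mathbb{T})$, denoted $z\mapsto\widetilde{M}(rz)$), and that $\widetilde{M}$ is holomorphic on the interior of $\sigma(S)$ when this interior is non-empty. $\widetilde{M}(\sigma(S))$ denotes the essential range of $\widetilde{M}$ on $\sigma(S)$: the values of the holomorphic function $\widetilde{M}$ on the interior of $\sigma(S)$ together with the essential range (with respect to arc length) of $\widetilde{M}$ on the circles forming the boundary of $\sigma(S)$. The bar denotes closure in $\mathbb{C}$. For $\phi\in F(\mathbb{Z})$, $M_\phi$ is the operator of convolution by $\phi$ on $E$, $M_\phi f=\phi*f$. $\mathfrak{S}$ is the closure, in the operator norm topology,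 of the algebra generated by the bounded operators $M_\phi$ with $\phi\in F(\mathbb{Z})$.
   Formalization: Part 2 assumes σ(S) is nonempty: it fails if S is unbounded and S⁻¹ quasinilpotent, as for weighted ℓ² with weight exp(n|n|) and M = I. If σ(S) = {0}, the point 0 counts as a boundary circle of radius 0, where the symbol has the value M̂(0). *)

theory Defs
  imports "HOL-Analysis.Analysis" "HOL-Library.Function_Algebras"
begin

section \<open>Banach spaces of two-sided complex sequences\<close>

type_synonym cseq = "int \<Rightarrow> complex"

definition cscale :: "complex \<Rightarrow> cseq \<Rightarrow> cseq" where
  "cscale c x = (\<lambda>n. c * x n)"

global_interpretation cseq: vector_space cscale
  by unfold_locales (auto simp: cscale_def plus_fun_def algebra_simps)

definition finseq :: "cseq set" where
  "finseq = {x. finite {n. x n \<noteq> 0}}"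

text \<open>The locale \<^locale>\<open>Metric_space\<close> wants a distance that is nonnegative and symmetric on the
  whole type, so the distance induced by the norm is cut off outside the space.\<close>

definition seq_dist :: "cseq set \<Rightarrow> (cseq \<Rightarrow> real) \<Rightarrow> cseq \<Rightarrow> cseq \<Rightarrow> real" where
  "seq_dist E N x y = (if x \<in> E \<and> y \<in> E then N (x - y) else 0)"

definition seq_topology :: "cseq set \<Rightarrow> (cseq \<Rightarrow> real) \<Rightarrow> cseq topology" where
  "seq_topology E N = Metric_space.mtopology E (seq_dist E N)"

locale banach_seq_space =
  fixes E :: "cseq set" and N :: "cseq \<Rightarrow> real"
  assumes subspace: "cseq.subspace E"
    and norm_nonneg: "\<And>x. x \<in> E \<Longrightarrow> 0 \<le> N x"
    and norm_eq_0_iff: "\<And>x. x \<in> E \<Longrightarrow> N x = 0 \<longleftrightarrow> x = 0"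
    and norm_cscale: "\<And>c x. x \<in> E \<Longrightarrow> N (cscale c x) = cmod c * N x"
    and norm_triangle: "\<And>x y. x \<in> E \<Longrightarrow> y \<in> E \<Longrightarrow> N (x + y) \<le> N x + N y"
    and complete: "Metric_space.mcomplete E (seq_dist E N)"

sublocale banach_seq_space \<subseteq> Metric_space E "seq_dist E N"
proof
  have diff: "x - y \<in> E" if "x \<in> E" "y \<in> E" for x y
    using that subspace by (rule cseq.subspace_diff[rotated])
  show "0 \<le> seq_dist E N x y" for x y
    using norm_nonneg[OF diff] by (simp add: seq_dist_def)
  show "seq_dist E N x y = seq_dist E N y x" for x y
  proof -
    have "N (y - x) = N (x - y)" if "x \<in> E" "y \<in> E"
    proof -
      have "cscale (-1) (x - y) = y - x"
        by (auto simp: cscale_def fun_eq_iff)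
      with norm_cscale[OF diff[OF that], of "-1"] show ?thesis by simp
    qed
    then show ?thesis by (simp add: seq_dist_def)
  qed
  show "seq_dist E N x y = 0 \<longleftrightarrow> x = y" if "x \<in> E" "y \<in> E" for x y
    using that norm_eq_0_iff[OF diff[OF that]] by (simp add: seq_dist_def)
  show "seq_dist E N x z \<le> seq_dist E N x y + seq_dist E N y z"
    if "x \<in> E" "y \<in> E" "z \<in> E" for x y z
    using norm_triangle[OF diff[OF that(1,2)] diff[OF that(2,3)]] that
    by (simp add: seq_dist_def)
qed

definition modulate :: "complex \<Rightarrow> cseq \<Rightarrow> cseq" where
  "modulate z x = (\<lambda>n. x n * z powi n)"

locale shift_space = banach_seq_space +
  assumes finseq_subset: "finseq \<subseteq> E"
    and finseq_dense: "seq_topology E N closure_of finseq = E"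
    and continuous_coord: "\<And>n. continuous_map (seq_topology E N) euclidean (\<lambda>x. x n)"
    and modulate_into: "\<And>z. cmod z = 1 \<Longrightarrow> modulate z ` E \<subseteq> E"
    and modulate_bounded: "\<exists>C. \<forall>z. cmod z = 1 \<longrightarrow> (\<forall>x\<in>E. N (modulate z x) \<le> C * N x)"

definition shift :: "cseq \<Rightarrow> cseq" where
  "shift x = (\<lambda>n. x (n - 1))"

definition unshift :: "cseq \<Rightarrow> cseq" where
  "unshift x = (\<lambda>n. x (n + 1))"


section \<open>Operators and spectra\<close>

text \<open>A bounded operator on \<open>E\<close> is given by a function on all sequences whose values outside
  \<open>E\<close> are irrelevant.  Operators with a domain, possibly unbounded, are given by their graphs.\<close>

definition bounded_operator :: "cseq set \<Rightarrow> (cseq \<Rightarrow> real) \<Rightarrow> (cseq \<Rightarrow> cseq) \<Rightarrow> bool" where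
  "bounded_operator E N T \<longleftrightarrow>
     T ` E \<subseteq> E \<and>
     (\<forall>x\<in>E. \<forall>y\<in>E. T (x + y) = T x + T y) \<and>
     (\<forall>c. \<forall>x\<in>E. T (cscale c x) = cscale c (T x)) \<and>
     (\<exists>C. \<forall>x\<in>E. N (T x) \<le> C * N x)"

definition graph_on :: "cseq set \<Rightarrow> (cseq \<Rightarrow> cseq) \<Rightarrow> (cseq \<times> cseq) set" where
  "graph_on D T = (\<lambda>x. (x, T x)) ` D"

definition linear_relation :: "(cseq \<times> cseq) set \<Rightarrow> bool" where
  "linear_relation G \<longleftrightarrow>
     (0, 0) \<in> G \<and>
     (\<forall>x y x' y'. (x, y) \<in> G \<longrightarrow> (x', y') \<in> G \<longrightarrow> (x + x', y + y') \<in> G) \<and>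
     (\<forall>c x y. (x, y) \<in> G \<longrightarrow> (cscale c x, cscale c y) \<in> G)"

definition closed_operator :: "cseq set \<Rightarrow> (cseq \<Rightarrow> real) \<Rightarrow> (cseq \<times> cseq) set \<Rightarrow> bool" where
  "closed_operator E N G \<longleftrightarrow>
     linear_relation G \<and> single_valued G \<and>
     closedin (prod_topology (seq_topology E N) (seq_topology E N)) G"

definition smallest_closed_extension ::
    "cseq set \<Rightarrow> (cseq \<Rightarrow> real) \<Rightarrow> (cseq \<times> cseq) set \<Rightarrow> (cseq \<times> cseq) set" where
  "smallest_closed_extension E N G = closed_operator E N hull G"

text \<open>The number \<open>\<alpha>\<close> is outside the spectrum of the operator \<open>T\<close> with graph \<open>G\<close> if \<open>T - \<alpha>\<close>
  is a bijection of its domain onto \<open>E\<close> with a bounded inverse \<open>R\<close>.\<close>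

definition op_spectrum ::
    "cseq set \<Rightarrow> (cseq \<Rightarrow> real) \<Rightarrow> (cseq \<times> cseq) set \<Rightarrow> complex set" where
  "op_spectrum E N G =
     {\<alpha>. \<not> (\<exists>R. bounded_operator E N R \<and>
              (\<forall>(x, y)\<in>G. R (y - cscale \<alpha> x) = x) \<and>
              (\<forall>y\<in>E. (R y, y + cscale \<alpha> (R y)) \<in> G))}"

definition shift_spectrum :: "cseq set \<Rightarrow> (cseq \<Rightarrow> real) \<Rightarrow> complex set" where
  "shift_spectrum E N =
     op_spectrum E N
       (if shift ` E \<subseteq> E then graph_on E shift
        else smallest_closed_extension E N (graph_on finseq shift))"

text \<open>The smallest closed extension of the shift on the finite sequences is indeed a closed
  operator, i.e. the hull is taken over a nonempty family.\<close>

lemma (in shift_space) closed_operator_shift_extension: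
  "closed_operator E N (smallest_closed_extension E N (graph_on finseq shift))"
proof -
  let ?T = "prod_topology (seq_topology E N) (seq_topology E N)"
  define G where "G = {p \<in> E \<times> E. snd p = shift (fst p)}"
  have top: "topspace ?T = E \<times> E"
    by (simp add: seq_topology_def)
  have coord: "closedin ?T {p \<in> topspace ?T. snd p n = fst p (n - 1)}" for n
  proof -
    have "continuous_map ?T euclidean (\<lambda>p. snd p n)"
      using continuous_map_compose[OF continuous_map_snd continuous_coord] by (simp add: o_def)
    moreover have "continuous_map ?T euclidean (\<lambda>p. fst p (n - 1))"
      using continuous_map_compose[OF continuous_map_fst continuous_coord] by (simp add: o_def)
    ultimately show ?thesis
      by (intro closedin_continuous_maps_eq[of euclidean]) auto
  qed
  have "closedin ?T (\<Inter>n. {p \<in> topspace ?T. snd p n = fst p (n - 1)})"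
    by (rule closedin_Inter) (use coord in auto)
  moreover have "(\<Inter>n. {p \<in> topspace ?T. snd p n = fst p (n - 1)}) = G"
    unfolding top G_def by (auto simp: shift_def)
  ultimately have closed: "closedin ?T G" by simp
  have "linear_relation G"
    unfolding linear_relation_def G_def
    using cseq.subspace_0[OF subspace] cseq.subspace_add[OF subspace]
      cseq.subspace_scale[OF subspace]
    by (auto simp: shift_def cscale_def)
  then have G: "closed_operator E N G"
    unfolding closed_operator_def using closed by (auto simp: single_valued_def G_def)
  have "shift x \<in> finseq" if "x \<in> finseq" for x
  proof -
    have "{n. shift x n \<noteq> 0} = (\<lambda>n. n + 1) ` {n. x n \<noteq> 0}"
      by (force simp: shift_def image_iff)
    then show ?thesis using that by (simp add: finseq_def)
  qed
  then have sub: "graph_on finseq shift \<subseteq> G"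
    using finseq_subset by (auto simp: graph_on_def G_def)
  let ?H = "smallest_closed_extension E N (graph_on finseq shift)"
  have H: "?H = \<Inter>{H. closed_operator E N H \<and> graph_on finseq shift \<subseteq> H}"
    by (simp add: smallest_closed_extension_def hull_def)
  have "?H \<subseteq> G" using G sub unfolding H by blast
  then have "single_valued ?H"
    using G unfolding closed_operator_def by (meson single_valued_subset)
  moreover have "linear_relation ?H"
    unfolding H by (auto simp: linear_relation_def closed_operator_def)
  moreover have "closedin ?T ?H"
    unfolding H using G sub by (intro closedin_Inter) (auto simp: closed_operator_def)
  ultimately show ?thesis by (simp add: closed_operator_def)
qed


section \<open>Multipliers and their symbols\<close>

definition multiplier :: "cseq set \<Rightarrow> (cseq \<Rightarrow> real) \<Rightarrow> (cseq \<Rightarrow> cseq) \<Rightarrow> bool" where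
  "multiplier E N M \<longleftrightarrow>
     bounded_operator E N M \<and> (\<forall>a\<in>finseq. M (shift a) = shift (M a))"

definition unit_seq :: cseq where
  "unit_seq = (\<lambda>n. if n = 0 then 1 else 0)"

definition hat :: "(cseq \<Rightarrow> cseq) \<Rightarrow> cseq" where
  "hat M = M unit_seq"

definition laurent :: "cseq \<Rightarrow> complex \<Rightarrow> complex" where
  "laurent a z = (\<Sum>\<^sub>\<infinity>n. a n * z powi n)"

text \<open>Arc length on the unit circle.\<close>

definition circle_measure :: "complex measure" where
  "circle_measure = distr (restrict_space lborel {0..2 * pi}) borel cis"

definition circle_Linf :: "(complex \<Rightarrow> complex) set" where
  "circle_Linf = {f \<in> borel_measurable borel. \<exists>C. AE z in circle_measure. cmod (f z) \<le> C}"

definition fourier_coeff :: "(complex \<Rightarrow> complex) \<Rightarrow> int \<Rightarrow> complex" where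
  "fourier_coeff f n = (LINT z|circle_measure. f z * z powi (- n)) / (2 * pi)"

text \<open>The function \<open>z \<mapsto> \<Sum>\<^sub>n a(n) (r z)\<^sup>n\<close> on the unit circle, determined up to a null set by
  its Fourier coefficients \<open>a(n) r\<^sup>n\<close>.  For \<open>r = 0\<close> it is the constant \<open>a(0)\<close>, because
  \<open>0 powi n\<close> is \<open>1\<close> for \<open>n = 0\<close> and \<open>0\<close> otherwise.\<close>

definition circle_symbol :: "cseq \<Rightarrow> real \<Rightarrow> complex \<Rightarrow> complex" where
  "circle_symbol a r =
     (SOME f. f \<in> circle_Linf \<and> (\<forall>n. fourier_coeff f n = a n * of_real r powi n))"

definition essential_range :: "'a measure \<Rightarrow> ('a \<Rightarrow> complex) \<Rightarrow> complex set" where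
  "essential_range \<mu> f =
     {w. \<forall>e>0. emeasure \<mu> {z \<in> space \<mu>. dist (f z) w < e} > 0}"

text \<open>The range, on a rotation invariant closed set \<open>K\<close>, of the symbol with coefficients \<open>a\<close>.
  If \<open>K\<close> is the single point \<open>0\<close>, which can happen for a quasinilpotent shift, this point counts
  as a boundary circle of radius \<open>0\<close> and contributes the value \<open>a(0)\<close>.\<close>

definition symbol_range :: "cseq \<Rightarrow> complex set \<Rightarrow> complex set" where
  "symbol_range a K =
     laurent a ` interior K \<union>
     (\<Union>r\<in>{r. r \<ge> 0 \<and> sphere 0 r \<subseteq> frontier K}. essential_range circle_measure (circle_symbol a r))"


section \<open>The closed algebra generated by the convolution operators\<close>

definition conv :: "cseq \<Rightarrow> cseq \<Rightarrow> cseq" where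
  "conv \<phi> f = (\<lambda>n. \<Sum>k | \<phi> k \<noteq> 0. \<phi> k * f (n - k))"

inductive_set generated_algebra :: "(cseq \<Rightarrow> cseq) set \<Rightarrow> (cseq \<Rightarrow> cseq) set"
  for \<G> :: "(cseq \<Rightarrow> cseq) set" where
  generator: "A \<in> \<G> \<Longrightarrow> A \<in> generated_algebra \<G>"
| add: "A \<in> generated_algebra \<G> \<Longrightarrow> B \<in> generated_algebra \<G> \<Longrightarrow>
    (\<lambda>x. A x + B x) \<in> generated_algebra \<G>"
| scale: "A \<in> generated_algebra \<G> \<Longrightarrow> (\<lambda>x. cscale c (A x)) \<in> generated_algebra \<G>"
| compose: "A \<in> generated_algebra \<G> \<Longrightarrow> B \<in> generated_algebra \<G> \<Longrightarrow>
    A \<circ> B \<in> generated_algebra \<G>"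

definition conv_algebra :: "cseq set \<Rightarrow> (cseq \<Rightarrow> real) \<Rightarrow> (cseq \<Rightarrow> cseq) set" where
  "conv_algebra E N = generated_algebra {conv \<phi> |\<phi>. \<phi> \<in> finseq \<and> bounded_operator E N (conv \<phi>)}"

text \<open>Its closure in the operator norm: the condition \<open>N (M x - A x) \<le> e * N x\<close> for all \<open>x \<in> E\<close>
  says that the operator norm of \<open>M - A\<close> on \<open>E\<close> is at most \<open>e\<close>.\<close>

definition conv_closure :: "cseq set \<Rightarrow> (cseq \<Rightarrow> real) \<Rightarrow> (cseq \<Rightarrow> cseq) set" where
  "conv_closure E N =
     {M. bounded_operator E N M \<and>
         (\<forall>e>0. \<exists>A\<in>conv_algebra E N. \<forall>x\<in>E. N (M x - A x) \<le> e * N x)}"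

end

theory Submission
  imports Defs "HOL-Computational_Algebra.Fundamental_Theorem_Algebra"
begin

text \<open>
  Write \<open>B = S\<^sup>s\<close> for the bounded one of the two shifts, \<open>s = 1\<close> or \<open>s = -1\<close>, \<open>C\<close> for a bound of the
  modulations \<open>\<psi>\<^sub>z\<close>, and \<open>K\<close> for the spectrum of \<open>S\<close>.  The set \<open>K\<close> consists of the \<open>\<alpha>\<close>, nonzero if \<open>s = -1\<close>,
  with \<open>\<alpha>\<^sup>s\<close> in the spectrum of \<open>B\<close> (\<open>shift_spectrum_iff\<close>); it is closed, and conjugation with
  modulations shows that with every point it contains the whole circle about \<open>0\<close>.

  Everything rests on one estimate: the symbol of a bounded convolution operator with a finite
  sequence \<open>\<phi>\<close> is bounded on \<open>K\<close> by the norm of that operator (\<open>laurent_le_of_sigma\<close>).  For if \<open>\<phi>\<close> takes the value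
  \<open>l\<close> at \<open>\<alpha> \<in> K\<close>, then \<open>M\<^sub>\<phi> - l\<close> is, up to a power of \<open>B\<close>, divisible by \<open>B - \<alpha>\<^sup>s\<close>, and cannot be
  invertible (\<open>laurent_neq_of_invertible\<close>).  A multiplier may have infinitely many nonzero
  coefficients, but averaging over modulations shows that the Fejer means of the coefficients give
  convolution operators of norm at most \<open>C\<^sup>3 \<parallel>M\<parallel>\<close> (\<open>op_bound_conv_weight_hat\<close>).  So the Fejer means of the symbol are
  uniformly bounded on \<open>K\<close>; this makes the symbol an \<open>L\<^sup>\<infinity>\<close> function on each circle in \<open>K\<close>
  (\<open>circle_symbol_symbol_function\<close>), with essential range in the disc of radius \<open>C\<^sup>3 \<parallel>M\<parallel>\<close>
  (\<open>symbol_function_le\<close>).  On circles inside the interior of \<open>K\<close> the Laurent series converges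
  absolutely, and its values belong to these essential ranges
  (\<open>laurent_interior_mem_essential_range\<close>).

  For the first part let \<open>l\<close> be outside the spectrum of \<open>M\<close>.  Then \<open>R = (M - l)\<^sup>-\<^sup>1\<close> is a multiplier.
  Multiplying the Fejer means of the symbol of \<open>R\<close> by the symbol of \<open>M - l\<close> gives functions on the
  circle that tend weakly to \<open>1\<close>, so the symbol of \<open>M\<close> has distance at least \<open>1 / (C\<^sup>3 \<parallel>R\<parallel>)\<close> from \<open>l\<close>
  (\<open>symbol_function_lower\<close>).

  For the second part let \<open>l\<close> have positive distance \<open>\<delta>\<close> from the range of the symbol, and choose a
  finite \<open>\<phi>\<close> with \<open>M\<^sub>\<phi>\<close> close to \<open>M\<close>.  The symbol of \<open>\<phi>\<close> has distance more than \<open>\<delta> / 2\<close> from \<open>l\<close> on \<open>K\<close>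
  (\<open>laurent_far_from\<close>), so \<open>M\<^sub>\<phi> - l - v\<close> is invertible for every \<open>v\<close> in the disc of radius \<open>\<delta> / 2\<close>: it factors into
  terms \<open>B - \<beta>\<close> with \<open>\<beta>\<close> outside the spectrum of \<open>B\<close> (\<open>invertible_op_conv\<close>).  Hence the spectral radius of
  \<open>(M\<^sub>\<phi> - l)\<^sup>-\<^sup>1\<close> is small enough (\<open>powers_bounded\<close>) to invert the commuting perturbation \<open>M - l\<close> by a Neumann
  series (\<open>invertible_op_perturbation\<close>).  If \<open>S\<close> is unbounded, the point \<open>0\<close> of the spectrum of \<open>B\<close> has no
  counterpart in \<open>K\<close>; it is reached as a limit (\<open>sigma_contains_punctured_disc\<close>).
\<close>


section \<open>Integration on the unit circle\<close>

lemma sets_circle_measure [measurable_cong, simp]: "sets circle_measure = sets borel"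
  by (simp add: circle_measure_def)

lemma space_circle_measure [simp]: "space circle_measure = UNIV"
  by (simp add: circle_measure_def)

lemma measurable_circle_measure [simp]: "borel_measurable circle_measure = borel_measurable borel"
  by (rule measurable_cong_sets) auto

lemma cis_measurable [measurable]: "cis \<in> borel_measurable borel"
  by (intro borel_measurable_continuous_onI continuous_intros)

lemma cis_measurable_restrict:
  "cis \<in> measurable (restrict_space lborel {0..2 * pi}) borel"
  by (rule measurable_restrict_space1) simp

lemma emeasure_circle_measure:
  assumes "B \<in> sets borel"
  shows "emeasure circle_measure B = emeasure lborel (cis -` B \<inter> {0..2 * pi})"
proof -
  have "emeasure circle_measure B
      = emeasure (restrict_space lborel {0..2 * pi}) (cis -` B \<inter> {0..2 * pi})"
    unfolding circle_measure_def
    by (subst emeasure_distr) (use assms cis_measurable_restrict in \<open>auto simp: space_restrict_space\<close>)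
  also have "\<dots> = emeasure lborel (cis -` B \<inter> {0..2 * pi})"
    by (subst emeasure_restrict_space) auto
  finally show ?thesis .
qed

lemma finite_measure_circle_measure: "finite_measure circle_measure"
  by standard (simp add: emeasure_circle_measure)

interpretation circle: finite_measure circle_measure
  by (rule finite_measure_circle_measure)

lemma measure_circle_measure_UNIV: "measure circle_measure UNIV = 2 * pi"
  by (simp add: measure_def emeasure_circle_measure)

lemma AE_circle_norm: "AE z in circle_measure. cmod z = 1"
  unfolding circle_measure_def
  by (subst AE_distr_iff) (use cis_measurable_restrict in auto)

lemma integral_circle_measure:
  fixes f :: "complex \<Rightarrow> complex"
  assumes "f \<in> borel_measurable borel"
  shows "(LINT z|circle_measure. f z) = (LINT t|lborel. indicator {0..2 * pi} t *\<^sub>R f (cis t))"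
  unfolding circle_measure_def
  by (subst integral_distr) (use assms cis_measurable_restrict in \<open>auto simp: integral_restrict_space\<close>)

lemma powi_measurable [measurable]: "(\<lambda>z::complex. z powi n) \<in> borel_measurable borel"
  by (auto simp: power_int_def)

lemma integral_circle_powi:
  "(LINT z|circle_measure. z powi n) = (if n = 0 then 2 * pi else 0)"
proof -
  have "(LINT z|circle_measure. z powi n)
      = (LINT t|lborel. indicator {0..2 * pi} t *\<^sub>R cis (of_int n * t))"
    by (subst integral_circle_measure) (auto simp: cis_power_int)
  also have "\<dots> = (if n = 0 then 2 * pi else 0)"
  proof (cases "n = 0")
    case True
    then show ?thesis by (simp add: scaleR_conv_of_real)
  next
    case False
    let ?F = "\<lambda>t::real. cis (of_int n * t) / (\<i> * of_int n)"
    have "(?F has_vector_derivative cis (of_int n * t)) (at t within {0..2 * pi})" for t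
    proof -
      have "((\<lambda>z. exp (\<i> * of_int n * z)) has_field_derivative
          \<i> * of_int n * exp (\<i> * of_int n * of_real t)) (at (of_real t))"
        by (auto intro!: derivative_eq_intros)
      from has_vector_derivative_real_field[OF this, of "{0..2 * pi}"]
      have "((\<lambda>t. cis (of_int n * t)) has_vector_derivative of_int n *\<^sub>R (\<i> * cis (of_int n * t)))
          (at t within {0..2 * pi})"
        unfolding cis_conv_exp by (simp add: scaleR_conv_of_real mult_ac)
      from has_vector_derivative_divide[OF this, of "\<i> * of_int n"] show ?thesis
        using False by (simp add: scaleR_conv_of_real)
    qed
    then have "(LINT t|lborel. indicator {0..2 * pi} t *\<^sub>R cis (of_int n * t)) = ?F (2 * pi) - ?F 0"
      by (intro integral_FTC_atLeastAtMost) (auto intro!: continuous_intros)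
    also have "cis (of_int n * (2 * pi)) = 1"
      using cis_multiple_2pi[of "of_int n"] by (simp add: mult_ac)
    finally show ?thesis using False by simp
  qed
  finally show ?thesis .
qed

lemma circle_integrable_bounded:
  fixes f :: "complex \<Rightarrow> complex"
  assumes "f \<in> borel_measurable borel" "AE z in circle_measure. cmod (f z) \<le> C"
  shows "integrable circle_measure f"
  using assms by (intro circle.integrable_const_bound[of f C]) auto

section \<open>Weak convergence from convergence of Fourier coefficients\<close>

text \<open>Uniform essential boundedness is part of the notion, so that convergence of the integrals
  against trigonometric polynomials extends by density to integrals over Borel sets.\<close>

definition weakly_null :: "(nat \<Rightarrow> complex \<Rightarrow> complex) \<Rightarrow> bool" where
  "weakly_null h \<longleftrightarrow>
     (\<forall>k. h k \<in> borel_measurable borel) \<and>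
     (\<exists>C. \<forall>k. AE z in circle_measure. cmod (h k z) \<le> C) \<and>
     (\<forall>n. (\<lambda>k. LINT z|circle_measure. h k z * z powi n) \<longlonglongrightarrow> 0)"

lemma weakly_nullI:
  assumes "\<And>k. h k \<in> borel_measurable borel"
    and "\<And>k. AE z in circle_measure. cmod (h k z) \<le> C"
    and "\<And>n. (\<lambda>k. LINT z|circle_measure. h k z * z powi n) \<longlonglongrightarrow> 0"
  shows "weakly_null h"
  using assms unfolding weakly_null_def by blast

lemma weakly_null_measurable: "weakly_null h \<Longrightarrow> h k \<in> borel_measurable borel"
  by (simp add: weakly_null_def)

lemma weakly_null_bounded:
  assumes "weakly_null h"
  obtains C where "C > 0" "\<And>k. AE z in circle_measure. cmod (h k z) \<le> C"
proof -
  obtain C where C: "\<And>k. AE z in circle_measure. cmod (h k z) \<le> C"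
    using assms by (auto simp: weakly_null_def)
  have "AE z in circle_measure. cmod (h k z) \<le> max C 1" for k
    using C[of k] by eventually_elim auto
  then show thesis by (intro that[of "max C 1"]) auto
qed

lemma weakly_null_coeff:
  "weakly_null h \<Longrightarrow> (\<lambda>k. LINT z|circle_measure. h k z * z powi n) \<longlonglongrightarrow> 0"
  by (simp add: weakly_null_def)

lemma weakly_null_integrable:
  assumes "weakly_null h"
  shows "integrable circle_measure (\<lambda>z. h k z * z powi n)"
proof -
  obtain C where C: "AE z in circle_measure. cmod (h k z) \<le> C"
    using assms by (auto simp: weakly_null_def)
  show ?thesis
  proof (rule circle_integrable_bounded[where C = C])
    have [measurable]: "h k \<in> borel_measurable borel"
      using assms by (simp add: weakly_null_def)
    show "(\<lambda>z. h k z * z powi n) \<in> borel_measurable borel"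
      by measurable
    show "AE z in circle_measure. cmod (h k z * z powi n) \<le> C"
      using C AE_circle_norm by eventually_elim (auto simp: norm_mult norm_power_int)
  qed
qed

lemma bounded_linear_on_circle:
  fixes g :: "complex \<Rightarrow> real"
  assumes g: "bounded_linear g"
  obtains a b where "\<And>z. cmod z = 1 \<Longrightarrow> complex_of_real (g z) = a * z + b * z powi (-1)"
proof
  fix z :: complex assume z: "cmod z = 1"
  interpret bounded_linear g by fact
  have "z = Re z *\<^sub>R 1 + Im z *\<^sub>R \<i>"
    by (simp add: complex_eq_iff)
  then have gz: "g z = Re z * g 1 + Im z * g \<i>"
    by (metis add scaleR real_scaleR_def)
  have inv: "z powi (-1) = cnj z"
    using z by (simp add: power_int_minus inverse_complex_def complex_eq_iff cmod_def)
  show "complex_of_real (g z)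
      = ((g 1 - \<i> * g \<i>) / 2) * z + ((g 1 + \<i> * g \<i>) / 2) * z powi (-1)"
    unfolding gz inv by (simp add: complex_eq_iff field_simps)
qed

text \<open>The class of weakly null sequences is a module over the polynomials in \<open>Re z\<close> and \<open>Im z\<close>:
  on the circle a real-linear function is a combination of \<open>z\<close> and \<open>1/z\<close>, so multiplication by
  it shifts the Fourier coefficients.\<close>

lemma weakly_null_mult_polynomial:
  assumes "real_polynomial_function g" "weakly_null h"
  shows "weakly_null (\<lambda>k z. of_real (g z) * h k z)"
  using assms
proof (induction g arbitrary: h rule: real_polynomial_function.induct)
  case (linear g)
  note h = linear.prems
  obtain a b where ab: "\<And>z. cmod z = 1 \<Longrightarrow> complex_of_real (g z) = a * z + b * z powi (-1)"
    using bounded_linear_on_circle[OF linear.hyps] by metis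
  have hm [measurable]: "h k \<in> borel_measurable borel" for k
    using h by (simp add: weakly_null_def)
  have g [measurable]: "g \<in> borel_measurable borel"
    using linear.hyps by (intro borel_measurable_continuous_onI linear_continuous_on)
  obtain C where C: "\<And>k. AE z in circle_measure. cmod (h k z) \<le> C"
    using h by (auto simp: weakly_null_def)
  have "AE z in circle_measure. cmod (of_real (g z) * h k z) \<le> (cmod a + cmod b) * C" for k
    using C[of k] AE_circle_norm
  proof eventually_elim
    case (elim z)
    have "cmod (of_real (g z)) \<le> cmod a + cmod b"
      unfolding ab[OF elim(2)]
      by (rule order_trans[OF norm_triangle_ineq]) (simp add: norm_mult norm_power_int elim norm_inverse)
    then show ?case using elim(1) by (simp add: norm_mult mult_mono)
  qed
  then show ?case
  proof (rule weakly_nullI[rotated])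
    fix n
    have eq: "(LINT z|circle_measure. of_real (g z) * h k z * z powi n)
        = a * (LINT z|circle_measure. h k z * z powi (n + 1))
          + b * (LINT z|circle_measure. h k z * z powi (n - 1))" for k
    proof -
      have "(LINT z|circle_measure. of_real (g z) * h k z * z powi n)
          = (LINT z|circle_measure. a * (h k z * z powi (n + 1)) + b * (h k z * z powi (n - 1)))"
      proof (rule integral_cong_AE)
        show "AE z in circle_measure. of_real (g z) * h k z * z powi n
            = a * (h k z * z powi (n + 1)) + b * (h k z * z powi (n - 1))"
          using AE_circle_norm
        proof eventually_elim
          case (elim z)
          then have "z \<noteq> 0" by auto
          then show ?case unfolding ab[OF elim]
            by (simp add: power_int_add power_int_diff power_int_minus field_simps)
        qed
      qed measurable
      also have "\<dots> = a * (LINT z|circle_measure. h k z * z powi (n + 1))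
          + b * (LINT z|circle_measure. h k z * z powi (n - 1))"
        using weakly_null_integrable[OF h] by simp
      finally show ?thesis .
    qed
    have lim: "(\<lambda>k. LINT z|circle_measure. h k z * z powi m) \<longlonglongrightarrow> 0" for m
      using h by (auto simp: weakly_null_def)
    show "(\<lambda>k. LINT z|circle_measure. of_real (g z) * h k z * z powi n) \<longlonglongrightarrow> 0"
      unfolding eq by (intro tendsto_add_zero tendsto_mult_right_zero lim)
  qed measurable
next
  case (const c)
  obtain C where C: "\<And>k. AE z in circle_measure. cmod (h k z) \<le> C"
    using weakly_null_bounded[OF const] by metis
  have hm [measurable]: "h k \<in> borel_measurable borel" for k
    using const by (rule weakly_null_measurable)
  have "AE z in circle_measure. cmod (of_real c * h k z) \<le> \<bar>c\<bar> * C" for k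
    using C[of k] by eventually_elim (auto simp: norm_mult mult_left_mono)
  moreover have "(\<lambda>k. LINT z|circle_measure. of_real c * h k z * z powi n) \<longlonglongrightarrow> 0" for n
    using tendsto_mult_right_zero[OF weakly_null_coeff[OF const], of "of_real c" n]
    by (simp add: mult.assoc)
  ultimately show ?case by (intro weakly_nullI) auto
next
  case (add f g)
  note F = add.IH(1)[OF add.prems] and G = add.IH(2)[OF add.prems]
  obtain C where C: "\<And>k. AE z in circle_measure. cmod (of_real (f z) * h k z) \<le> C"
    using weakly_null_bounded[OF F] by metis
  obtain D where D: "\<And>k. AE z in circle_measure. cmod (of_real (g z) * h k z) \<le> D"
    using weakly_null_bounded[OF G] by metis
  note [measurable] = weakly_null_measurable[OF F] weakly_null_measurable[OF G]
  have "AE z in circle_measure. cmod (of_real (f z + g z) * h k z) \<le> C + D" for k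
    using C[of k] D[of k]
    by eventually_elim (simp add: distrib_right norm_triangle_mono)
  moreover have "(\<lambda>k. LINT z|circle_measure. of_real (f z + g z) * h k z * z powi n) \<longlonglongrightarrow> 0" for n
  proof -
    have eq: "(LINT z|circle_measure. of_real (f z + g z) * h k z * z powi n)
      = (LINT z|circle_measure. of_real (f z) * h k z * z powi n)
        + (LINT z|circle_measure. of_real (g z) * h k z * z powi n)" for k
      using weakly_null_integrable[OF F, of k n] weakly_null_integrable[OF G, of k n]
      by (simp add: distrib_right)
    show ?thesis
      unfolding eq by (intro tendsto_add_zero weakly_null_coeff F G)
  qed
  moreover have "(\<lambda>z. of_real (f z + g z) * h k z) \<in> borel_measurable borel" for k
    by (simp add: distrib_right)
  ultimately show ?case by (intro weakly_nullI) auto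
next
  case (mult f g)
  from mult.IH(1)[OF mult.IH(2)[OF mult.prems]] show ?case
    by (simp add: mult.assoc)
qed

lemma weakly_null_integral_approx:
  fixes g :: "complex \<Rightarrow> real"
  assumes h: "weakly_null h" and g: "integrable circle_measure g"
    and approx: "\<And>e. e > 0 \<Longrightarrow> \<exists>g'. integrable circle_measure g' \<and>
        (LINT z|circle_measure. \<bar>g z - g' z\<bar>) < e \<and>
        (\<lambda>k. LINT z|circle_measure. of_real (g' z) * h k z) \<longlonglongrightarrow> 0"
  shows "(\<lambda>k. LINT z|circle_measure. of_real (g z) * h k z) \<longlonglongrightarrow> 0"
proof (rule LIMSEQ_I)
  fix e :: real assume "e > 0"
  obtain C where "C > 0" and C: "\<And>k. AE z in circle_measure. cmod (h k z) \<le> C"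
    using weakly_null_bounded[OF h] by metis
  note hm [measurable] = weakly_null_measurable[OF h]
  have int: "integrable circle_measure (\<lambda>z. of_real (f z) * h k z)"
    and le: "cmod (LINT z|circle_measure. of_real (f z) * h k z) \<le> C * (LINT z|circle_measure. \<bar>f z\<bar>)"
    if f: "integrable circle_measure f" for f :: "complex \<Rightarrow> real" and k
  proof -
    have [measurable]: "f \<in> borel_measurable borel" using f by auto
    have b: "AE z in circle_measure. cmod (of_real (f z) * h k z) \<le> C * \<bar>f z\<bar>"
      using C[of k] by eventually_elim (auto simp: norm_mult mult.commute[of C] intro!: mult_left_mono)
    then have "AE z in circle_measure. cmod (of_real (f z) * h k z) \<le> norm (C * \<bar>f z\<bar>)"
      by eventually_elim (use \<open>C > 0\<close> in \<open>simp add: abs_mult\<close>)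
    then show i: "integrable circle_measure (\<lambda>z. of_real (f z) * h k z)"
    proof (rule Bochner_Integration.integrable_bound[rotated 2])
      show "integrable circle_measure (\<lambda>z. C * \<bar>f z\<bar>)"
        using f by (intro integrable_mult_right integrable_abs)
      show "(\<lambda>z. of_real (f z) * h k z) \<in> borel_measurable circle_measure"
        by measurable
    qed
    have "cmod (LINT z|circle_measure. of_real (f z) * h k z)
        \<le> (LINT z|circle_measure. cmod (of_real (f z) * h k z))" by simp
    also have "\<dots> \<le> (LINT z|circle_measure. C * \<bar>f z\<bar>)"
      using b f i by (intro integral_mono_AE) auto
    finally show "cmod (LINT z|circle_measure. of_real (f z) * h k z) \<le> C * (LINT z|circle_measure. \<bar>f z\<bar>)"
      by simp
  qed
  obtain g' where g': "integrable circle_measure g'"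
      "(LINT z|circle_measure. \<bar>g z - g' z\<bar>) < e / (2 * C)"
      "(\<lambda>k. LINT z|circle_measure. of_real (g' z) * h k z) \<longlonglongrightarrow> 0"
    using approx[of "e / (2 * C)"] \<open>e > 0\<close> \<open>C > 0\<close> by auto
  obtain k0 where k0: "\<And>k. k \<ge> k0 \<Longrightarrow> cmod (LINT z|circle_measure. of_real (g' z) * h k z) < e / 2"
    using LIMSEQ_D[OF g'(3), of "e / 2"] \<open>e > 0\<close> by auto
  have "cmod ((LINT z|circle_measure. of_real (g z) * h k z) - 0) < e" if "k \<ge> k0" for k
  proof -
    have d: "integrable circle_measure (\<lambda>z. g z - g' z)" using g g'(1) by auto
    have "(LINT z|circle_measure. of_real (g z) * h k z)
        = (LINT z|circle_measure. of_real (g z - g' z) * h k z + of_real (g' z) * h k z)"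
      by (rule Bochner_Integration.integral_cong) (auto simp: algebra_simps)
    also have "\<dots> = (LINT z|circle_measure. of_real (g z - g' z) * h k z)
        + (LINT z|circle_measure. of_real (g' z) * h k z)"
      using int[OF d] int[OF g'(1)] by (rule Bochner_Integration.integral_add)
    finally have "cmod (LINT z|circle_measure. of_real (g z) * h k z)
        \<le> cmod (LINT z|circle_measure. of_real (g z - g' z) * h k z)
          + cmod (LINT z|circle_measure. of_real (g' z) * h k z)"
      by (metis norm_triangle_ineq)
    also have "\<dots> < C * (e / (2 * C)) + e / 2"
      using order_le_less_trans[OF le[OF d, of k] mult_strict_left_mono[OF g'(2) \<open>C > 0\<close>]] k0[OF that]
      by (rule add_strict_mono)
    finally show ?thesis using \<open>C > 0\<close> by simp
  qed
  then show "\<exists>k0. \<forall>k\<ge>k0. cmod ((LINT z|circle_measure. of_real (g z) * h k z) - 0) < e"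
    by blast
qed

lemma circle_integrable_bounded_real:
  fixes f :: "complex \<Rightarrow> real"
  assumes "f \<in> borel_measurable borel" "AE z in circle_measure. \<bar>f z\<bar> \<le> C"
  shows "integrable circle_measure f"
  using assms by (intro circle.integrable_const_bound[of f C]) auto

lemma circle_integrable_continuous:
  fixes f :: "complex \<Rightarrow> real"
  assumes "continuous_on UNIV f"
  shows "integrable circle_measure f"
proof -
  have "compact (f ` sphere 0 1)"
    using assms by (intro compact_continuous_image continuous_on_subset[OF assms]) auto
  then obtain C where C: "\<And>z. z \<in> sphere 0 1 \<Longrightarrow> \<bar>f z\<bar> \<le> C"
    by (metis compact_imp_bounded bounded_iff image_eqI real_norm_def)
  show ?thesis
  proof (rule circle_integrable_bounded_real[where C = C])
    show "f \<in> borel_measurable borel" using assms by (rule borel_measurable_continuous_onI)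
    show "AE z in circle_measure. \<bar>f z\<bar> \<le> C"
      using AE_circle_norm by eventually_elim (simp add: C)
  qed
qed

lemma weakly_null_integral_continuous:
  assumes h: "weakly_null h" and g: "continuous_on UNIV (g :: complex \<Rightarrow> real)"
  shows "(\<lambda>k. LINT z|circle_measure. of_real (g z) * h k z) \<longlonglongrightarrow> 0"
proof (rule weakly_null_integral_approx[OF h circle_integrable_continuous[OF g]])
  fix e :: real assume "e > 0"
  define d where "d = e / (4 * pi)"
  have "d > 0" using \<open>e > 0\<close> by (simp add: d_def)
  obtain p where p: "real_polynomial_function p" "\<And>z. z \<in> sphere 0 1 \<Longrightarrow> \<bar>g z - p z\<bar> < d"
    using Stone_Weierstrass_real_polynomial_function[of "sphere 0 1" g d] g \<open>d > 0\<close>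
      continuous_on_subset by (metis compact_sphere top_greatest)
  have pc: "continuous_on UNIV p"
    using p(1) by (auto simp: continuous_on_eq_continuous_at continuous_real_polymonial_function)
  have "(LINT z|circle_measure. \<bar>g z - p z\<bar>) \<le> (LINT z|circle_measure. d)"
  proof (rule integral_mono_AE)
    show "integrable circle_measure (\<lambda>z. \<bar>g z - p z\<bar>)"
      by (intro circle_integrable_continuous continuous_intros g pc)
    show "AE z in circle_measure. \<bar>g z - p z\<bar> \<le> d"
      using AE_circle_norm by eventually_elim (use p(2) in \<open>auto intro: less_imp_le\<close>)
  qed auto
  also have "\<dots> < e" using \<open>e > 0\<close> by (simp add: measure_circle_measure_UNIV d_def)
  finally have "(LINT z|circle_measure. \<bar>g z - p z\<bar>) < e" .
  moreover have "(\<lambda>k. LINT z|circle_measure. of_real (p z) * h k z) \<longlonglongrightarrow> 0"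
    using weakly_null_coeff[OF weakly_null_mult_polynomial[OF p(1) h], of 0] by simp
  ultimately show "\<exists>g'. integrable circle_measure g' \<and>
        (LINT z|circle_measure. \<bar>g z - g' z\<bar>) < e \<and>
        (\<lambda>k. LINT z|circle_measure. of_real (g' z) * h k z) \<longlonglongrightarrow> 0"
    using circle_integrable_continuous[OF pc] by blast
qed

lemma weakly_null_integral_compact:
  assumes h: "weakly_null h" and K: "compact K"
  shows "(\<lambda>k. LINT z|circle_measure. of_real (indicator K z) * h k z) \<longlonglongrightarrow> 0"
proof (cases "K = {}")
  case False
  have clK: "closed K" using K by (rule compact_imp_closed)
  have [measurable]: "K \<in> sets borel" using clK by (rule borel_closed)
  define g where "g j z = max 0 (1 - real j * infdist z K)" for j z
  have gc: "continuous_on UNIV (g j)" for j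
    unfolding g_def by (intro continuous_intros)
  have glim: "(\<lambda>j. g j z) \<longlonglongrightarrow> indicator K z" for z
  proof (cases "z \<in> K")
    case True
    then show ?thesis by (simp add: g_def)
  next
    case False
    then have pos: "infdist z K > 0"
      using clK \<open>K \<noteq> {}\<close> by (simp add: infdist_pos_not_in_closed)
    obtain j0 where "real j0 > 1 / infdist z K" using reals_Archimedean2 by blast
    then have "g j z = 0" if "j \<ge> j0" for j
    proof -
      have "1 < real j0 * infdist z K" using \<open>real j0 > _\<close> pos by (simp add: field_simps)
      also have "\<dots> \<le> real j * infdist z K" using that pos by simp
      finally show ?thesis by (simp add: g_def)
    qed
    then have "eventually (\<lambda>j. g j z = 0) sequentially"
      unfolding eventually_sequentially by blast
    then show ?thesis using False by (simp add: tendsto_eventually)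
  qed
  have gb: "0 \<le> g j z" "g j z \<le> 1" for j z
    by (auto simp: g_def infdist_nonneg)
  have gm [measurable]: "g j \<in> borel_measurable borel" for j
    using gc by (rule borel_measurable_continuous_onI)
  have "(\<lambda>j. LINT z|circle_measure. \<bar>indicator K z - g j z\<bar>) \<longlonglongrightarrow> (LINT z|circle_measure. 0)"
  proof (rule integral_dominated_convergence[where w = "\<lambda>_. 1"])
    show "AE z in circle_measure. (\<lambda>j. \<bar>indicator K z - g j z\<bar>) \<longlonglongrightarrow> 0"
    proof (rule AE_I2)
      fix z
      from tendsto_rabs[OF tendsto_diff[OF tendsto_const[of "indicator K z"] glim[of z]]]
      show "(\<lambda>j. \<bar>indicator K z - g j z\<bar>) \<longlonglongrightarrow> 0" by simp
    qed
    show "AE z in circle_measure. norm \<bar>indicator K z - g j z\<bar> \<le> 1" for j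
    proof (rule AE_I2)
      fix z show "norm \<bar>indicator K z - g j z\<bar> \<le> 1"
        using gb[of j z] by (cases "z \<in> K") auto
    qed
  qed auto
  then have L1: "(\<lambda>j. LINT z|circle_measure. \<bar>indicator K z - g j z\<bar>) \<longlonglongrightarrow> 0" by simp
  show ?thesis
  proof (rule weakly_null_integral_approx[OF h])
    show "integrable circle_measure (indicat_real K)"
      by (rule circle_integrable_bounded_real[where C = 1]) auto
    fix e :: real assume "e > 0"
    then have "eventually (\<lambda>j. (LINT z|circle_measure. \<bar>indicator K z - g j z\<bar>) < e) sequentially"
      using L1 by (intro order_tendstoD) auto
    then obtain j where "(LINT z|circle_measure. \<bar>indicator K z - g j z\<bar>) < e"
      by (auto simp: eventually_sequentially)
    then show "\<exists>g'. integrable circle_measure g' \<and>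
        (LINT z|circle_measure. \<bar>indicator K z - g' z\<bar>) < e \<and>
        (\<lambda>k. LINT z|circle_measure. of_real (g' z) * h k z) \<longlonglongrightarrow> 0"
      using circle_integrable_continuous[OF gc] weakly_null_integral_continuous[OF h gc] by blast
  qed
qed simp

text \<open>Trigonometric polynomials approximate continuous functions (Stone-Weierstrass), these
  approximate indicators of compact sets, and these approximate indicators of Borel sets by inner
  regularity of arc length; so a bounded sequence whose Fourier coefficients tend to \<open>0\<close> has
  integrals tending to \<open>0\<close> over every Borel set.\<close>

lemma weakly_null_integral_borel:
  assumes h: "weakly_null h" and B [measurable]: "B \<in> sets borel"
  shows "(\<lambda>k. LINT z|circle_measure. of_real (indicator B z) * h k z) \<longlonglongrightarrow> 0"
proof (rule weakly_null_integral_approx[OF h])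
  show "integrable circle_measure (indicat_real B)"
    by (rule circle_integrable_bounded_real[where C = 1]) auto
  fix e :: real assume "e > 0"
  have "\<exists>K. K \<subseteq> B \<and> compact K \<and> measure circle_measure B < measure circle_measure K + e"
  proof (rule ccontr)
    assume "\<not> ?thesis"
    then have le: "measure circle_measure K \<le> measure circle_measure B - e" if "K \<subseteq> B" "compact K" for K
      using that by force
    from le[of "{}"] have pos: "0 \<le> measure circle_measure B - e" by simp
    have "emeasure circle_measure B = (SUP K \<in> {K. K \<subseteq> B \<and> compact K}. emeasure circle_measure K)"
      by (rule inner_regular) auto
    also have "\<dots> \<le> ennreal (measure circle_measure B - e)"
      by (rule SUP_least) (auto simp: circle.emeasure_eq_measure intro!: ennreal_leI le)
    finally show False
      using pos \<open>e > 0\<close> by (simp add: circle.emeasure_eq_measure)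
  qed
  then obtain K where K: "K \<subseteq> B" "compact K" "measure circle_measure B < measure circle_measure K + e"
    by blast
  have [measurable]: "K \<in> sets borel" using K(2) compact_imp_closed borel_closed by blast
  have "(LINT z|circle_measure. \<bar>indicat_real B z - indicator K z\<bar>) = (LINT z|circle_measure. indicat_real B z - indicator K z)"
    using K(1) by (intro Bochner_Integration.integral_cong) (auto simp: indicator_def)
  also have "\<dots> = measure circle_measure B - measure circle_measure K"
    by (subst Bochner_Integration.integral_diff) (auto intro: circle_integrable_bounded_real[where C = 1])
  also have "\<dots> < e" using K(3) by simp
  finally show "\<exists>g'. integrable circle_measure g' \<and>
        (LINT z|circle_measure. \<bar>indicator B z - g' z\<bar>) < e \<and>
        (\<lambda>k. LINT z|circle_measure. of_real (g' z) * h k z) \<longlonglongrightarrow> 0"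
    using weakly_null_integral_compact[OF h K(2)]
    by (intro exI[of _ "indicat_real K"]) (auto intro: circle_integrable_bounded_real[where C = 1])
qed


section \<open>Bounded functions with prescribed Fourier coefficients\<close>

lemma integral_circle_powi_sum:
  fixes c :: "int \<Rightarrow> complex"
  assumes "finite A"
  shows "(LINT z|circle_measure. (\<Sum>n\<in>A. c n * z powi n) * z powi m)
    = (if -m \<in> A then 2 * pi * c (-m) else 0)"
proof -
  have int: "integrable circle_measure (\<lambda>z. z powi n)" for n
    by (rule circle_integrable_bounded[where C = 1])
      (use AE_circle_norm in \<open>auto simp: norm_power_int elim: eventually_mono\<close>)
  have "(LINT z|circle_measure. (\<Sum>n\<in>A. c n * z powi n) * z powi m)
      = (LINT z|circle_measure. (\<Sum>n\<in>A. c n * z powi (n + m)))"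
  proof (rule integral_cong_AE)
    show "AE z in circle_measure. (\<Sum>n\<in>A. c n * z powi n) * z powi m = (\<Sum>n\<in>A. c n * z powi (n + m))"
      using AE_circle_norm
    proof eventually_elim
      case (elim z)
      then have "z \<noteq> 0" by auto
      then show ?case
        by (simp add: sum_distrib_right power_int_add mult.assoc)
    qed
  qed measurable
  also have "\<dots> = (\<Sum>n\<in>A. c n * (LINT z|circle_measure. z powi (n + m)))"
    using int by (subst Bochner_Integration.integral_sum) auto
  also have "\<dots> = (\<Sum>n\<in>A. if n = -m then 2 * pi * c (-m) else 0)"
    by (intro sum.cong) (auto simp: integral_circle_powi add_eq_0_iff2)
  also have "\<dots> = (if -m \<in> A then 2 * pi * c (-m) else 0)"
    using assms by (simp add: sum.delta)
  finally show ?thesis .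
qed

lemma circle_parseval:
  fixes c :: "int \<Rightarrow> complex"
  assumes "finite A"
  shows "(LINT z|circle_measure. (cmod (\<Sum>n\<in>A. c n * z powi n))\<^sup>2) = 2 * pi * (\<Sum>n\<in>A. (cmod (c n))\<^sup>2)"
proof -
  let ?u = "\<lambda>z. \<Sum>n\<in>A. c n * z powi n"
  have int: "integrable circle_measure (\<lambda>z. ?u z * z powi m)" for m
  proof (rule circle_integrable_bounded[where C = "\<Sum>n\<in>A. cmod (c n)"])
    show "AE z in circle_measure. cmod (?u z * z powi m) \<le> (\<Sum>n\<in>A. cmod (c n))"
      using AE_circle_norm
      by eventually_elim
        (auto simp: norm_mult norm_power_int intro!: order_trans[OF norm_sum])
  qed measurable
  have "complex_of_real (LINT z|circle_measure. (cmod (?u z))\<^sup>2)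
      = (LINT z|circle_measure. complex_of_real ((cmod (?u z))\<^sup>2))"
    by (rule integral_complex_of_real[symmetric])
  also have "\<dots> = (LINT z|circle_measure. (\<Sum>m\<in>A. cnj (c m) * (?u z * z powi (-m))))"
  proof (rule integral_cong_AE)
    show "AE z in circle_measure. complex_of_real ((cmod (?u z))\<^sup>2)
        = (\<Sum>m\<in>A. cnj (c m) * (?u z * z powi (-m)))"
      using AE_circle_norm
    proof eventually_elim
      case (elim z)
      have inv: "cnj (z powi n) = z powi (-n)" for n
      proof -
        have "cnj z = inverse z"
          using elim by (simp add: inverse_complex_def complex_eq_iff cmod_def)
        then show ?thesis by (simp add: power_int_minus power_int_inverse)
      qed
      have "complex_of_real ((cmod (?u z))\<^sup>2) = ?u z * cnj (?u z)"
        by (rule complex_norm_square)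
      also have "cnj (?u z) = (\<Sum>m\<in>A. cnj (c m) * z powi (-m))"
        by (simp only: cnj_sum complex_cnj_mult inv)
      finally show ?case by (simp add: sum_distrib_left mult_ac)
    qed
  qed measurable
  also have "\<dots> = (\<Sum>m\<in>A. cnj (c m) * (LINT z|circle_measure. ?u z * z powi (-m)))"
    using int by (subst Bochner_Integration.integral_sum) auto
  also have "\<dots> = (\<Sum>m\<in>A. cnj (c m) * (2 * pi * c m))"
    by (intro sum.cong) (simp_all add: integral_circle_powi_sum[OF assms])
  also have "\<dots> = complex_of_real (2 * pi * (\<Sum>n\<in>A. (cmod (c n))\<^sup>2))"
    by (simp add: sum_distrib_left mult_ac complex_norm_square[unfolded of_real_power])
  finally show ?thesis by (simp only: of_real_eq_iff)
qed

lemma sum_tail_small: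
  fixes q :: "'a \<Rightarrow> real"
  assumes q: "\<And>n. 0 \<le> q n" and bd: "\<And>A. finite A \<Longrightarrow> sum q A \<le> S" and "e > 0"
  obtains A where "finite A" "\<And>B. finite B \<Longrightarrow> sum q (B - A) < e"
proof -
  define s where "s = (SUP A\<in>{A. finite A}. sum q A)"
  have bdd: "bdd_above (sum q ` {A. finite A})"
    using bd by (auto intro!: bdd_aboveI[of _ S])
  have "\<exists>A\<in>{A. finite A}. s - e < sum q A"
    using \<open>e > 0\<close> bdd unfolding s_def by (subst less_cSUP_iff[symmetric]) auto
  then obtain A where A: "finite A" "s - e < sum q A" by auto
  show thesis
  proof (rule that[OF A(1)])
    fix B :: "'a set" assume B: "finite B"
    have "sum q (B - A) + sum q A = sum q (B \<union> A)"
      using A(1) B by (subst sum.union_disjoint[symmetric]) auto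
    also have "\<dots> \<le> s"
      unfolding s_def using A(1) B bdd by (intro cSUP_upper) auto
    finally show "sum q (B - A) < e" using A(2) by simp
  qed
qed

text \<open>The weighted sums are bounded in \<open>L\<^sup>2\<close>, so the coefficients are square summable; then the
  weighted sums are Cauchy in \<open>L\<^sup>1\<close>, and a subsequence converges almost everywhere.  The limit
  inherits the bound and, by dominated convergence, the Fourier coefficients.\<close>

lemma bounded_function_of_bounded_means:
  fixes a :: cseq and w :: "nat \<Rightarrow> int \<Rightarrow> real"
  assumes w: "\<And>k n. 0 \<le> w k n" "\<And>k n. w k n \<le> 1"
    and w_supp: "\<And>k n. w k n \<noteq> 0 \<Longrightarrow> n \<in> {- int k..int k}"
    and w_lim: "\<And>n. (\<lambda>k. w k n) \<longlonglongrightarrow> 1"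
    and bd: "\<And>k z. cmod z = 1 \<Longrightarrow> cmod (\<Sum>n\<in>{- int k..int k}. (w k n * a n) * z powi n) \<le> C"
  obtains f where "f \<in> circle_Linf" "\<And>n. fourier_coeff f n = a n"
proof -
  define u where "u k z = (\<Sum>n\<in>{- int k..int k}. (w k n * a n) * z powi n)" for k z
  define q where "q n = (cmod (a n))\<^sup>2" for n
  have um [measurable]: "u k \<in> borel_measurable borel" for k
    unfolding u_def by measurable
  have ub: "AE z in circle_measure. cmod (u k z) \<le> C" for k
    using AE_circle_norm by eventually_elim (simp add: u_def bd)
  have u_extend: "u k z = (\<Sum>n\<in>{- int m..int m}. (w k n * a n) * z powi n)" if "k \<le> m" for k m z
    unfolding u_def using that w_supp[of k] by (intro sum.mono_neutral_left) force+
  have q0: "0 \<le> q n" for n by (simp add: q_def)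
  have q_sum: "sum q A \<le> C\<^sup>2" if A: "finite A" for A
  proof -
    have "(\<Sum>n\<in>A. (w k n)\<^sup>2 * q n) \<le> C\<^sup>2" for k
    proof -
      have "(\<Sum>n\<in>A. (w k n)\<^sup>2 * q n) = (\<Sum>n\<in>A \<inter> {- int k..int k}. (w k n)\<^sup>2 * q n)"
        using A w_supp[of k] by (intro sum.mono_neutral_right) auto
      also have "\<dots> \<le> (\<Sum>n\<in>{- int k..int k}. (w k n)\<^sup>2 * q n)"
        by (intro sum_mono2) (auto simp: q0)
      also have "2 * pi * \<dots> = (LINT z|circle_measure. (cmod (u k z))\<^sup>2)"
        unfolding u_def by (subst circle_parseval) (auto simp: q_def norm_mult power_mult_distrib)
      also have "\<dots> \<le> (LINT z|circle_measure. C\<^sup>2)"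
      proof (rule integral_mono_AE)
        show b: "AE z in circle_measure. (cmod (u k z))\<^sup>2 \<le> C\<^sup>2"
          using ub[of k] by eventually_elim (auto intro: power_mono)
        show "integrable circle_measure (\<lambda>z. (cmod (u k z))\<^sup>2)"
          by (rule circle_integrable_bounded_real[where C = "C\<^sup>2"]) (use b in auto)
      qed auto
      finally have "2 * pi * (\<Sum>n\<in>A. (w k n)\<^sup>2 * q n) \<le> 2 * pi * C\<^sup>2"
        by (simp add: measure_circle_measure_UNIV)
      then show ?thesis by simp
    qed
    moreover have "(\<lambda>k. \<Sum>n\<in>A. (w k n)\<^sup>2 * q n) \<longlonglongrightarrow> (\<Sum>n\<in>A. 1\<^sup>2 * q n)"
      by (intro tendsto_intros w_lim)
    ultimately show ?thesis
      by (intro LIMSEQ_le_const2) auto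
  qed
  have u_int: "integrable circle_measure (u k)" for k
    by (rule circle_integrable_bounded[OF um ub])
  have "\<exists>K. \<forall>i\<ge>K. \<forall>j\<ge>K. (LINT z|circle_measure. cmod (u i z - u j z)) < e" if "e > 0" for e
  proof -
    define d where "d = e / (4 * pi)"
    have "d > 0" using \<open>e > 0\<close> by (simp add: d_def)
    obtain A where A: "finite A" "\<And>B. finite B \<Longrightarrow> sum q (B - A) < d\<^sup>2 / 2"
      using sum_tail_small[of q "C\<^sup>2" "d\<^sup>2 / 2"] q0 q_sum \<open>d > 0\<close> by auto
    have "(\<lambda>k. \<Sum>n\<in>A. (1 - w k n) * q n) \<longlonglongrightarrow> (\<Sum>n\<in>A. (1 - 1) * q n)"
      by (intro tendsto_intros w_lim)
    then have "eventually (\<lambda>k. (\<Sum>n\<in>A. (1 - w k n) * q n) < d\<^sup>2 / 4) sequentially"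
      using \<open>d > 0\<close> by (intro order_tendstoD) auto
    then obtain K where K: "\<And>k. k \<ge> K \<Longrightarrow> (\<Sum>n\<in>A. (1 - w k n) * q n) < d\<^sup>2 / 4"
      by (auto simp: eventually_sequentially)
    have "(LINT z|circle_measure. cmod (u i z - u j z)) < e" if ij: "i \<ge> K" "j \<ge> K" for i j
    proof -
      define m where "m = max i j"
      let ?M = "{- int m..int m}"
      have diff: "u i z - u j z = (\<Sum>n\<in>?M. (of_real (w i n - w j n) * a n) * z powi n)" for z
        by (simp add: u_extend[of i m] u_extend[of j m] m_def sum_subtractf algebra_simps)
      have wdiff: "(w i n - w j n)\<^sup>2 \<le> (1 - w i n) + (1 - w j n)" for n
      proof -
        have "\<bar>w i n - w j n\<bar> \<le> 1" using w(1)[of i n] w(1)[of j n] w(2)[of i n] w(2)[of j n] by linarith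
        then have "(w i n - w j n)\<^sup>2 \<le> \<bar>w i n - w j n\<bar>"
          by (metis abs_ge_zero mult_left_le power2_abs power2_eq_square)
        then show ?thesis
          using w(1)[of i n] w(1)[of j n] w(2)[of i n] w(2)[of j n] by linarith
      qed
      have wdiff1: "(w i n - w j n)\<^sup>2 \<le> 1" for n
        using w(1)[of i n] w(1)[of j n] w(2)[of i n] w(2)[of j n]
        by (intro abs_square_le_1[THEN iffD2]) linarith
      have "(\<Sum>n\<in>?M. (w i n - w j n)\<^sup>2 * q n)
          = (\<Sum>n\<in>?M \<inter> A. (w i n - w j n)\<^sup>2 * q n) + (\<Sum>n\<in>?M - A. (w i n - w j n)\<^sup>2 * q n)"
        by (subst sum.union_disjoint[symmetric]) (auto intro!: sum.cong)
      also have "(\<Sum>n\<in>?M \<inter> A. (w i n - w j n)\<^sup>2 * q n) \<le> (\<Sum>n\<in>A. ((1 - w i n) + (1 - w j n)) * q n)"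
      proof -
        have "(\<Sum>n\<in>?M \<inter> A. (w i n - w j n)\<^sup>2 * q n) \<le> (\<Sum>n\<in>?M \<inter> A. ((1 - w i n) + (1 - w j n)) * q n)"
          by (intro sum_mono mult_right_mono wdiff q0)
        also have "\<dots> \<le> (\<Sum>n\<in>A. ((1 - w i n) + (1 - w j n)) * q n)"
          using A(1) w by (intro sum_mono2 mult_nonneg_nonneg add_nonneg_nonneg q0) auto
        finally show ?thesis .
      qed
      also have "\<dots> = (\<Sum>n\<in>A. (1 - w i n) * q n) + (\<Sum>n\<in>A. (1 - w j n) * q n)"
        by (simp only: sum.distrib distrib_right)
      also have "\<dots> < d\<^sup>2 / 4 + d\<^sup>2 / 4"
        by (intro add_strict_mono K ij)
      also have "(\<Sum>n\<in>?M - A. (w i n - w j n)\<^sup>2 * q n) \<le> sum q (?M - A)"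
        using mult_right_mono[OF wdiff1 q0] by (intro sum_mono) simp
      also have "\<dots> < d\<^sup>2 / 2" by (rule A(2)) simp
      finally have small: "(\<Sum>n\<in>?M. (w i n - w j n)\<^sup>2 * q n) < d\<^sup>2" by simp
      have L2: "(LINT z|circle_measure. (cmod (u i z - u j z))\<^sup>2) < 2 * pi * d\<^sup>2"
        unfolding diff by (subst circle_parseval)
          (use small in \<open>auto simp: q_def norm_mult power_mult_distrib simp del: of_real_diff\<close>)
      have ubd: "AE z in circle_measure. cmod (u i z - u j z) \<le> 2 * C"
        using ub[of i] ub[of j] by eventually_elim (rule order_trans[OF norm_triangle_ineq4], simp)
      have sq_int: "integrable circle_measure (\<lambda>z. (cmod (u i z - u j z))\<^sup>2)"
      proof (rule circle_integrable_bounded_real[where C = "(2 * C)\<^sup>2"])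
        show "AE z in circle_measure. \<bar>(cmod (u i z - u j z))\<^sup>2\<bar> \<le> (2 * C)\<^sup>2"
          using ubd by eventually_elim (simp only: abs_power2, rule power_mono, auto)
      qed measurable
      (* This inequality takes the place of Cauchy-Schwarz in passing from L2 to L1. *)
      have "cmod (u i z - u j z) \<le> d / 2 + (cmod (u i z - u j z))\<^sup>2 / (2 * d)" for z
      proof -
        have "0 \<le> (cmod (u i z - u j z) - d)\<^sup>2" by simp
        then show ?thesis using \<open>d > 0\<close> by (simp add: field_simps power2_eq_square)
      qed
      then have "(LINT z|circle_measure. cmod (u i z - u j z))
          \<le> (LINT z|circle_measure. d / 2 + (cmod (u i z - u j z))\<^sup>2 / (2 * d))"
        using u_int sq_int by (intro integral_mono) auto
      also have "\<dots> = pi * d + (LINT z|circle_measure. (cmod (u i z - u j z))\<^sup>2) / (2 * d)"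
        using sq_int by (simp add: measure_circle_measure_UNIV)
      also have "\<dots> < pi * d + (2 * pi * d\<^sup>2) / (2 * d)"
        using L2 \<open>d > 0\<close> by (intro add_strict_left_mono divide_strict_right_mono) auto
      also have "\<dots> = e / 2" using \<open>d > 0\<close> by (simp add: d_def field_simps power2_eq_square)
      also have "\<dots> < e" using \<open>e > 0\<close> by simp
      finally show ?thesis .
    qed
    then show ?thesis by blast
  qed
  then obtain r where r: "strict_mono r" "AE z in circle_measure. Cauchy (\<lambda>i. u (r i) z)"
    using cauchy_L1_AE_cauchy_subseq[of circle_measure u, OF u_int] by blast
  define f where "f z = lim (\<lambda>i. u (r i) z)" for z
  have fm [measurable]: "f \<in> borel_measurable borel"
    unfolding f_def by measurable
  have f_lim: "AE z in circle_measure. (\<lambda>i. u (r i) z) \<longlonglongrightarrow> f z"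
    using r(2)
  proof eventually_elim
    case (elim z)
    then have "convergent (\<lambda>i. u (r i) z)" by (rule Cauchy_convergent)
    then show ?case unfolding f_def by (simp only: convergent_LIMSEQ_iff)
  qed
  have ub': "AE z in circle_measure. \<forall>i. cmod (u (r i) z) \<le> C"
    using ub by (simp add: AE_all_countable)
  have "AE z in circle_measure. cmod (f z) \<le> C"
    using ub' f_lim by eventually_elim (rule LIMSEQ_le_const2[OF tendsto_norm], auto)
  then have "f \<in> circle_Linf" by (auto simp: circle_Linf_def)
  moreover have "fourier_coeff f n = a n" for n
  proof -
    have "(\<lambda>i. LINT z|circle_measure. u (r i) z * z powi (-n)) \<longlonglongrightarrow> (LINT z|circle_measure. f z * z powi (-n))"
    proof (rule integral_dominated_convergence[where w = "\<lambda>_. C"])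
      show "AE z in circle_measure. (\<lambda>i. u (r i) z * z powi (-n)) \<longlonglongrightarrow> f z * z powi (-n)"
        using f_lim by eventually_elim (intro tendsto_intros)
      show "AE z in circle_measure. norm (u (r i) z * z powi (-n)) \<le> C" for i
        using ub[of "r i"] AE_circle_norm
        by eventually_elim (simp add: norm_mult norm_power_int norm_inverse)
    qed auto
    moreover have "(\<lambda>i. LINT z|circle_measure. u (r i) z * z powi (-n)) \<longlonglongrightarrow> 2 * pi * (1 * a n)"
    proof (rule Lim_transform_eventually)
      have "(\<lambda>i. w (r i) n) \<longlonglongrightarrow> 1"
        using LIMSEQ_subseq_LIMSEQ[OF w_lim[of n] r(1)] by (simp add: o_def)
      from tendsto_of_real[OF this]
      show "(\<lambda>i. 2 * pi * (complex_of_real (w (r i) n) * a n)) \<longlonglongrightarrow> 2 * pi * (1 * a n)"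
        by (intro tendsto_intros) simp
      show "\<forall>\<^sub>F i in sequentially. 2 * pi * (complex_of_real (w (r i) n) * a n)
          = (LINT z|circle_measure. u (r i) z * z powi (-n))"
        unfolding u_def integral_circle_powi_sum[OF finite_atLeastAtMost_int]
        using w_supp[of _ n] by (auto intro!: always_eventually)
    qed
    ultimately have "(LINT z|circle_measure. f z * z powi (-n)) = 2 * pi * a n"
      using LIMSEQ_unique by fastforce
    then show ?thesis by (simp add: fourier_coeff_def)
  qed
  ultimately show thesis by (rule that)
qed

section \<open>Essential range\<close>

text \<open>The complement of the essential range is a union of discs with null preimage, and countably
  many of them cover it.\<close>

lemma AE_essential_range:
  fixes f :: "complex \<Rightarrow> complex"
  assumes f [measurable]: "f \<in> borel_measurable borel"
  shows "AE z in circle_measure. f z \<in> essential_range circle_measure f"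
proof -
  define \<F> where "\<F> = {ball w e |w e. emeasure circle_measure {z. f z \<in> ball w e} = 0}"
  obtain \<F>' where F': "\<F>' \<subseteq> \<F>" "countable \<F>'" "\<Union>\<F>' = \<Union>\<F>"
    using Lindelof[of \<F>] by (auto simp: \<F>_def)
  have "AE z in circle_measure. \<forall>U\<in>\<F>'. f z \<notin> U"
  proof (rule AE_ball_countable[OF F'(2), THEN iffD2], rule)
    fix U assume "U \<in> \<F>'"
    then obtain w e where U: "U = ball w e" "emeasure circle_measure {z. f z \<in> ball w e} = 0"
      using F'(1) by (auto simp: \<F>_def)
    show "AE z in circle_measure. f z \<notin> U"
      by (rule AE_I[where N = "{z. f z \<in> ball w e}"]) (use U in auto)
  qed
  then show ?thesis
  proof eventually_elim
    case (elim z)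
    then have "f z \<notin> \<Union>\<F>" using F'(3) by blast
    have "emeasure circle_measure {y. f y \<in> ball (f z) e} \<noteq> 0" if "e > 0" for e
    proof
      assume "emeasure circle_measure {y. f y \<in> ball (f z) e} = 0"
      then have "ball (f z) e \<in> \<F>" unfolding \<F>_def by blast
      then show False using \<open>f z \<notin> \<Union>\<F>\<close> \<open>e > 0\<close> by (meson UnionI centre_in_ball)
    qed
    moreover have "{y. f y \<in> ball (f z) e} = {y. dist (f y) (f z) < e}" for e
      by (auto simp: dist_commute)
    ultimately show ?case
      by (simp add: essential_range_def zero_less_iff_neq_zero)
  qed
qed

text \<open>An open subset of the circle that is not empty contains an arc.  The arc is taken to the
  right of the argument of \<open>z\<close> in \<open>[0, 2\<pi>)\<close>, where it does not leave the interval.\<close>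

lemma AE_circle_closedD:
  assumes F: "closed F" and ae: "AE z in circle_measure. z \<in> F" and z: "cmod z = 1"
  shows "z \<in> F"
proof (rule ccontr)
  assume "z \<notin> F"
  define t where "t = Arg2pi z"
  have t: "0 \<le> t" "t < 2 * pi" "cis t = z"
    using Arg2pi[of z] Arg2pi_eq[of z] z by (auto simp: t_def cis_conv_exp)
  have "open (cis -` (- F))"
    using F by (intro open_vimage continuous_intros) (auto simp: open_closed)
  then obtain d where d: "d > 0" "\<And>s. \<bar>s - t\<bar> < d \<Longrightarrow> cis s \<notin> F"
    using t(3) \<open>z \<notin> F\<close> unfolding open_dist by (force simp: dist_real_def)
  define b where "b = min (t + d / 2) (2 * pi)"
  have [measurable]: "F \<in> sets borel" using F by (rule borel_closed)
  have "ennreal (b - t) = emeasure lborel {t..b}"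
    using d(1) t by (simp add: b_def)
  also have "\<dots> \<le> emeasure lborel (cis -` (- F) \<inter> {0..2 * pi})"
  proof (rule emeasure_mono)
    show "{t..b} \<subseteq> cis -` (- F) \<inter> {0..2 * pi}"
      using d t by (auto simp: b_def)
    show "cis -` (- F) \<inter> {0..2 * pi} \<in> sets lborel"
      using measurable_sets[OF cis_measurable, of "- F"] by auto
  qed
  also have "\<dots> = emeasure circle_measure (- F)"
    by (rule emeasure_circle_measure[symmetric]) auto
  also have "\<dots> = 0"
    using ae by (subst (asm) AE_iff_measurable[of "- F"]) auto
  finally show False using d(1) t by (auto simp: b_def ennreal_eq_0_iff)
qed

lemma infsum_tendsto_dominated:
  fixes F :: "nat \<Rightarrow> int \<Rightarrow> complex"
  assumes g: "g summable_on UNIV" and le: "\<And>k n. cmod (F k n) \<le> g n"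
    and lim: "\<And>n. (\<lambda>k. F k n) \<longlonglongrightarrow> G n"
  shows "(\<lambda>k. \<Sum>\<^sub>\<infinity>n. F k n) \<longlonglongrightarrow> (\<Sum>\<^sub>\<infinity>n. G n)"
proof -
  have gi: "integrable (count_space UNIV) g"
    using iffD1[OF abs_summable_equivalent iffD1[OF summable_on_iff_abs_summable_on_real g]]
    unfolding Infinite_Set_Sum.abs_summable_on_def .
  have Gle: "cmod (G n) \<le> g n" for n
    by (rule LIMSEQ_le_const2[OF tendsto_norm[OF lim]]) (use le in auto)
  have eq: "(\<Sum>\<^sub>\<infinity>n. f n) = (LINT n|count_space UNIV. f n)"
    if "\<And>n. cmod (f n) \<le> g n" for f :: "int \<Rightarrow> complex"
  proof -
    have "norm (f n) \<le> norm (g n)" for n using that[of n] norm_ge_zero[of "f n"] by simp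
    then have "integrable (count_space UNIV) f"
      by (intro Bochner_Integration.integrable_bound[OF gi] AE_I2) auto
    then have "Infinite_Set_Sum.abs_summable_on f UNIV"
      by (simp add: Infinite_Set_Sum.abs_summable_on_def)
    from infsetsum_infsum[OF this] show ?thesis by (simp add: infsetsum_def)
  qed
  have "(\<lambda>k. LINT n|count_space UNIV. F k n) \<longlonglongrightarrow> (LINT n|count_space UNIV. G n)"
    by (rule integral_dominated_convergence[OF _ _ gi]) (use le lim in auto)
  then show ?thesis using eq[of "F _"] eq[of G] le Gle by simp
qed


section \<open>Convolution by finite sequences\<close>

definition translate :: "int \<Rightarrow> cseq \<Rightarrow> cseq" where
  "translate s x = (\<lambda>n. x (n - s))"

definition single :: "int \<Rightarrow> cseq" where
  "single j = (\<lambda>n. if n = j then 1 else 0)"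

lemma shift_eq_translate: "shift = translate 1"
  by (auto simp: shift_def translate_def)

lemma unshift_eq_translate: "unshift = translate (-1)"
  by (auto simp: unshift_def translate_def)

lemma unit_seq_eq_single: "unit_seq = single 0"
  by (auto simp: unit_seq_def single_def)

lemma translate_translate [simp]: "translate s (translate t x) = translate (s + t) x"
  by (auto simp: translate_def algebra_simps)

lemma translate_0 [simp]: "translate 0 x = x"
  by (simp add: translate_def)

lemma translate_add: "translate s (x + y) = translate s x + translate s y"
  by (auto simp: translate_def)

lemma translate_diff: "translate s (x - y) = translate s x - translate s y"
  by (auto simp: translate_def)

lemma translate_cscale: "translate s (cscale c x) = cscale c (translate s x)"
  by (auto simp: translate_def cscale_def)

lemma translate_single [simp]: "translate s (single j) = single (s + j)"
  by (auto simp: translate_def single_def)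

lemma translate_zero [simp]: "translate s 0 = 0"
  by (auto simp: translate_def)

lemma translate_inject: "translate s x = translate s y \<longleftrightarrow> x = y"
  by (metis translate_0 translate_translate add.left_inverse)

lemma finseq_subspace: "cseq.subspace finseq"
proof -
  have "{n. x n + y n \<noteq> (0::complex)} \<subseteq> {n. x n \<noteq> 0} \<union> {n. y n \<noteq> 0}" for x y :: cseq
    by auto
  moreover have "{n. c * x n \<noteq> 0} \<subseteq> {n. x n \<noteq> 0}" for c :: complex and x :: cseq
    by auto
  ultimately show ?thesis
    by (auto simp: cseq.subspace_def finseq_def cscale_def intro: finite_subset)
qed

lemmas finseq_0 [simp] = cseq.subspace_0[OF finseq_subspace]
lemmas finseq_add [intro] = cseq.subspace_add[OF finseq_subspace]
lemmas finseq_cscale [intro] = cseq.subspace_scale[OF finseq_subspace]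
lemmas finseq_diff [intro] = cseq.subspace_diff[OF finseq_subspace]

lemma finseq_single [simp]: "single j \<in> finseq"
  by (simp add: finseq_def single_def)

lemma finseq_translate [intro]: "x \<in> finseq \<Longrightarrow> translate s x \<in> finseq"
proof -
  have "{n. translate s x n \<noteq> 0} = (\<lambda>n. n + s) ` {n. x n \<noteq> 0}"
    by (force simp: translate_def image_iff)
  then show "x \<in> finseq \<Longrightarrow> translate s x \<in> finseq" by (simp add: finseq_def)
qed

lemma finseq_window:
  assumes "x \<in> finseq"
  obtains k :: nat where "\<And>n. x n \<noteq> 0 \<Longrightarrow> \<bar>n\<bar> \<le> int k"
proof -
  have "finite ((\<lambda>n. nat \<bar>n\<bar>) ` {n. x n \<noteq> 0})" using assms by (simp add: finseq_def)
  then obtain k where "\<And>n. x n \<noteq> 0 \<Longrightarrow> nat \<bar>n\<bar> \<le> k"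
    unfolding finite_nat_set_iff_bounded_le by blast
  then show thesis by (intro that[of k]) force
qed

lemma finseq_induct [consumes 1, case_names zero add]:
  assumes "x \<in> finseq" "P 0"
    and step: "\<And>x j c. x \<in> finseq \<Longrightarrow> P x \<Longrightarrow> P (x + cscale c (single j))"
  shows "P x"
proof -
  have "P x" if "finite A" "{n. x n \<noteq> 0} \<subseteq> A" for A x
    using that
  proof (induction A arbitrary: x rule: finite_induct)
    case empty
    then have "x = 0" by (auto simp: fun_eq_iff)
    then show ?case using assms(2) by metis
  next
    case (insert j A)
    let ?y = "\<lambda>n. if n = j then 0 else x n"
    have y: "{n. ?y n \<noteq> 0} \<subseteq> A" using insert.prems by auto
    have "?y \<in> finseq" unfolding finseq_def using insert.hyps(1) y finite_subset by blast
    moreover have "x = ?y + cscale (x j) (single j)"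
      by (auto simp: fun_eq_iff cscale_def single_def)
    ultimately show ?case using step[OF _ insert.IH[OF y]] by metis
  qed
  then show ?thesis using assms(1) by (auto simp: finseq_def)
qed

lemma conv_eq_sum:
  assumes "finite A" "\<And>k. \<phi> k \<noteq> 0 \<Longrightarrow> k \<in> A"
  shows "conv \<phi> f n = (\<Sum>k\<in>A. \<phi> k * f (n - k))"
  unfolding conv_def using assms by (intro sum.mono_neutral_left) auto

lemma conv_add_left:
  assumes "\<phi> \<in> finseq" "\<psi> \<in> finseq"
  shows "conv (\<phi> + \<psi>) f = conv \<phi> f + conv \<psi> f"
proof
  fix n
  let ?A = "{k. \<phi> k \<noteq> 0} \<union> {k. \<psi> k \<noteq> 0}"
  have "finite ?A" using assms by (simp add: finseq_def)
  then show "conv (\<phi> + \<psi>) f n = (conv \<phi> f + conv \<psi> f) n"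
    using conv_eq_sum[of ?A \<phi> f n] conv_eq_sum[of ?A \<psi> f n]
    by (subst conv_eq_sum[of ?A]) (auto simp: sum.distrib distrib_right)
qed

lemma conv_cscale_left: "\<phi> \<in> finseq \<Longrightarrow> conv (cscale c \<phi>) f = cscale c (conv \<phi> f)"
proof
  fix n assume "\<phi> \<in> finseq"
  then have "finite {k. \<phi> k \<noteq> 0}" by (simp add: finseq_def)
  from conv_eq_sum[OF this, of "cscale c \<phi>" f n] conv_eq_sum[OF this, of \<phi> f n]
  show "conv (cscale c \<phi>) f n = cscale c (conv \<phi> f) n"
    by (auto simp: cscale_def sum_distrib_left mult.assoc)
qed

lemma conv_diff_left:
  assumes "\<phi> \<in> finseq" "\<psi> \<in> finseq"
  shows "conv (\<phi> - \<psi>) f = conv \<phi> f - conv \<psi> f"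
  using conv_add_left[OF finseq_diff[OF assms] assms(2), of f] by simp

lemma conv_single [simp]: "conv (single j) f = translate j f"
proof
  fix n
  show "conv (single j) f n = translate j f n"
    by (subst conv_eq_sum[of "{j}"]) (simp_all add: translate_def single_def split: if_splits)
qed

lemma conv_zero_left [simp]: "conv 0 f = 0"
  by (rule ext) (simp add: conv_def)

lemma conv_zero_right [simp]: "conv \<phi> 0 = 0"
  by (rule ext) (simp add: conv_def)

lemma conv_add_right: "conv \<phi> (f + g) = conv \<phi> f + conv \<phi> g"
  by (rule ext) (simp add: conv_def sum.distrib distrib_left)

lemma conv_diff_right: "conv \<phi> (f - g) = conv \<phi> f - conv \<phi> g"
  by (rule ext) (simp add: conv_def sum_subtractf right_diff_distrib)

lemma conv_cscale_right: "conv \<phi> (cscale c f) = cscale c (conv \<phi> f)"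
  by (rule ext) (simp add: conv_def cscale_def sum_distrib_left mult_ac)

lemma conv_translate_right: "conv \<phi> (translate j f) = translate j (conv \<phi> f)"
  by (rule ext) (simp add: conv_def translate_def algebra_simps)

lemmas conv_step = conv_add_left conv_cscale_left finseq_cscale

lemma conv_translate_left:
  assumes "\<phi> \<in> finseq"
  shows "conv (translate j \<phi>) f = translate j (conv \<phi> f)"
  by (rule finseq_induct[where P = "\<lambda>\<phi>. conv (translate j \<phi>) f = translate j (conv \<phi> f)", OF assms])
    (simp_all add: conv_step translate_add translate_cscale finseq_translate)

lemma conv_finseq [intro]: "\<phi> \<in> finseq \<Longrightarrow> \<psi> \<in> finseq \<Longrightarrow> conv \<phi> \<psi> \<in> finseq"
  by (rule finseq_induct[where P = "\<lambda>\<phi>. conv \<phi> \<psi> \<in> finseq"]) (auto simp: conv_step)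

lemma conv_assoc:
  assumes "\<phi> \<in> finseq" "\<psi> \<in> finseq"
  shows "conv (conv \<phi> \<psi>) f = conv \<phi> (conv \<psi> f)"
  by (rule finseq_induct[where P = "\<lambda>\<phi>. conv (conv \<phi> \<psi>) f = conv \<phi> (conv \<psi> f)", OF assms(1)])
    (simp_all add: conv_step conv_finseq assms(2) conv_translate_left finseq_translate)

lemma conv_commute:
  assumes "\<phi> \<in> finseq" "\<psi> \<in> finseq"
  shows "conv \<phi> \<psi> = conv \<psi> \<phi>"
proof -
  have s0: "conv \<psi> (single j) = translate j \<psi>" for j
  proof -
    have "conv \<psi> (single 0) = \<psi>"
    proof
      fix n
      show "conv \<psi> (single 0) n = \<psi> n"
        using assms(2) by (subst conv_eq_sum[of "insert n {k. \<psi> k \<noteq> 0}"])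
          (auto simp: finseq_def single_def if_distrib cong: if_cong)
    qed
    then show ?thesis by (metis add.right_neutral conv_translate_right translate_single)
  qed
  show ?thesis
    by (rule finseq_induct[where P = "\<lambda>\<phi>. conv \<phi> \<psi> = conv \<psi> \<phi>", OF assms(1)])
      (simp_all add: conv_step conv_add_right conv_cscale_right s0)
qed

lemma laurent_eq_sum:
  assumes "finite A" "\<And>n. a n \<noteq> 0 \<Longrightarrow> n \<in> A"
  shows "laurent a z = (\<Sum>n\<in>A. a n * z powi n)"
proof -
  have "laurent a z = infsum (\<lambda>n. a n * z powi n) A"
    unfolding laurent_def using assms(2) by (intro infsum_cong_neutral) auto
  then show ?thesis using assms(1) by simp
qed

lemma laurent_add:
  assumes "\<phi> \<in> finseq" "\<psi> \<in> finseq"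
  shows "laurent (\<phi> + \<psi>) z = laurent \<phi> z + laurent \<psi> z"
proof -
  let ?A = "{k. \<phi> k \<noteq> 0} \<union> {k. \<psi> k \<noteq> 0}"
  have "finite ?A" using assms by (simp add: finseq_def)
  then show ?thesis
    using laurent_eq_sum[of ?A \<phi> z] laurent_eq_sum[of ?A \<psi> z]
    by (subst laurent_eq_sum[of ?A]) (auto simp: sum.distrib distrib_right)
qed

lemma laurent_cscale: "\<phi> \<in> finseq \<Longrightarrow> laurent (cscale c \<phi>) z = c * laurent \<phi> z"
  using laurent_eq_sum[of "{k. \<phi> k \<noteq> 0}" \<phi> z] laurent_eq_sum[of "{k. \<phi> k \<noteq> 0}" "cscale c \<phi>" z]
  by (auto simp: cscale_def finseq_def sum_distrib_left mult.assoc)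

lemma laurent_diff:
  assumes "\<phi> \<in> finseq" "\<psi> \<in> finseq"
  shows "laurent (\<phi> - \<psi>) z = laurent \<phi> z - laurent \<psi> z"
  using laurent_add[OF finseq_diff[OF assms] assms(2), of z] by simp

lemma laurent_single [simp]: "laurent (single j) z = z powi j"
  by (subst laurent_eq_sum[of "{j}"]) (simp_all add: single_def split: if_splits)

lemma laurent_zero [simp]: "laurent 0 z = 0"
  by (simp add: laurent_def)

lemma laurent_translate:
  assumes "\<phi> \<in> finseq" "z \<noteq> 0"
  shows "laurent (translate j \<phi>) z = z powi j * laurent \<phi> z"
  by (rule finseq_induct[where P = "\<lambda>\<phi>. laurent (translate j \<phi>) z = z powi j * laurent \<phi> z", OF assms(1)])
    (simp_all add: laurent_add laurent_cscale translate_add translate_cscale finseq_translate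
      finseq_cscale distrib_left power_int_add assms(2) mult_ac)

section \<open>Averages of modulations\<close>

definition weight :: "(int \<Rightarrow> complex) \<Rightarrow> cseq \<Rightarrow> cseq" where
  "weight w x = (\<lambda>n. w n * x n)"

text \<open>These are the Fourier coefficients of complex measures of total variation at most \<open>1\<close> on the circle.
  Finite sums that are correct only on a given window replace the measure, so
  that no vector-valued integrals are needed: all estimates are for finite sequences.\<close>

definition averaging_weight :: "(int \<Rightarrow> complex) \<Rightarrow> bool" where
  "averaging_weight w \<longleftrightarrow>
     (\<forall>L. \<exists>Z c. finite Z \<and> Z \<subseteq> sphere 0 1 \<and> (\<Sum>z\<in>Z. cmod (c z)) \<le> 1 \<and>
        (\<forall>j. \<bar>j\<bar> \<le> L \<longrightarrow> w j = (\<Sum>z\<in>Z. c z * z powi j)))"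

lemma averaging_weightE:
  assumes "averaging_weight w"
  obtains Z c where "finite Z" "\<And>z. z \<in> Z \<Longrightarrow> cmod z = 1" "(\<Sum>z\<in>Z. cmod (c z)) \<le> 1"
    "\<And>j. \<bar>j\<bar> \<le> L \<Longrightarrow> w j = (\<Sum>z\<in>Z. c z * z powi j)"
proof -
  from assms[unfolded averaging_weight_def, THEN spec, of L]
  obtain Z c where Z: "finite Z" "Z \<subseteq> sphere 0 1" "(\<Sum>z\<in>Z. cmod (c z)) \<le> 1"
      "\<forall>j. \<bar>j\<bar> \<le> L \<longrightarrow> w j = (\<Sum>z\<in>Z. c z * z powi j)"
    by (elim exE conjE) (rule that)
  show thesis
  proof (rule that[of Z c])
    show "cmod z = 1" if "z \<in> Z" for z using subsetD[OF Z(2) that] by simp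
  qed (use Z in blast)+
qed

lemma averaging_weight_le_1:
  assumes "averaging_weight w"
  shows "cmod (w j) \<le> 1"
proof -
  obtain Z c where Z: "finite Z" "\<And>z. z \<in> Z \<Longrightarrow> cmod z = 1" "(\<Sum>z\<in>Z. cmod (c z)) \<le> 1"
    "\<And>i. \<bar>i\<bar> \<le> \<bar>j\<bar> \<Longrightarrow> w i = (\<Sum>z\<in>Z. c z * z powi i)"
    by (rule averaging_weightE[OF assms, of "\<bar>j\<bar>"]) blast
  have "cmod (w j) \<le> (\<Sum>z\<in>Z. cmod (c z * z powi j))"
    using Z(4)[of j] by (simp add: norm_sum)
  also have "\<dots> = (\<Sum>z\<in>Z. cmod (c z))"
    using Z(2) by (intro sum.cong) (auto simp: norm_mult norm_power_int)
  finally show ?thesis using Z(3) by linarith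
qed

lemma averaging_weight_translate:
  assumes "averaging_weight w"
  shows "averaging_weight (translate s w)"
  unfolding averaging_weight_def
proof
  fix L
  obtain Z c where Z: "finite Z" "\<And>z. z \<in> Z \<Longrightarrow> cmod z = 1" "(\<Sum>z\<in>Z. cmod (c z)) \<le> 1"
    "\<And>i. \<bar>i\<bar> \<le> L + \<bar>s\<bar> \<Longrightarrow> w i = (\<Sum>z\<in>Z. c z * z powi i)"
    by (rule averaging_weightE[OF assms, of "L + \<bar>s\<bar>"]) blast
  have nz: "z \<noteq> 0" if "z \<in> Z" for z using Z(2)[OF that] by auto
  show "\<exists>Z c. finite Z \<and> Z \<subseteq> sphere 0 1 \<and> (\<Sum>z\<in>Z. cmod (c z)) \<le> 1 \<and>
        (\<forall>j. \<bar>j\<bar> \<le> L \<longrightarrow> translate s w j = (\<Sum>z\<in>Z. c z * z powi j))"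
  proof (intro exI[of _ Z] exI[of _ "\<lambda>z. c z * z powi (-s)"] conjI allI impI)
    have "(\<Sum>z\<in>Z. cmod (c z * z powi (-s))) = (\<Sum>z\<in>Z. cmod (c z))"
      using Z(2) by (intro sum.cong) (auto simp: norm_mult norm_power_int norm_inverse)
    then show "(\<Sum>z\<in>Z. cmod (c z * z powi (-s))) \<le> 1" using Z(3) by simp
    fix j assume "\<bar>j\<bar> \<le> L"
    then have "translate s w j = (\<Sum>z\<in>Z. c z * z powi (j - s))"
      unfolding translate_def by (intro Z(4)) linarith
    also have "\<dots> = (\<Sum>z\<in>Z. c z * z powi (-s) * z powi j)"
      using nz by (intro sum.cong) (auto simp: power_int_diff power_int_minus field_simps)
    finally show "translate s w j = (\<Sum>z\<in>Z. c z * z powi (-s) * z powi j)" .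
  qed (use Z in auto)
qed

lemma root_of_unity_norm: "0 < m \<Longrightarrow> z ^ m = 1 \<Longrightarrow> cmod z = 1" for m :: nat
  using power_eq_1_iff[of z m] by simp

lemma finite_roots: "0 < m \<Longrightarrow> finite {z::complex. z ^ m = 1}"
  using card_roots_unity_eq[of m] by (metis card.infinite less_irrefl)

lemma sum_roots_of_unity:
  assumes m: "0 < m"
  shows "(\<Sum>z | z ^ m = 1. z powi j) = (if int m dvd j then of_nat m else (0::complex))"
proof (cases "int m dvd j")
  case True
  then obtain i where "j = int m * i" by auto
  then have *: "z powi j = 1" if "z ^ m = 1" for z :: complex
    using that by (simp add: power_int_mult)
  then have "(\<Sum>z::complex | z ^ m = 1. z powi j) = (\<Sum>z::complex | z ^ m = 1. 1)"
    by (intro sum.cong) (auto simp: *)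
  then show ?thesis using True card_roots_unity_eq[OF m] by simp
next
  case False
  define \<omega> where "\<omega> = cis (2 * pi / m)"
  have \<omega>m: "\<omega> ^ m = 1" using m by (simp add: \<omega>_def Complex.DeMoivre)
  have \<omega>0: "\<omega> \<noteq> 0" by (simp add: \<omega>_def)
  have "\<omega> powi j \<noteq> 1"
  proof
    assume "\<omega> powi j = 1"
    then have "cis (of_int j * (2 * pi / m)) = 1"
      by (simp add: \<omega>_def cis_power_int)
    then have "cos (of_int j * (2 * pi / m)) = 1" by (simp add: complex_eq_iff)
    then obtain i :: int where "of_int j * (2 * pi / m) = of_int i * 2 * pi"
      using cos_one_2pi_int by auto
    then have "real_of_int j = of_int i * of_nat m"
      using m by (simp add: field_simps)
    then have "j = i * int m" by (metis of_int_eq_iff of_int_mult of_int_of_nat_eq)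
    then show False using False by simp
  qed
  moreover have "(\<Sum>z | z ^ m = 1. z powi j) = \<omega> powi j * (\<Sum>z | z ^ m = 1. z powi j)"
  proof -
    have "(\<Sum>z | z ^ m = 1. z powi j) = (\<Sum>z | z ^ m = 1. (\<omega> * z) powi j)"
      by (rule sum.reindex_bij_witness[of _ "\<lambda>z. \<omega> * z" "\<lambda>z. z / \<omega>"])
        (use \<omega>0 \<omega>m in \<open>auto simp: power_mult_distrib power_divide\<close>)
    also have "\<dots> = \<omega> powi j * (\<Sum>z | z ^ m = 1. z powi j)"
      by (simp add: power_int_mult_distrib sum_distrib_left)
    finally show ?thesis .
  qed
  ultimately show ?thesis using False by auto
qed

text \<open>The density \<open>z\<^sup>-\<^sup>i\<close> with respect to normalised arc length extracts one coefficient; on a window,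
  arc length can be replaced by the average over the roots of unity of a high order.\<close>

lemma averaging_weight_single: "averaging_weight (single i)"
  unfolding averaging_weight_def
proof
  fix L
  define m where "m = nat (\<bar>L\<bar> + \<bar>i\<bar> + 1)"
  have m: "0 < m" "int m = \<bar>L\<bar> + \<bar>i\<bar> + 1" by (auto simp: m_def)
  let ?Z = "{z::complex. z ^ m = 1}"
  have nz: "z \<noteq> 0" if "z \<in> ?Z" for z using that m by (auto simp: power_0_left)
  show "\<exists>Z c. finite Z \<and> Z \<subseteq> sphere 0 1 \<and> (\<Sum>z\<in>Z. cmod (c z)) \<le> 1 \<and>
        (\<forall>j. \<bar>j\<bar> \<le> L \<longrightarrow> single i j = (\<Sum>z\<in>Z. c z * z powi j))"
  proof (intro exI[of _ ?Z] exI[of _ "\<lambda>z::complex. z powi (-i) / m"] conjI allI impI)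
    show "finite ?Z" using m by (simp add: finite_roots)
    show "?Z \<subseteq> sphere 0 1" using m root_of_unity_norm by auto
    have "(\<Sum>z\<in>?Z. cmod (z powi (-i) / m)) = (\<Sum>z\<in>?Z. 1 / m)"
      using m root_of_unity_norm
      by (intro sum.cong) (auto simp: norm_divide norm_power_int norm_inverse)
    also have "\<dots> = 1" using m card_roots_unity_eq[of m] by simp
    finally show "(\<Sum>z\<in>?Z. cmod (z powi (-i) / m)) \<le> 1" by simp
    fix j assume j: "\<bar>j\<bar> \<le> L"
    have "(\<Sum>z\<in>?Z. z powi (-i) / m * z powi j) = (\<Sum>z\<in>?Z. z powi (j - i)) / m"
      unfolding sum_divide_distrib
      by (intro sum.cong) (use nz in \<open>auto simp: power_int_diff power_int_minus field_simps\<close>)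
    also have "\<dots> = single i j"
    proof (cases "j = i")
      case False
      then have "\<not> int m dvd (j - i)"
        using j m dvd_imp_le_int[of "j - i" "int m"] by force
      then show ?thesis using m False by (simp add: sum_roots_of_unity single_def)
    next
      case True
      then show ?thesis using m sum_roots_of_unity[of m 0] by (simp add: single_def)
    qed
    finally show "single i j = (\<Sum>z\<in>?Z. z powi (-i) / m * z powi j)" ..
  qed
qed

text \<open>This is \<open>max 0 (1 - |n| / (k + 1))\<close>.  As a count of pairs it is visibly the sequence of Fourier
  coefficients of \<open>|1 + z + \<dots> + z\<^sup>k|\<^sup>2 / (k + 1)\<close>, which is positive.\<close>

definition fejer_weight :: "nat \<Rightarrow> int \<Rightarrow> real" where
  "fejer_weight k n = card {(a, b). a \<le> k \<and> b \<le> k \<and> int a - int b = n} / Suc k"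

lemma finite_fejer_pairs: "finite {(a, b). a \<le> k \<and> b \<le> k \<and> int a - int b = n}"
  by (rule finite_subset[of _ "{..k} \<times> {..k}"]) auto

lemma fejer_weight_nonneg: "0 \<le> fejer_weight k n"
  by (simp add: fejer_weight_def)

lemma fejer_weight_support:
  assumes "fejer_weight k n \<noteq> 0"
  shows "\<bar>n\<bar> \<le> int k"
proof -
  have "{(a, b). a \<le> k \<and> b \<le> k \<and> int a - int b = n} \<noteq> {}"
  proof
    assume "{(a, b). a \<le> k \<and> b \<le> k \<and> int a - int b = n} = {}"
    then have "fejer_weight k n = 0" by (simp only: fejer_weight_def card.empty)
    then show False using assms by contradiction
  qed
  then show ?thesis by auto
qed

text \<open>The Fejer kernel is positive with mean \<open>1\<close>, so its total variation is \<open>1\<close>.  It is sampled at roots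
  of unity of an order that exceeds all frequencies involved.\<close>

lemma averaging_weight_fejer: "averaging_weight (\<lambda>n. of_real (fejer_weight k n))"
  unfolding averaging_weight_def
proof
  fix L
  define m where "m = nat (\<bar>L\<bar> + int k + 1)"
  have m: "0 < m" "int m = \<bar>L\<bar> + int k + 1" by (auto simp: m_def)
  let ?Z = "{z::complex. z ^ m = 1}"
  have Z: "finite ?Z" "\<And>z. z \<in> ?Z \<Longrightarrow> cmod z = 1"
    using finite_roots[OF m(1)] root_of_unity_norm[OF m(1)] unfolding mem_Collect_eq .
  have nz: "z \<noteq> 0" if "z \<in> ?Z" for z using Z(2)[OF that] by auto
  define D where "D = real m * real (Suc k)"
  have "D > 0" using m by (simp add: D_def)
  define c where "c z = (cmod (\<Sum>a\<le>k. z powi int a))\<^sup>2 / D" for z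
  have c_eq: "complex_of_real (c z) = (\<Sum>a\<le>k. \<Sum>b\<le>k. z powi (int b - int a)) / of_real D"
    if z: "z \<in> ?Z" for z
  proof -
    have inv: "cnj (z powi n) = z powi (-n)" for n
    proof -
      have "cnj z = inverse z"
        using Z(2)[OF z] by (simp add: inverse_complex_def complex_eq_iff cmod_def)
      then show ?thesis by (simp add: power_int_minus power_int_inverse)
    qed
    have "complex_of_real ((cmod (\<Sum>a\<le>k. z powi int a))\<^sup>2)
        = (\<Sum>b\<le>k. z powi int b) * (\<Sum>a\<le>k. z powi (- int a))"
      unfolding complex_norm_square cnj_sum inv ..
    also have "\<dots> = (\<Sum>b\<le>k. \<Sum>a\<le>k. z powi (int b - int a))"
      unfolding sum_product
      by (intro sum.cong) (use nz[OF z] in \<open>auto simp: power_int_diff power_int_minus field_simps\<close>)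
    also have "\<dots> = (\<Sum>a\<le>k. \<Sum>b\<le>k. z powi (int b - int a))"
      by (rule sum.swap)
    finally show ?thesis by (simp add: c_def)
  qed
  have main: "(\<Sum>z\<in>?Z. complex_of_real (c z) * z powi j) = of_real (fejer_weight k j)"
    if j: "\<bar>j\<bar> \<le> \<bar>L\<bar>" for j
  proof -
    have "(\<Sum>z\<in>?Z. complex_of_real (c z) * z powi j)
        = (\<Sum>z\<in>?Z. (\<Sum>a\<le>k. \<Sum>b\<le>k. z powi (int b - int a + j)) / of_real D)"
    proof (intro sum.cong refl)
      fix z assume z: "z \<in> ?Z"
      have "(\<Sum>a\<le>k. \<Sum>b\<le>k. z powi (int b - int a + j)) = (\<Sum>a\<le>k. \<Sum>b\<le>k. z powi (int b - int a)) * z powi j"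
        using nz[OF z] by (simp add: power_int_add sum_distrib_right)
      then show "complex_of_real (c z) * z powi j
          = (\<Sum>a\<le>k. \<Sum>b\<le>k. z powi (int b - int a + j)) / of_real D"
        by (simp add: c_eq[OF z])
    qed
    also have "\<dots> = (\<Sum>z\<in>?Z. \<Sum>a\<le>k. \<Sum>b\<le>k. z powi (int b - int a + j)) / of_real D"
      by (rule sum_divide_distrib[symmetric])
    also have "(\<Sum>z\<in>?Z. \<Sum>a\<le>k. \<Sum>b\<le>k. z powi (int b - int a + j))
        = (\<Sum>a\<le>k. \<Sum>b\<le>k. \<Sum>z\<in>?Z. z powi (int b - int a + j))"
      by (subst sum.swap, intro sum.cong refl, rule sum.swap)
    also have "\<dots> = (\<Sum>a\<le>k. \<Sum>b\<le>k. if int a - int b = j then of_nat m else 0)"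
    proof (intro sum.cong refl)
      fix a b assume ab: "a \<in> {..k}" "b \<in> {..k}"
      have "int m dvd (int b - int a + j) \<longleftrightarrow> int a - int b = j"
      proof
        assume dvd: "int m dvd (int b - int a + j)"
        have "\<bar>int b - int a + j\<bar> < int m" using ab j m by auto
        then have "int b - int a + j = 0" using dvd dvd_imp_le_int[of "int b - int a + j" "int m"] by linarith
        then show "int a - int b = j" by simp
      qed auto
      then show "(\<Sum>z\<in>?Z. z powi (int b - int a + j)) = (if int a - int b = j then of_nat m else 0)"
        using m by (simp add: sum_roots_of_unity)
    qed
    also have "\<dots> = of_nat m * of_nat (card {(a, b). a \<le> k \<and> b \<le> k \<and> int a - int b = j})"
    proof -
      have "(\<Sum>a\<le>k. \<Sum>b\<le>k. if int a - int b = j then complex_of_nat m else 0)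
          = (\<Sum>p\<in>{..k} \<times> {..k}. if int (fst p) - int (snd p) = j then complex_of_nat m else 0)"
        by (simp add: sum.cartesian_product case_prod_unfold)
      also have "\<dots> = (\<Sum>p\<in>{(a, b). a \<le> k \<and> b \<le> k \<and> int a - int b = j}. complex_of_nat m)"
        by (intro sum.mono_neutral_cong_right) auto
      finally show ?thesis by simp
    qed
    finally show ?thesis using m(1) by (simp add: fejer_weight_def D_def del: of_nat_Suc)
  qed
  show "\<exists>Z c. finite Z \<and> Z \<subseteq> sphere 0 1 \<and> (\<Sum>z\<in>Z. cmod (c z)) \<le> 1 \<and>
        (\<forall>j. \<bar>j\<bar> \<le> L \<longrightarrow> complex_of_real (fejer_weight k j) = (\<Sum>z\<in>Z. c z * z powi j))"
  proof (intro exI[of _ ?Z] exI[of _ "\<lambda>z. complex_of_real (c z)"] conjI allI impI)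
    have "{(a, b). a \<le> k \<and> b \<le> k \<and> int a - int b = 0} = (\<lambda>a. (a, a)) ` {..k}" by auto
    then have "fejer_weight k 0 = 1"
      by (simp add: fejer_weight_def card_image inj_on_def)
    then have "complex_of_real (\<Sum>z\<in>?Z. c z) = 1" using main[of 0] by simp
    then have "(\<Sum>z\<in>?Z. c z) = 1" using of_real_eq_1_iff by blast
    then show "(\<Sum>z\<in>?Z. cmod (complex_of_real (c z))) \<le> 1"
      using \<open>D > 0\<close> by (simp add: c_def norm_divide norm_power)
  qed (use Z main in auto)
qed

lemma fejer_weight_le_1: "fejer_weight k n \<le> 1"
  using averaging_weight_le_1[OF averaging_weight_fejer, of k n] fejer_weight_nonneg[of k n] by simp

lemma fejer_weight_lower: "1 - \<bar>real_of_int n\<bar> / Suc k \<le> fejer_weight k n"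
proof (cases "\<bar>n\<bar> \<le> int k")
  case True
  let ?S = "{(a, b). a \<le> k \<and> b \<le> k \<and> int a - int b = n}"
  let ?f = "\<lambda>i. (i + nat n, i + nat (- n))"
  have "?f ` {..k - nat \<bar>n\<bar>} \<subseteq> ?S" using True by auto
  then have "card (?f ` {..k - nat \<bar>n\<bar>}) \<le> card ?S"
    by (rule card_mono[OF finite_fejer_pairs])
  moreover have "card (?f ` {..k - nat \<bar>n\<bar>}) = Suc (k - nat \<bar>n\<bar>)"
    by (subst card_image) (auto simp: inj_on_def)
  ultimately have "Suc k - \<bar>real_of_int n\<bar> \<le> card ?S" using True by linarith
  then have "(Suc k - \<bar>real_of_int n\<bar>) / Suc k \<le> card ?S / Suc k"
    by (rule divide_right_mono) simp
  then show ?thesis unfolding fejer_weight_def by (simp add: diff_divide_distrib del: of_nat_Suc)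
next
  case False
  then have "1 \<le> \<bar>real_of_int n\<bar> / Suc k" by (simp add: field_simps)
  then show ?thesis using fejer_weight_nonneg[of k n] by linarith
qed

lemma fejer_weight_tendsto: "(\<lambda>k. fejer_weight k n) \<longlonglongrightarrow> 1"
proof (rule tendsto_sandwich)
  show "(\<lambda>k. 1 - \<bar>real_of_int n\<bar> / Suc k) \<longlonglongrightarrow> 1"
    using tendsto_diff[OF tendsto_const LIMSEQ_Suc[OF lim_const_over_n]] by force
qed (use fejer_weight_lower fejer_weight_le_1 in \<open>auto simp del: of_nat_Suc\<close>)


section \<open>Bounded operators\<close>

text \<open>Sequences are treated as vectors from here on; evaluating sums and differences of functions
  pointwise would break up the vectors inside eta-expanded terms.\<close>

lemmas cseq_apply = plus_fun_apply minus_apply uminus_apply zero_fun_apply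
declare cseq_apply [simp del]

lemma uminus_eq_cscale: "- x = cscale (-1) (x :: cseq)"
  by (auto simp: cscale_def cseq_apply)

context banach_seq_space
begin

lemma zero_mem [simp]: "0 \<in> E"
  by (rule cseq.subspace_0[OF subspace])

lemma add_mem: "x \<in> E \<Longrightarrow> y \<in> E \<Longrightarrow> x + y \<in> E"
  by (rule cseq.subspace_add[OF subspace])

lemma cscale_mem: "x \<in> E \<Longrightarrow> cscale c x \<in> E"
  by (rule cseq.subspace_scale[OF subspace])

lemma diff_mem: "x \<in> E \<Longrightarrow> y \<in> E \<Longrightarrow> x - y \<in> E"
  by (rule cseq.subspace_diff[OF subspace])

lemma sum_mem: "(\<And>i. i \<in> A \<Longrightarrow> f i \<in> E) \<Longrightarrow> sum f A \<in> E"
  by (rule cseq.subspace_sum[OF subspace])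

lemma norm_zero [simp]: "N 0 = 0"
  using norm_eq_0_iff[of 0] by simp

lemma norm_diff_commute: "x \<in> E \<Longrightarrow> y \<in> E \<Longrightarrow> N (x - y) = N (y - x)"
  using norm_cscale[OF diff_mem, of y x "-1"] by (simp flip: uminus_eq_cscale)

lemma norm_diff_le: "x \<in> E \<Longrightarrow> y \<in> E \<Longrightarrow> N (x - y) \<le> N x + N y"
  using norm_triangle[of x "- y"] norm_cscale[of y "-1"] cscale_mem[of y "-1"]
  by (simp flip: uminus_eq_cscale)

lemma norm_le_diff: "x \<in> E \<Longrightarrow> y \<in> E \<Longrightarrow> N x \<le> N (x - y) + N y"
  using norm_triangle[OF diff_mem, of x y y] by simp

lemma norm_diff_triangle: "x \<in> E \<Longrightarrow> y \<in> E \<Longrightarrow> z \<in> E \<Longrightarrow> N (x - z) \<le> N (x - y) + N (y - z)"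
  using norm_triangle[OF diff_mem diff_mem, of x y y z] by simp

lemma norm_sum_le:
  assumes "\<And>i. i \<in> A \<Longrightarrow> f i \<in> E"
  shows "N (sum f A) \<le> (\<Sum>i\<in>A. N (f i))"
proof (cases "finite A")
  case True
  then show ?thesis using assms
  proof (induction A rule: finite_induct)
    case (insert i A)
    have "N (f i + sum f A) \<le> N (f i) + N (sum f A)"
      using insert.prems by (intro norm_triangle sum_mem) auto
    then show ?case using insert by (simp del: plus_fun_apply)
  qed simp
qed simp

lemma complete_sequence:
  assumes "\<And>k. x k \<in> E" "\<And>e. e > 0 \<Longrightarrow> \<exists>K. \<forall>i\<ge>K. \<forall>j\<ge>K. N (x i - x j) < e"
  obtains y where "y \<in> E" "(\<lambda>k. N (x k - y)) \<longlonglongrightarrow> 0"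
proof -
  have "MCauchy x"
    unfolding MCauchy_def using assms by (force simp: seq_dist_def)
  then obtain y where "limitin mtopology x y sequentially"
    using complete by (auto simp: mcomplete_def)
  then have y: "y \<in> E" "\<forall>e>0. \<exists>K. \<forall>n\<ge>K. x n \<in> E \<and> seq_dist E N (x n) y < e"
    by (auto simp: limit_metric_sequentially)
  have "(\<lambda>k. N (x k - y)) \<longlonglongrightarrow> 0"
  proof (rule LIMSEQ_I)
    fix e :: real assume "e > 0"
    then show "\<exists>K. \<forall>k\<ge>K. norm (N (x k - y) - 0) < e"
      using y assms(1) norm_nonneg[OF diff_mem[OF assms(1) y(1)]]
      by (simp add: seq_dist_def)
  qed
  then show thesis using that y(1) by blast
qed

lemma limit_unique:
  assumes "\<And>k. x k \<in> E" "y \<in> E" "z \<in> E"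
    and "(\<lambda>k. N (x k - y)) \<longlonglongrightarrow> 0" "(\<lambda>k. N (x k - z)) \<longlonglongrightarrow> 0"
  shows "y = z"
proof -
  have le: "N (y - z) \<le> N (x k - y) + N (x k - z)" for k
    using norm_diff_triangle[of y "x k" z] assms(1-3) norm_diff_commute[of y "x k"] by simp
  have "(\<lambda>k. N (x k - y) + N (x k - z)) \<longlonglongrightarrow> 0 + 0"
    by (intro tendsto_add assms)
  then have "N (y - z) \<le> 0 + 0" by (rule LIMSEQ_le_const) (use le in auto)
  then have "N (y - z) = 0" using norm_nonneg[OF diff_mem[OF assms(2,3)]] by simp
  then show ?thesis using norm_eq_0_iff[OF diff_mem[OF assms(2,3)]] by simp
qed

text \<open>The bound is explicit because the proof depends on the constants: estimates have to be
  uniform in families of operators.\<close>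

definition op_bound :: "(cseq \<Rightarrow> cseq) \<Rightarrow> real \<Rightarrow> bool" where
  "op_bound T c \<longleftrightarrow>
     (\<forall>x\<in>E. T x \<in> E) \<and> (\<forall>x\<in>E. \<forall>y\<in>E. T (x + y) = T x + T y) \<and>
     (\<forall>a. \<forall>x\<in>E. T (cscale a x) = cscale a (T x)) \<and> 0 \<le> c \<and> (\<forall>x\<in>E. N (T x) \<le> c * N x)"

lemma bounded_operator_iff: "bounded_operator E N T \<longleftrightarrow> (\<exists>c. op_bound T c)"
proof
  assume T: "bounded_operator E N T"
  then obtain c where c: "\<forall>x\<in>E. N (T x) \<le> c * N x" by (auto simp: bounded_operator_def)
  have "N (T x) \<le> max c 0 * N x" if "x \<in> E" for x
    using c that norm_nonneg[OF that] by (meson max.cobounded1 mult_right_mono order_trans)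
  then have "op_bound T (max c 0)" using T unfolding op_bound_def bounded_operator_def by auto
  then show "\<exists>c. op_bound T c" ..
qed (auto simp: op_bound_def bounded_operator_def)

lemma op_bound_mem: "op_bound T c \<Longrightarrow> x \<in> E \<Longrightarrow> T x \<in> E"
  and op_bound_add: "op_bound T c \<Longrightarrow> x \<in> E \<Longrightarrow> y \<in> E \<Longrightarrow> T (x + y) = T x + T y"
  and op_bound_cscale: "op_bound T c \<Longrightarrow> x \<in> E \<Longrightarrow> T (cscale a x) = cscale a (T x)"
  and op_bound_nonneg: "op_bound T c \<Longrightarrow> 0 \<le> c"
  and op_bound_le: "op_bound T c \<Longrightarrow> x \<in> E \<Longrightarrow> N (T x) \<le> c * N x"
  by (auto simp: op_bound_def)

lemma op_bound_diff:
  assumes T: "op_bound T c" and xy: "x \<in> E" "y \<in> E"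
  shows "T (x - y) = T x - T y"
proof -
  have "T x = T ((x - y) + y)" by simp
  also have "\<dots> = T (x - y) + T y"
    by (rule op_bound_add[OF T diff_mem[OF xy] xy(2)])
  finally show ?thesis by simp
qed

lemma op_bound_zero: "op_bound T c \<Longrightarrow> T 0 = 0"
  using op_bound_diff[of T c 0 0] by simp

lemma op_bound_sum:
  assumes T: "op_bound T c" and f: "\<And>i. i \<in> A \<Longrightarrow> f i \<in> E"
  shows "T (sum f A) = (\<Sum>i\<in>A. T (f i))"
proof (cases "finite A")
  case True
  then show ?thesis using f
  proof (induction A rule: finite_induct)
    case (insert i A)
    have fi: "f i \<in> E" and fA: "sum f A \<in> E"
      using insert.prems by (auto intro: sum_mem)
    have IH: "T (sum f A) = (\<Sum>i\<in>A. T (f i))" using insert by blast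
    show ?case unfolding sum.insert[OF insert.hyps] op_bound_add[OF T fi fA] IH ..
  qed (simp add: op_bound_zero[OF T])
qed (simp add: op_bound_zero[OF T])

lemma op_bound_id: "op_bound (\<lambda>x. x) 1"
  by (simp add: op_bound_def)

lemma op_bound_comp:
  assumes S: "op_bound S c" and T: "op_bound T d"
  shows "op_bound (\<lambda>x. S (T x)) (c * d)"
proof -
  have "N (S (T x)) \<le> c * d * N x" if "x \<in> E" for x
  proof -
    have "N (S (T x)) \<le> c * N (T x)" by (intro op_bound_le[OF S] op_bound_mem[OF T] that)
    also have "\<dots> \<le> c * (d * N x)"
      by (intro mult_left_mono op_bound_le[OF T] op_bound_nonneg[OF S] that)
    finally show ?thesis by (simp add: mult.assoc)
  qed
  then show ?thesis using S T unfolding op_bound_def by simp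
qed

lemma op_bound_plus:
  assumes S: "op_bound S c" and T: "op_bound T d"
  shows "op_bound (\<lambda>x. S x + T x) (c + d)"
proof -
  have "N (S x + T x) \<le> (c + d) * N x" if "x \<in> E" for x
    using norm_triangle[OF op_bound_mem[OF S that] op_bound_mem[OF T that]]
      op_bound_le[OF S that] op_bound_le[OF T that] by (simp add: distrib_right)
  moreover have "S (cscale a x) + T (cscale a x) = cscale a (S x + T x)" if "x \<in> E" for a x
    using op_bound_cscale[OF S that] op_bound_cscale[OF T that] by (simp add: cseq.scale_right_distrib)
  moreover have "S (x + y) + T (x + y) = S x + T x + (S y + T y)" if "x \<in> E" "y \<in> E" for x y
    using op_bound_add[OF S that] op_bound_add[OF T that] by (simp add: add_ac)
  ultimately show ?thesis
    using op_bound_mem[OF S] op_bound_mem[OF T] op_bound_nonneg[OF S] op_bound_nonneg[OF T]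
    unfolding op_bound_def by (simp add: add_mem)
qed

lemma op_bound_cmult:
  assumes T: "op_bound T c"
  shows "op_bound (\<lambda>x. cscale a (T x)) (cmod a * c)"
proof -
  have "N (cscale a (T x)) \<le> cmod a * c * N x" if "x \<in> E" for x
    using mult_left_mono[OF op_bound_le[OF T that], of "cmod a"] norm_cscale[OF op_bound_mem[OF T that]]
    by (simp add: mult.assoc)
  moreover have "cscale a (T (cscale b x)) = cscale b (cscale a (T x))" if "x \<in> E" for b x
    using op_bound_cscale[OF T that] by (simp add: mult.commute)
  moreover have "cscale a (T (x + y)) = cscale a (T x) + cscale a (T y)" if "x \<in> E" "y \<in> E" for x y
    using op_bound_add[OF T that] by (simp add: cseq.scale_right_distrib)
  ultimately show ?thesis
    using op_bound_mem[OF T] op_bound_nonneg[OF T] unfolding op_bound_def by (simp add: cscale_mem)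
qed

lemma op_bound_minus:
  assumes S: "op_bound S c" and T: "op_bound T d"
  shows "op_bound (\<lambda>x. S x - T x) (c + d)"
  using op_bound_plus[OF S op_bound_cmult[OF T, of "-1"]] by (simp flip: uminus_eq_cscale)

lemma op_bound_cong:
  assumes "op_bound T c" "\<And>x. x \<in> E \<Longrightarrow> S x = T x"
  shows "op_bound S c"
  using assms add_mem cscale_mem by (simp add: op_bound_def)

lemma op_bound_pow: "op_bound T c \<Longrightarrow> op_bound (T ^^ n) (c ^ n)"
proof (induction n)
  case 0
  then show ?case using op_bound_id by (simp add: id_def)
next
  case (Suc n)
  then show ?case using op_bound_comp[of T c "T ^^ n" "c ^ n"] by (simp add: o_def)
qed

lemma op_bound_tendsto:
  assumes T: "op_bound T c" and x: "\<And>k. x k \<in> E" "y \<in> E" "(\<lambda>k. N (x k - y)) \<longlonglongrightarrow> 0"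
  shows "(\<lambda>k. N (T (x k) - T y)) \<longlonglongrightarrow> 0"
proof (rule tendsto_sandwich[of "\<lambda>_. 0" _ _ "\<lambda>k. c * N (x k - y)"])
  show "\<forall>\<^sub>F k in sequentially. N (T (x k) - T y) \<le> c * N (x k - y)"
    using op_bound_le[OF T diff_mem] op_bound_diff[OF T] x(1,2) by auto
  show "\<forall>\<^sub>F k in sequentially. 0 \<le> N (T (x k) - T y)"
    using norm_nonneg diff_mem op_bound_mem[OF T] x(1,2) by auto
qed (use tendsto_mult_right_zero[OF x(3)] in auto)

subsection \<open>Inverses and the Neumann series\<close>

definition inverse_op :: "(cseq \<Rightarrow> cseq) \<Rightarrow> (cseq \<Rightarrow> cseq) \<Rightarrow> bool" where
  "inverse_op R T \<longleftrightarrow> (\<exists>c. op_bound R c) \<and> (\<forall>x\<in>E. R (T x) = x \<and> T (R x) = x)"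

definition invertible_op :: "(cseq \<Rightarrow> cseq) \<Rightarrow> bool" where
  "invertible_op T \<longleftrightarrow> (\<exists>R. inverse_op R T)"

lemma not_in_spectrum_iff:
  assumes "\<And>x. x \<in> E \<Longrightarrow> T x \<in> E"
  shows "\<alpha> \<notin> op_spectrum E N (graph_on E T) \<longleftrightarrow> invertible_op (\<lambda>x. T x - cscale \<alpha> x)"
proof -
  have "(\<forall>(x, y)\<in>graph_on E T. R (y - cscale \<alpha> x) = x) \<and>
      (\<forall>y\<in>E. (R y, y + cscale \<alpha> (R y)) \<in> graph_on E T) \<longleftrightarrow>
      (\<forall>x\<in>E. R (T x - cscale \<alpha> x) = x \<and> T (R x) - cscale \<alpha> (R x) = x)"
    if R: "op_bound R c" for R c
  proof -
    have "(R y, y + cscale \<alpha> (R y)) \<in> graph_on E T \<longleftrightarrow> T (R y) - cscale \<alpha> (R y) = y" if "y \<in> E" for y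
      using op_bound_mem[OF R that] by (auto simp: graph_on_def algebra_simps)
    then show ?thesis by (auto simp: graph_on_def)
  qed
  then show ?thesis
    unfolding op_spectrum_def invertible_op_def inverse_op_def bounded_operator_iff by blast
qed

text \<open>The maximum with \<open>0\<close> is there for the space \<open>{0}\<close>, where \<open>k\<close> may be negative.\<close>

lemma inverse_opI:
  assumes A: "op_bound A c" and surj: "\<And>y. y \<in> E \<Longrightarrow> \<exists>x\<in>E. A x = y"
    and below: "\<And>x. x \<in> E \<Longrightarrow> N x \<le> k * N (A x)"
  shows "\<exists>R. inverse_op R A \<and> op_bound R (max k 0)"
proof -
  have inj: "x = y" if "x \<in> E" "y \<in> E" "A x = A y" for x y
  proof -
    have "N (x - y) \<le> k * N (A (x - y))" using that by (intro below diff_mem)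
    also have "A (x - y) = 0" using op_bound_diff[OF A that(1,2)] that(3) by simp
    finally have "N (x - y) = 0" using norm_nonneg[OF diff_mem[OF that(1,2)]] by simp
    then show ?thesis using norm_eq_0_iff[OF diff_mem[OF that(1,2)]] by simp
  qed
  define R where "R y = (SOME x. x \<in> E \<and> A x = y)" for y
  have R: "R y \<in> E" "A (R y) = y" if "y \<in> E" for y
    using someI_ex[of "\<lambda>x. x \<in> E \<and> A x = y"] surj[OF that] by (auto simp: R_def)
  have RA: "R (A x) = x" if "x \<in> E" for x
    using inj R op_bound_mem[OF A] that by blast
  have "op_bound R (max k 0)"
    unfolding op_bound_def
  proof (intro conjI ballI allI)
    fix x y assume xy: "x \<in> E" "y \<in> E"
    show "R (x + y) = R x + R y"
      by (rule inj; simp add: R xy add_mem op_bound_add[OF A])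
  next
    fix a x assume x: "x \<in> E"
    show "R (cscale a x) = cscale a (R x)"
      by (rule inj; simp add: R x cscale_mem op_bound_cscale[OF A])
  next
    fix x assume x: "x \<in> E"
    have "N (R x) \<le> k * N x" using below[OF R(1)[OF x]] R(2)[OF x] by simp
    also have "\<dots> \<le> max k 0 * N x" by (intro mult_right_mono norm_nonneg x) simp
    finally show "N (R x) \<le> max k 0 * N x" .
  qed (use R in auto)
  then show ?thesis using RA R unfolding inverse_op_def by blast
qed

text \<open>The hypothesis is on the powers of \<open>T\<close> and not on the norm of \<open>T\<close>, so that operators of small spectral
  radius are covered.\<close>

lemma neumann:
  assumes T: "op_bound T c" and \<theta>: "0 \<le> \<theta>" "\<theta> < 1"
    and pow: "\<And>n x. x \<in> E \<Longrightarrow> N ((T ^^ n) x) \<le> K * \<theta> ^ n * N x"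
  shows "invertible_op (\<lambda>x. x - T x)"
proof -
  define s where "s n x = (\<Sum>i<n. (T ^^ i) x)" for n x
  have powm: "(T ^^ i) x \<in> E" if "x \<in> E" for i x
    using op_bound_mem[OF op_bound_pow[OF T] that] .
  have s_mem: "s n x \<in> E" if "x \<in> E" for n x
    unfolding s_def using that by (intro sum_mem powm)
  have A: "op_bound (\<lambda>x. x - T x) (1 + c)"
    by (rule op_bound_minus[OF op_bound_id T])
  have Ts: "T (s n x) = s (Suc n) x - x" if x: "x \<in> E" for n x
  proof -
    have "T (s n x) = (\<Sum>i<n. (T ^^ Suc i) x)"
      unfolding s_def using x by (subst op_bound_sum[OF T]) (auto simp: powm)
    also have "\<dots> = s (Suc n) x - x" unfolding s_def sum.lessThan_Suc_shift by simp
    finally show ?thesis .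
  qed
  have sT: "s n (x - T x) = x - (T ^^ n) x" if x: "x \<in> E" for n x
  proof (induction n)
    case 0
    then show ?case by (simp add: s_def)
  next
    case (Suc n)
    have "(T ^^ n) (x - T x) = (T ^^ n) x - (T ^^ Suc n) x"
      using op_bound_diff[OF op_bound_pow[OF T] x op_bound_mem[OF T x]]
      by (simp only: funpow_Suc_right o_apply)
    then show ?case using Suc by (simp add: s_def del: funpow.simps)
  qed
  have lim0: "(\<lambda>n. K * \<theta> ^ n * b) \<longlonglongrightarrow> 0" for b
    using LIMSEQ_power_zero[of \<theta>] \<theta> by (intro tendsto_mult_left_zero tendsto_mult_right_zero) auto
  have K: "0 \<le> K * N x" if "x \<in> E" for x
    using pow[OF that, of 0] norm_nonneg[OF that] by simp
  have s_le: "N (s n x) \<le> K / (1 - \<theta>) * N x" if x: "x \<in> E" for n x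
  proof -
    have "N (s n x) \<le> (\<Sum>i<n. N ((T ^^ i) x))"
      unfolding s_def using x by (intro norm_sum_le powm)
    also have "\<dots> \<le> (\<Sum>i<n. (K * N x) * \<theta> ^ i)"
      using pow[OF x] by (intro sum_mono) (simp add: mult_ac)
    also have "\<dots> = (K * N x) * (\<Sum>i<n. \<theta> ^ i)" by (simp add: sum_distrib_left)
    also have "(\<Sum>i<n. \<theta> ^ i) = (1 - \<theta> ^ n) / (1 - \<theta>)"
      using \<theta> by (simp add: sum_gp_strict)
    also have "(K * N x) * \<dots> \<le> (K * N x) * (1 / (1 - \<theta>))"
      using \<theta> by (intro mult_left_mono K x divide_right_mono) auto
    finally show ?thesis by simp
  qed
  have "\<exists>R. inverse_op R (\<lambda>x. x - T x) \<and> op_bound R (max (K / (1 - \<theta>)) 0)"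
  proof (rule inverse_opI[OF A])
    fix x assume x: "x \<in> E"
    have le: "N x \<le> K / (1 - \<theta>) * N (x - T x) + K * \<theta> ^ n * N x" for n
    proof -
      have "N x = N (s n (x - T x) + (T ^^ n) x)" by (simp add: sT[OF x])
      also have "\<dots> \<le> N (s n (x - T x)) + N ((T ^^ n) x)"
        by (intro norm_triangle s_mem powm diff_mem op_bound_mem[OF T] x)
      finally show ?thesis
        using s_le[OF op_bound_mem[OF A x], of n] pow[OF x, of n] by linarith
    qed
    show "N x \<le> K / (1 - \<theta>) * N (x - T x)"
    proof (rule LIMSEQ_le_const)
      show "(\<lambda>n. K / (1 - \<theta>) * N (x - T x) + K * \<theta> ^ n * N x) \<longlonglongrightarrow> K / (1 - \<theta>) * N (x - T x)"
        using tendsto_add[OF tendsto_const lim0] by simp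
    qed (use le in auto)
  next
    fix y assume y: "y \<in> E"
    have "\<exists>n0. \<forall>m\<ge>n0. \<forall>n\<ge>n0. N (s m y - s n y) < e" if "e > 0" for e
    proof -
      have step: "N (s (m + i) y - s m y) \<le> K / (1 - \<theta>) * (K * \<theta> ^ m * N y)" for m i
      proof -
        have "s (m + i) y - s m y = s i ((T ^^ m) y)"
          by (induction i) (simp_all add: s_def funpow_add add.commute[of m] algebra_simps)
        then have "N (s (m + i) y - s m y) \<le> K / (1 - \<theta>) * N ((T ^^ m) y)"
          using s_le[OF powm[OF y]] by simp
        also have "\<dots> \<le> K / (1 - \<theta>) * (K * \<theta> ^ m * N y)"
        proof (cases "N y = 0")
          case True
          then have "y = 0" using norm_eq_0_iff[OF y] by simp
          then show ?thesis using op_bound_zero[OF op_bound_pow[OF T]] by simp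
        next
          case False
          then have "K \<ge> 0" using K[OF y] norm_nonneg[OF y] by (simp add: zero_le_mult_iff)
          then show ?thesis using \<theta> by (intro mult_left_mono pow y) auto
        qed
        finally show ?thesis .
      qed
      have "(\<lambda>m. K / (1 - \<theta>) * (K * \<theta> ^ m * N y)) \<longlonglongrightarrow> 0"
        by (rule tendsto_mult_right_zero[OF lim0])
      then have "\<forall>\<^sub>F m in sequentially. K / (1 - \<theta>) * (K * \<theta> ^ m * N y) < e"
        using \<open>e > 0\<close> by (rule order_tendstoD)
      then obtain n0 where n0: "\<And>m. m \<ge> n0 \<Longrightarrow> K / (1 - \<theta>) * (K * \<theta> ^ m * N y) < e"
        by (auto simp: eventually_sequentially)
      have lt: "N (s n y - s m y) < e" if "m \<ge> n0" "n \<ge> m" for m n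
        using le_less_trans[OF step[of m "n - m"] n0[OF that(1)]] that(2) by simp
      have "N (s m y - s n y) < e" if "m \<ge> n0" "n \<ge> n0" for m n
        using lt[of m n] lt[of n m] norm_diff_commute[OF s_mem[OF y] s_mem[OF y], of m n] that
        by (cases "m \<le> n") auto
      then show ?thesis by blast
    qed
    then obtain x where x: "x \<in> E" "(\<lambda>n. N (s n y - x)) \<longlonglongrightarrow> 0"
      using complete_sequence[of "\<lambda>n. s n y"] s_mem[OF y] by blast
    have "x - T x = y"
    proof (rule limit_unique[of "\<lambda>n. s n y - T (s n y)"])
      show "s n y - T (s n y) \<in> E" for n by (intro op_bound_mem[OF A] s_mem y)
      show "x - T x \<in> E" by (intro op_bound_mem[OF A] x)
      show "y \<in> E" by fact
      show "(\<lambda>n. N (s n y - T (s n y) - (x - T x))) \<longlonglongrightarrow> 0"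
        by (rule op_bound_tendsto[OF A s_mem[OF y] x])
      have "N (s n y - T (s n y) - y) \<le> K * \<theta> ^ n * N y" for n
      proof -
        have "s n y - T (s n y) - y = - (T ^^ n) y"
          unfolding Ts[OF y] by (simp add: s_def)
        then have "N (s n y - T (s n y) - y) = N ((T ^^ n) y)"
          using norm_cscale[OF powm[OF y], of "-1"] by (simp flip: uminus_eq_cscale)
        then show ?thesis using pow[OF y] by simp
      qed
      moreover have "0 \<le> N (s n y - T (s n y) - y)" for n
        by (intro norm_nonneg diff_mem op_bound_mem[OF T] s_mem y)
      ultimately show "(\<lambda>n. N (s n y - T (s n y) - y)) \<longlonglongrightarrow> 0"
        by (intro tendsto_sandwich[OF _ _ tendsto_const lim0[of "N y"]]) auto
    qed
    then show "\<exists>x\<in>E. x - T x = y" using x(1) by blast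
  qed
  then show ?thesis unfolding invertible_op_def by blast
qed

lemma invertible_op_id_minus:
  assumes "op_bound U c" "c < 1"
  shows "invertible_op (\<lambda>x. x - U x)"
proof (rule neumann[OF assms(1) op_bound_nonneg[OF assms(1)] assms(2)])
  show "N ((U ^^ n) x) \<le> 1 * c ^ n * N x" if "x \<in> E" for n x
    using op_bound_le[OF op_bound_pow[OF assms(1)] that] by simp
qed

lemma invertible_op_diff_scalar:
  assumes T: "op_bound T c" and "c < cmod \<alpha>"
  shows "invertible_op (\<lambda>x. T x - cscale \<alpha> x)"
proof -
  have nz: "\<alpha> \<noteq> 0" "cmod \<alpha> > 0" using assms(2) op_bound_nonneg[OF T] by auto
  define U where "U x = cscale (inverse \<alpha>) (T x)" for x
  have U: "op_bound U (c / cmod \<alpha>)"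
    using op_bound_cmult[OF T, of "inverse \<alpha>"] unfolding U_def
    by (simp add: norm_inverse divide_inverse mult.commute)
  have "invertible_op (\<lambda>x. x - U x)"
    by (rule invertible_op_id_minus[OF U]) (use nz assms(2) in simp)
  then obtain R d where R: "op_bound R d" "\<And>x. x \<in> E \<Longrightarrow> R (x - U x) = x"
      "\<And>x. x \<in> E \<Longrightarrow> R x - U (R x) = x"
    unfolding invertible_op_def inverse_op_def by blast
  have eq: "T x - cscale \<alpha> x = cscale (- \<alpha>) (x - U x)" for x
    using nz by (simp add: U_def cseq.scale_right_diff_distrib)
  show ?thesis
    unfolding invertible_op_def inverse_op_def eq
  proof (intro exI[of _ "\<lambda>x. cscale (- inverse \<alpha>) (R x)"] conjI ballI)
    show "\<exists>c. op_bound (\<lambda>x. cscale (- inverse \<alpha>) (R x)) c"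
      using op_bound_cmult[OF R(1)] by blast
    fix x assume x: "x \<in> E"
    have xU: "x - U x \<in> E" using op_bound_mem[OF op_bound_minus[OF op_bound_id U] x] .
    show "cscale (- inverse \<alpha>) (R (cscale (- \<alpha>) (x - U x))) = x"
      unfolding op_bound_cscale[OF R(1) xU] R(2)[OF x] using nz by simp
    have "U (cscale (- inverse \<alpha>) (R x)) = cscale (- inverse \<alpha>) (U (R x))"
      by (rule op_bound_cscale[OF U op_bound_mem[OF R(1) x]])
    then have "cscale (- \<alpha>) (cscale (- inverse \<alpha>) (R x) - U (cscale (- inverse \<alpha>) (R x)))
        = cscale (- \<alpha> * - inverse \<alpha>) (R x - U (R x))"
      by (simp add: cseq.scale_right_diff_distrib)
    then show "cscale (- \<alpha>) (cscale (- inverse \<alpha>) (R x) - U (cscale (- inverse \<alpha>) (R x))) = x"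
      using nz R(3)[OF x] by simp
  qed
qed

lemma invertible_op_cong:
  assumes "invertible_op T" "\<And>x. x \<in> E \<Longrightarrow> S x = T x"
  shows "invertible_op S"
proof -
  obtain R c where "op_bound R c" "\<forall>x\<in>E. R (T x) = x \<and> T (R x) = x"
    using assms(1) by (auto simp: invertible_op_def inverse_op_def)
  then have "inverse_op R S" using assms(2) op_bound_mem unfolding inverse_op_def by metis
  then show ?thesis unfolding invertible_op_def by blast
qed

lemma invertible_op_comp:
  assumes "invertible_op S" "invertible_op T" "\<And>x. x \<in> E \<Longrightarrow> T x \<in> E"
  shows "invertible_op (\<lambda>x. S (T x))"
proof -
  obtain R c where R: "op_bound R c" "\<forall>x\<in>E. R (S x) = x \<and> S (R x) = x"
    using assms(1) by (auto simp: invertible_op_def inverse_op_def)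
  obtain Q d where Q: "op_bound Q d" "\<forall>x\<in>E. Q (T x) = x \<and> T (Q x) = x"
    using assms(2) by (auto simp: invertible_op_def inverse_op_def)
  have "inverse_op (\<lambda>x. Q (R x)) (\<lambda>x. S (T x))"
    unfolding inverse_op_def using op_bound_comp[OF Q(1) R(1)] R Q assms(3) op_bound_mem[OF R(1)]
    by fastforce
  then show ?thesis unfolding invertible_op_def by blast
qed

end


section \<open>Fejer means in the sequence space\<close>

context shift_space
begin

lemma finseq_mem: "x \<in> finseq \<Longrightarrow> x \<in> E"
  using finseq_subset by blast

definition modulation_bound :: real where
  "modulation_bound = (SOME C. 1 \<le> C \<and> (\<forall>z. cmod z = 1 \<longrightarrow> (\<forall>x\<in>E. N (modulate z x) \<le> C * N x)))"

lemma modulation_bound: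
  shows modulation_bound_ge_1: "1 \<le> modulation_bound"
    and norm_modulate_le: "cmod z = 1 \<Longrightarrow> x \<in> E \<Longrightarrow> N (modulate z x) \<le> modulation_bound * N x"
proof -
  obtain C where C: "\<And>z x. cmod z = 1 \<Longrightarrow> x \<in> E \<Longrightarrow> N (modulate z x) \<le> C * N x"
    using modulate_bounded by blast
  have "N (modulate z x) \<le> max C 1 * N x" if "cmod z = 1" "x \<in> E" for z x
    using C[OF that] mult_right_mono[OF max.cobounded1 norm_nonneg[OF that(2)], of C 1] by linarith
  then have "\<exists>C. 1 \<le> C \<and> (\<forall>z. cmod z = 1 \<longrightarrow> (\<forall>x\<in>E. N (modulate z x) \<le> C * N x))"
    by (intro exI[of _ "max C 1"]) auto
  from someI_ex[OF this] show "1 \<le> modulation_bound"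
    "cmod z = 1 \<Longrightarrow> x \<in> E \<Longrightarrow> N (modulate z x) \<le> modulation_bound * N x"
    by (auto simp: modulation_bound_def)
qed

lemma modulate_mem: "cmod z = 1 \<Longrightarrow> x \<in> E \<Longrightarrow> modulate z x \<in> E"
  using modulate_into by blast

lemma op_bound_modulate: "cmod z = 1 \<Longrightarrow> op_bound (modulate z) modulation_bound"
  using modulation_bound_ge_1 norm_modulate_le modulate_mem unfolding op_bound_def
  by (auto simp: modulate_def cscale_def cseq_apply algebra_simps)

lemma coord_bound: "\<exists>b\<ge>0. \<forall>x\<in>E. cmod (x n) \<le> b * N x"
proof -
  have "openin mtopology {x \<in> topspace mtopology. x n \<in> ball 0 1}"
    using continuous_coord[of n] unfolding seq_topology_def
    by (rule openin_continuous_map_preimage) simp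
  moreover have "0 \<in> {x \<in> topspace mtopology. x n \<in> ball 0 1}"
    by (simp add: cseq_apply)
  ultimately obtain r where r: "r > 0" "mball 0 r \<subseteq> {x \<in> topspace mtopology. x n \<in> ball 0 1}"
    unfolding openin_mtopology by blast
  have small: "cmod (x n) < 1" if "x \<in> E" "N x < r" for x
  proof -
    have "x \<in> mball 0 r"
      using that norm_diff_commute[of 0 x] by (simp add: in_mball seq_dist_def)
    then show ?thesis using r(2) by auto
  qed
  have "cmod (x n) \<le> 2 / r * N x" if x: "x \<in> E" for x
  proof (cases "x = 0")
    case False
    then have pos: "N x > 0" using norm_eq_0_iff[OF x] norm_nonneg[OF x] by linarith
    define t where "t = r / (2 * N x)"
    have "t > 0" using pos r(1) by (simp add: t_def)
    have "N (cscale (of_real t) x) = r / 2"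
    proof -
      have "t * N x = r / 2" using pos by (simp add: t_def)
      then show ?thesis using norm_cscale[OF x, of "of_real t"] \<open>t > 0\<close> by simp
    qed
    then have "cmod (cscale (of_real t) x n) < 1"
      using r(1) by (intro small cscale_mem x) simp
    then have "t * cmod (x n) < 1" using \<open>t > 0\<close> by (simp add: cscale_def norm_mult)
    then show ?thesis using pos r(1) by (simp add: t_def field_simps)
  qed (simp add: cseq_apply)
  then show ?thesis using r(1) by (intro exI[of _ "2 / r"]) auto
qed

lemma coord_tendsto:
  assumes x: "\<And>k. x k \<in> E" "y \<in> E" "(\<lambda>k. N (x k - y)) \<longlonglongrightarrow> 0"
  shows "(\<lambda>k. x k n) \<longlonglongrightarrow> y n"
proof -
  obtain b where b: "\<forall>x\<in>E. cmod (x n) \<le> b * N x" using coord_bound by blast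
  have "cmod (x k n - y n) \<le> N (x k - y) * b" for k
    using b[rule_format, OF diff_mem[OF x(1,2)], of k] by (simp add: cseq_apply mult.commute)
  then have "(\<lambda>k. x k n - y n) \<longlonglongrightarrow> 0"
    using x(3) by (intro Lim_null_comparison[OF always_eventually tendsto_mult_left_zero[OF x(3)]]) auto
  then show ?thesis by (rule LIM_zero_cancel)
qed

lemma finseq_approx:
  assumes "x \<in> E" "e > 0"
  obtains a where "a \<in> finseq" "N (x - a) < e"
proof -
  have "x \<in> mtopology closure_of finseq"
    using finseq_dense assms(1) by (simp add: seq_topology_def)
  then obtain a where a: "a \<in> finseq" "a \<in> mball x e"
    using assms(2) unfolding metric_closure_of by blast
  then have "N (x - a) < e" by (auto simp: in_mball seq_dist_def)
  then show thesis using that a(1) by blast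
qed

lemma finseq_sequence:
  assumes "x \<in> E"
  obtains a where "\<And>k. a k \<in> finseq" "(\<lambda>k. N (a k - x)) \<longlonglongrightarrow> 0"
proof -
  have "\<exists>a. a \<in> finseq \<and> N (x - a) < inverse (real (Suc k))" for k
    using finseq_approx[OF assms, of "inverse (real (Suc k))"] by auto
  then obtain a where a: "\<And>k. a k \<in> finseq" "\<And>k. N (x - a k) < inverse (real (Suc k))"
    by metis
  have "(\<lambda>k. N (a k - x)) \<longlonglongrightarrow> 0"
  proof (rule tendsto_sandwich[OF _ _ tendsto_const LIMSEQ_inverse_real_of_nat])
    show "\<forall>\<^sub>F k in sequentially. 0 \<le> N (a k - x)"
      using norm_nonneg[OF diff_mem[OF finseq_mem[OF a(1)] assms]] by simp
    show "\<forall>\<^sub>F k in sequentially. N (a k - x) \<le> inverse (real (Suc k))"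
      using a norm_diff_commute[OF finseq_mem assms] by (auto intro!: always_eventually less_imp_le)
  qed
  then show thesis using that a(1) by blast
qed

lemma op_eq_dense:
  assumes S: "op_bound S c" and T: "op_bound T d" and eq: "\<And>a. a \<in> finseq \<Longrightarrow> S a = T a"
    and x: "x \<in> E"
  shows "S x = T x"
proof -
  obtain a where a: "\<And>k. a k \<in> finseq" "(\<lambda>k. N (a k - x)) \<longlonglongrightarrow> 0"
    using finseq_sequence[OF x] by blast
  show ?thesis
  proof (rule limit_unique)
    show "S (a k) \<in> E" for k by (intro op_bound_mem[OF S] finseq_mem a)
    show "S x \<in> E" "T x \<in> E" using op_bound_mem S T x by auto
    show "(\<lambda>k. N (S (a k) - S x)) \<longlonglongrightarrow> 0"
      by (intro op_bound_tendsto[OF S] finseq_mem a x)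
    show "(\<lambda>k. N (S (a k) - T x)) \<longlonglongrightarrow> 0"
      unfolding eq[OF a(1)] by (intro op_bound_tendsto[OF T] finseq_mem a x)
  qed
qed

text \<open>A linear map on all sequences whose coordinates are continuous on \<open>E\<close> is the extension by continuity of its
  restriction to the finite sequences; so membership in \<open>E\<close> and the bound have to be checked only there.\<close>

lemma op_bound_extend:
  assumes add: "\<And>x y. T (x + y) = T x + T y" and scale: "\<And>a x. T (cscale a x) = cscale a (T x)"
    and coord: "\<And>n. \<exists>b. \<forall>x\<in>E. cmod (T x n) \<le> b * N x"
    and mem: "\<And>a. a \<in> finseq \<Longrightarrow> T a \<in> E"
    and le: "\<And>a. a \<in> finseq \<Longrightarrow> N (T a) \<le> c * N a" and "0 \<le> c"
  shows "op_bound T c"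
proof -
  have diff: "T (x - y) = T x - T y" for x y
    using add[of "x - y" y] by simp
  have main: "T x \<in> E \<and> N (T x) \<le> c * N x" if x: "x \<in> E" for x
  proof -
    obtain a where a: "\<And>k. a k \<in> finseq" "(\<lambda>k. N (a k - x)) \<longlonglongrightarrow> 0"
      using finseq_sequence[OF x] by blast
    have Ta: "T (a k) \<in> E" for k by (intro mem a)
    have "\<exists>K. \<forall>i\<ge>K. \<forall>j\<ge>K. N (T (a i) - T (a j)) < e" if "e > 0" for e
    proof -
      define m where "m = 2 * (c + 1)"
      have "m > 0" using \<open>0 \<le> c\<close> by (simp add: m_def)
      define d where "d = e / m"
      have "d > 0" using \<open>e > 0\<close> \<open>m > 0\<close> by (simp add: d_def)
      then have "\<forall>\<^sub>F k in sequentially. N (a k - x) < d"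
        using a(2) by (intro order_tendstoD) auto
      then obtain K where K: "\<And>k. k \<ge> K \<Longrightarrow> N (a k - x) < d"
        by (auto simp: eventually_sequentially)
      have "N (T (a i) - T (a j)) < e" if "i \<ge> K" "j \<ge> K" for i j
      proof -
        have "N (T (a i) - T (a j)) \<le> c * N (a i - a j)"
          using le[OF finseq_diff[OF a(1) a(1)]] by (simp add: diff)
        also have "\<dots> \<le> c * (N (a i - x) + N (a j - x))"
          using norm_diff_triangle[of "a i" x "a j"] norm_diff_commute[of x "a j"] x finseq_mem[OF a(1)]
          by (intro mult_left_mono \<open>0 \<le> c\<close>) simp
        also have "\<dots> \<le> c * (d + d)"
          using K[OF that(1)] K[OF that(2)] by (intro mult_left_mono \<open>0 \<le> c\<close>) simp
        also have "\<dots> < (c + 1) * (d + d)" using \<open>d > 0\<close> by simp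
        also have "\<dots> = m * d" by (simp add: m_def algebra_simps)
        also have "\<dots> = e" using \<open>m > 0\<close> by (simp add: d_def)
        finally show ?thesis .
      qed
      then show ?thesis by blast
    qed
    then obtain y where y: "y \<in> E" "(\<lambda>k. N (T (a k) - y)) \<longlonglongrightarrow> 0"
      using complete_sequence[of "\<lambda>k. T (a k)"] Ta by blast
    have "T x = y"
    proof
      fix n
      obtain b where b: "\<forall>x\<in>E. cmod (T x n) \<le> b * N x" using coord by blast
      have "cmod (T (a k) n - T x n) \<le> N (a k - x) * b" for k
        using b[rule_format, OF diff_mem[OF finseq_mem[OF a(1)] x], of k]
        by (simp add: diff cseq_apply mult.commute)
      then have "(\<lambda>k. T (a k) n - T x n) \<longlonglongrightarrow> 0"
        by (intro Lim_null_comparison[OF always_eventually tendsto_mult_left_zero[OF a(2)]]) auto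
      then have "(\<lambda>k. T (a k) n) \<longlonglongrightarrow> T x n" by (rule LIM_zero_cancel)
      moreover have "(\<lambda>k. T (a k) n) \<longlonglongrightarrow> y n" by (rule coord_tendsto[OF Ta y])
      ultimately show "T x n = y n" by (rule LIMSEQ_unique)
    qed
    have le': "N y \<le> N (T (a k) - y) + c * (N (a k - x) + N x)" for k
    proof -
      have "N y \<le> N (T (a k) - y) + N (T (a k))"
        using norm_le_diff[OF y(1) Ta] norm_diff_commute[OF y(1) Ta] by simp
      moreover have "N (T (a k)) \<le> c * N (a k)" by (rule le[OF a(1)])
      moreover have "c * N (a k) \<le> c * (N (a k - x) + N x)"
        by (intro mult_left_mono norm_le_diff finseq_mem a x \<open>0 \<le> c\<close>)
      ultimately show ?thesis by linarith
    qed
    have "(\<lambda>k. N (T (a k) - y) + c * (N (a k - x) + N x)) \<longlonglongrightarrow> 0 + c * (0 + N x)"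
      by (intro tendsto_intros a y)
    then have "N y \<le> 0 + c * (0 + N x)" by (rule LIMSEQ_le_const) (use le' in auto)
    then show ?thesis using \<open>T x = y\<close> y(1) by simp
  qed
  then show ?thesis unfolding op_bound_def using add scale \<open>0 \<le> c\<close> by simp
qed

lemma finseq_eq_sum: "x \<in> finseq \<Longrightarrow> x = (\<Sum>n | x n \<noteq> 0. cscale (x n) (single n))"
proof -
  assume x: "x \<in> finseq"
  then have fin: "finite {n. x n \<noteq> 0}" by (simp add: finseq_def)
  have sum_apply: "(\<Sum>n\<in>A. f n) m = (\<Sum>n\<in>A. f n m)" if "finite A" for A :: "int set" and f :: "int \<Rightarrow> cseq" and m
    using that by (induction A rule: finite_induct) (simp_all add: cseq_apply)
  show ?thesis
  proof
    fix m
    show "x m = (\<Sum>n | x n \<noteq> 0. cscale (x n) (single n)) m"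
      by (simp add: sum_apply[OF fin] cscale_def single_def fin if_distrib sum.delta cong: if_cong)
  qed
qed

lemma weight_mem_finseq:
  assumes "finite {n. w n \<noteq> 0} \<or> x \<in> finseq"
  shows "weight w x \<in> finseq"
proof -
  have "{n. weight w x n \<noteq> 0} \<subseteq> {n. w n \<noteq> 0}" "{n. weight w x n \<noteq> 0} \<subseteq> {n. x n \<noteq> 0}"
    by (auto simp: weight_def)
  then show ?thesis using assms by (auto simp: finseq_def dest: finite_subset)
qed

text \<open>On a finite sequence the weight acts as an average of modulations.\<close>

lemma op_bound_weight:
  assumes w: "averaging_weight w"
  shows "op_bound (weight w) modulation_bound"
proof (rule op_bound_extend)
  show "weight w (x + y) = weight w x + weight w y" for x y
    by (auto simp: weight_def cseq_apply algebra_simps)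
  show "weight w (cscale a x) = cscale a (weight w x)" for a x
    by (auto simp: weight_def cscale_def)
  show "\<exists>b. \<forall>x\<in>E. cmod (weight w x n) \<le> b * N x" for n
  proof -
    obtain b where b: "\<forall>x\<in>E. cmod (x n) \<le> b * N x" using coord_bound by blast
    have "cmod (weight w x n) \<le> cmod (x n)" for x
      using mult_right_mono[OF averaging_weight_le_1[OF w], of "cmod (x n)" n]
      by (simp add: weight_def norm_mult)
    then show ?thesis using b order_trans by blast
  qed
  fix x assume x: "x \<in> finseq"
  then show "weight w x \<in> E" by (intro finseq_mem weight_mem_finseq) simp
  obtain L where L: "\<And>n. x n \<noteq> 0 \<Longrightarrow> \<bar>n\<bar> \<le> int L" using finseq_window[OF x] by blast
  obtain Z c where Z: "finite Z" "\<And>z. z \<in> Z \<Longrightarrow> cmod z = 1" "(\<Sum>z\<in>Z. cmod (c z)) \<le> 1"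
    "\<And>j. \<bar>j\<bar> \<le> int L \<Longrightarrow> w j = (\<Sum>z\<in>Z. c z * z powi j)"
    by (rule averaging_weightE[OF w, of "int L"]) blast
  have eq: "weight w x = (\<Sum>z\<in>Z. cscale (c z) (modulate z x))"
  proof
    fix n
    have "(\<Sum>z\<in>Z. cscale (c z) (modulate z x)) n = (\<Sum>z\<in>Z. c z * z powi n) * x n"
      using Z(1) by (induction Z rule: finite_induct)
        (simp_all add: cseq_apply cscale_def modulate_def algebra_simps)
    then show "weight w x n = (\<Sum>z\<in>Z. cscale (c z) (modulate z x)) n"
      using L[of n] Z(4)[of n] by (cases "x n = 0") (auto simp: weight_def)
  qed
  have xE: "x \<in> E" using x by (rule finseq_mem)
  have "N (weight w x) \<le> (\<Sum>z\<in>Z. N (cscale (c z) (modulate z x)))"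
    unfolding eq by (intro norm_sum_le cscale_mem modulate_mem xE Z(2))
  also have "\<dots> \<le> (\<Sum>z\<in>Z. cmod (c z) * (modulation_bound * N x))"
    using norm_cscale[OF modulate_mem[OF Z(2) xE]] norm_modulate_le[OF Z(2) xE]
    by (intro sum_mono) (auto intro!: mult_left_mono)
  also have "\<dots> = (\<Sum>z\<in>Z. cmod (c z)) * (modulation_bound * N x)"
    by (simp add: sum_distrib_right)
  also have "\<dots> \<le> 1 * (modulation_bound * N x)"
    using modulation_bound_ge_1 norm_nonneg[OF xE] by (intro mult_right_mono Z(3)) auto
  finally show "N (weight w x) \<le> modulation_bound * N x" by simp
qed (use modulation_bound_ge_1 in simp)

lemma weight_tendsto:
  assumes w: "\<And>k. averaging_weight (u k)" and lim: "\<And>n. (\<lambda>k. u k n) \<longlonglongrightarrow> 1" and x: "x \<in> E"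
  shows "(\<lambda>k. N (weight (u k) x - x)) \<longlonglongrightarrow> 0"
proof (rule LIMSEQ_I)
  fix e :: real assume "e > 0"
  define m where "m = 2 * (modulation_bound + 1)"
  have "m > 0" using modulation_bound_ge_1 by (simp add: m_def)
  define d where "d = e / m"
  have "d > 0" using \<open>e > 0\<close> \<open>m > 0\<close> by (simp add: d_def)
  then obtain a where a: "a \<in> finseq" "N (x - a) < d" using finseq_approx[OF x] by blast
  have aE: "a \<in> E" using a(1) by (rule finseq_mem)
  have wm: "weight (u k) y \<in> E" if "y \<in> E" for k y
    using op_bound_mem[OF op_bound_weight[OF w] that] .
  define q where "q k = (\<Sum>n | a n \<noteq> 0. cmod ((u k n - 1) * a n) * N (single n))" for k
  have "(\<lambda>k. q k) \<longlonglongrightarrow> (\<Sum>n | a n \<noteq> 0. cmod ((1 - 1) * a n) * N (single n))"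
    unfolding q_def by (intro tendsto_intros lim)
  then have "\<forall>\<^sub>F k in sequentially. q k < e / 2"
    using \<open>e > 0\<close> by (intro order_tendstoD) auto
  then obtain K where K: "\<And>k. k \<ge> K \<Longrightarrow> q k < e / 2" by (auto simp: eventually_sequentially)
  have q: "N (weight (u k) a - a) \<le> q k" for k
  proof -
    let ?y = "weight (u k) a - a"
    have y: "?y \<in> finseq" using a(1) by (intro finseq_diff weight_mem_finseq) auto
    have "N ?y = N (\<Sum>n | ?y n \<noteq> 0. cscale (?y n) (single n))"
      using finseq_eq_sum[OF y] by simp
    also have "\<dots> \<le> (\<Sum>n | ?y n \<noteq> 0. N (cscale (?y n) (single n)))"
      by (intro norm_sum_le cscale_mem finseq_mem finseq_single)
    also have "\<dots> = (\<Sum>n | ?y n \<noteq> 0. cmod ((u k n - 1) * a n) * N (single n))"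
    proof (intro sum.cong refl)
      fix n
      have "?y n = (u k n - 1) * a n" by (simp add: cseq_apply weight_def algebra_simps)
      then show "N (cscale (?y n) (single n)) = cmod ((u k n - 1) * a n) * N (single n)"
        using norm_cscale[OF finseq_mem[OF finseq_single]] by simp
    qed
    also have "\<dots> \<le> q k"
      unfolding q_def using a(1) norm_nonneg[OF finseq_mem[OF finseq_single]]
      by (intro sum_mono2) (auto simp: finseq_def cseq_apply weight_def)
    finally show ?thesis .
  qed
  have "norm (N (weight (u k) x - x) - 0) < e" if "k \<ge> K" for k
  proof -
    have "N (weight (u k) x - x) \<le> N (weight (u k) x - weight (u k) a) + N (weight (u k) a - x)"
      by (intro norm_diff_triangle wm x aE)
    also have "N (weight (u k) a - x) \<le> N (weight (u k) a - a) + N (a - x)"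
      by (intro norm_diff_triangle wm x aE)
    also have "N (weight (u k) x - weight (u k) a) \<le> modulation_bound * N (x - a)"
      using op_bound_le[OF op_bound_weight[OF w] diff_mem[OF x aE], of k]
        op_bound_diff[OF op_bound_weight[OF w] x aE, of k] by simp
    also have "N (a - x) = N (x - a)" by (rule norm_diff_commute[OF aE x])
    also have "modulation_bound * N (x - a) \<le> modulation_bound * d"
      using a(2) modulation_bound_ge_1 by (intro mult_left_mono) auto
    finally have "N (weight (u k) x - x) < modulation_bound * d + (e / 2 + d)"
      using q[of k] K[OF that] a(2) by linarith
    also have "\<dots> = m * d / 2 + e / 2" by (simp add: m_def algebra_simps)
    also have "\<dots> = e" using \<open>m > 0\<close> by (simp add: d_def)
    finally show ?thesis using norm_nonneg[OF diff_mem[OF wm[OF x] x]] by simp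
  qed
  then show "\<exists>K. \<forall>k\<ge>K. norm (N (weight (u k) x - x) - 0) < e" by blast
qed

abbreviation fejer :: "nat \<Rightarrow> cseq \<Rightarrow> cseq" where
  "fejer k \<equiv> weight (\<lambda>n. of_real (fejer_weight k n))"

lemmas op_bound_fejer = op_bound_weight[OF averaging_weight_fejer]

lemma fejer_tendsto:
  assumes "x \<in> E" shows "(\<lambda>k. N (fejer k x - x)) \<longlonglongrightarrow> 0"
  by (rule weight_tendsto[OF averaging_weight_fejer _ assms])
    (use tendsto_of_real[OF fejer_weight_tendsto] in simp)

lemma finite_fejer_support: "finite {n. complex_of_real (fejer_weight k n) \<noteq> 0}"
  by (rule finite_subset[of _ "{- int k..int k}"]) (use fejer_weight_support in force)+

lemma fejer_finseq: "fejer k x \<in> finseq"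
  by (intro weight_mem_finseq disjI1 finite_fejer_support)

text \<open>Together with the support of the Fejer weights this allows estimates of norms one window
  of coordinates at a time.\<close>

lemma norm_le_of_fejer:
  assumes x: "x \<in> E" and le: "\<And>k. N (fejer k x) \<le> c"
  shows "N x \<le> c"
proof -
  have "N x \<le> N (fejer k x - x) + c" for k
    using norm_le_diff[OF x finseq_mem[OF fejer_finseq], of k x] le[of k]
      norm_diff_commute[OF x finseq_mem[OF fejer_finseq], of k x] by simp
  moreover have "(\<lambda>k. N (fejer k x - x) + c) \<longlonglongrightarrow> 0 + c"
    by (intro tendsto_intros fejer_tendsto x)
  ultimately show ?thesis using LIMSEQ_le_const[of _ "0 + c" "N x"] by auto
qed

text \<open>A closed graph argument: the operators \<open>x \<mapsto> S\<^sup>s (\<sigma>\<^sub>l x)\<close>, with \<open>\<sigma>\<^sub>l\<close> the Fejer means, have finite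
  rank, and they are pointwise bounded because \<open>S\<^sup>s \<sigma>\<^sub>l = \<sigma>'\<^sub>l S\<^sup>s\<close> for the translated averaging
  weight.  By the Baire category theorem they are uniformly bounded.\<close>

lemma translate_bounded:
  assumes into: "translate s ` E \<subseteq> E"
  shows "\<exists>c. op_bound (translate s) c"
proof -
  let ?w = "\<lambda>l n. complex_of_real (fejer_weight l n)"
  define T where "T l x = translate s (fejer l x)" for l x
  have tr: "translate s x \<in> E" if "x \<in> E" for x using into that by blast
  have T_eq: "T l x = weight (translate s (?w l)) (translate s x)" for l x
    by (auto simp: T_def weight_def translate_def)
  have aw: "averaging_weight (translate s (?w l))" for l
    by (intro averaging_weight_translate averaging_weight_fejer)
  have T_mem: "T l x \<in> E" for l x
    unfolding T_def by (intro finseq_mem finseq_translate fejer_finseq)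
  have T_add: "T l (x + y) = T l x + T l y" for l x y
    by (auto simp: T_def weight_def translate_def cseq_apply algebra_simps)
  have T_diff: "T l (x - y) = T l x - T l y" for l x y
    by (auto simp: T_def weight_def translate_def cseq_apply algebra_simps)
  have T_scale: "T l (cscale a x) = cscale a (T l x)" for l a x
    by (auto simp: T_def weight_def translate_def cscale_def)
  have "\<exists>B\<ge>0. \<forall>x\<in>E. N (T l x) \<le> B * N x" for l
  proof -
    have "\<forall>n. \<exists>b. b \<ge> 0 \<and> (\<forall>x\<in>E. cmod (x n) \<le> b * N x)" using coord_bound by blast
    then obtain b where b: "\<And>n. b n \<ge> 0" "\<And>n x. x \<in> E \<Longrightarrow> cmod (x n) \<le> b n * N x" by metis
    define B where "B = (\<Sum>n\<in>{- int l..int l}. b n * N (single (s + n)))"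
    have sn: "0 \<le> N (single n)" for n by (intro norm_nonneg finseq_mem finseq_single)
    have "N (T l x) \<le> B * (modulation_bound * N x)" if x: "x \<in> E" for x
    proof -
      let ?y = "fejer l x"
      have yE: "?y \<in> E" and y: "?y \<in> finseq" by (auto intro: finseq_mem fejer_finseq)
      have "translate s (sum f A) = (\<Sum>n\<in>A. translate s (f n))" for A :: "int set" and f
        by (induction A rule: infinite_finite_induct) (simp_all add: translate_add)
      note tsum = this
      have T_sum: "T l x = (\<Sum>n | ?y n \<noteq> 0. translate s (cscale (?y n) (single n)))"
        unfolding T_def by (rule trans[OF arg_cong[where f = "translate s", OF finseq_eq_sum[OF y]]]) (rule tsum)
      have "N (T l x) \<le> (\<Sum>n | ?y n \<noteq> 0. N (translate s (cscale (?y n) (single n))))"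
        unfolding T_sum by (intro norm_sum_le finseq_mem finseq_translate finseq_cscale finseq_single)
      also have "\<dots> = (\<Sum>n | ?y n \<noteq> 0. cmod (?y n) * N (single (s + n)))"
        using norm_cscale[OF finseq_mem[OF finseq_single]] by (simp add: translate_cscale)
      also have "\<dots> \<le> (\<Sum>n\<in>{- int l..int l}. cmod (?y n) * N (single (s + n)))"
        using fejer_weight_support[of l] sn by (intro sum_mono2) (force simp: weight_def)+
      also have "\<dots> \<le> (\<Sum>n\<in>{- int l..int l}. b n * N ?y * N (single (s + n)))"
        by (intro sum_mono mult_right_mono b yE sn)
      also have "\<dots> = B * N ?y" unfolding B_def sum_distrib_right by (intro sum.cong) (simp_all add: mult_ac)
      also have "\<dots> \<le> B * (modulation_bound * N x)"
        unfolding B_def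
        by (intro mult_left_mono op_bound_le[OF op_bound_fejer] x sum_nonneg mult_nonneg_nonneg b sn)
      finally show ?thesis .
    qed
    moreover have "0 \<le> B * modulation_bound"
      unfolding B_def using modulation_bound_ge_1 by (intro mult_nonneg_nonneg sum_nonneg b sn) auto
    ultimately show ?thesis
      by (intro exI[of _ "B * modulation_bound"]) (simp add: mult.assoc)
  qed
  then obtain B where B: "\<And>l. B l \<ge> 0" "\<And>l x. x \<in> E \<Longrightarrow> N (T l x) \<le> B l * N x" by metis
  have Tsn: "N (T l x) \<le> modulation_bound * N (translate s x)" if "x \<in> E" for l x
    unfolding T_eq by (intro op_bound_le[OF op_bound_weight[OF aw]] tr that)
  define V where "V k = {x \<in> E. \<forall>l. N (T l x) \<le> real k}" for k :: nat
  have V_closed: "closedin mtopology (V k)" for k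
    unfolding closedin_metric
  proof (intro conjI allI impI)
    fix x assume x: "x \<in> E - V k"
    then obtain l where l: "N (T l x) > real k" by (auto simp: V_def not_le)
    define r where "r = (N (T l x) - k) / (B l + 1)"
    have "r > 0" using l B(1)[of l] by (simp add: r_def)
    moreover have "y \<notin> V k" if "y \<in> mball x r" for y
    proof
      assume "y \<in> V k"
      then have y: "y \<in> E" "N (T l y) \<le> k" by (auto simp: V_def)
      have "N (x - y) < r" using that by (simp add: in_mball seq_dist_def split: if_splits)
      then have "(B l + 1) * N (x - y) < N (T l x) - k"
        using B(1)[of l] by (simp add: r_def field_simps)
      moreover have "N (T l x) \<le> N (T l x - T l y) + N (T l y)"
        by (rule norm_le_diff[OF T_mem T_mem])
      moreover have "N (T l x - T l y) \<le> B l * N (x - y)"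
        using B(2)[OF diff_mem, of x y l] x y by (simp add: T_diff)
      moreover have "0 \<le> N (x - y)" using x y by (intro norm_nonneg diff_mem) auto
      ultimately show False using y(2) by (simp add: distrib_right)
    qed
    ultimately show "\<exists>r>0. disjnt (V k) (mball x r)" by (auto simp: disjnt_iff)
  qed (auto simp: V_def)
  have "\<exists>k. mtopology interior_of (V k) \<noteq> {}"
  proof (rule ccontr)
    assume "\<not> ?thesis"
    then have "mtopology interior_of (\<Union>(range V)) = {}"
      using V_closed by (intro metric_Baire_category_alt complete) auto
    moreover have "\<Union>(range V) = E"
    proof (intro equalityI subsetI)
      fix x assume x: "x \<in> E"
      obtain k :: nat where k: "modulation_bound * N (translate s x) \<le> k"
        using real_arch_simple by blast
      have "x \<in> V k" using x Tsn[OF x] k order_trans unfolding V_def by blast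
      then show "x \<in> \<Union>(range V)" by blast
    qed (auto simp: V_def)
    moreover have "mtopology interior_of E = E"
      by (metis interior_of_topspace topspace_mtopology)
    ultimately show False using zero_mem by auto
  qed
  then obtain k x0 r where x0: "x0 \<in> E" "r > 0" "mball x0 r \<subseteq> V k"
    by (auto simp: in_interior_of_mball)
  have small: "N (T l x) \<le> 2 * k" if x: "x \<in> E" "N x < r" for l x
  proof -
    have "x0 + x \<in> mball x0 r"
    proof -
      have "N (x0 - (x0 + x)) = N x"
        using norm_cscale[OF x(1), of "-1"] by (simp flip: uminus_eq_cscale)
      then show ?thesis using x x0 by (simp add: in_mball seq_dist_def add_mem)
    qed
    then have a: "N (T l (x0 + x)) \<le> k" using x0(3) by (auto simp: V_def)
    have "x0 \<in> mball x0 r" using x0 by simp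
    then have "x0 \<in> V k" using x0(3) by blast
    then have b: "N (T l x0) \<le> k" by (simp add: V_def)
    have "N (T l x) = N (T l (x0 + x) - T l x0)" by (simp add: T_add)
    also have "\<dots> \<le> N (T l (x0 + x)) + N (T l x0)" by (intro norm_diff_le T_mem)
    finally show ?thesis using a b by simp
  qed
  have T_le: "N (T l x) \<le> 4 * k / r * N x" if x: "x \<in> E" for l x
  proof (cases "x = 0")
    case True
    then show ?thesis using T_scale[of l 0 0] by simp
  next
    case False
    then have pos: "N x > 0" using norm_eq_0_iff[OF x] norm_nonneg[OF x] by linarith
    define t where "t = r / (2 * N x)"
    have "t > 0" using pos x0(2) by (simp add: t_def)
    have "N (cscale (of_real t) x) = r / 2"
    proof -
      have "t * N x = r / 2" using pos by (simp add: t_def)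
      then show ?thesis using norm_cscale[OF x, of "of_real t"] \<open>t > 0\<close> by simp
    qed
    then have "N (T l (cscale (of_real t) x)) \<le> 2 * k"
      using x0(2) by (intro small cscale_mem x) simp
    then have "t * N (T l x) \<le> 2 * k"
      using norm_cscale[OF T_mem, of "of_real t" l x] \<open>t > 0\<close> by (simp add: T_scale)
    then show ?thesis using pos x0(2) by (simp add: t_def field_simps)
  qed
  have lim: "(\<lambda>l. N (T l x - translate s x)) \<longlonglongrightarrow> 0" if "x \<in> E" for x
    unfolding T_eq
  proof (rule weight_tendsto[OF aw _ tr[OF that]])
    show "(\<lambda>l. translate s (?w l) n) \<longlonglongrightarrow> 1" for n
      unfolding translate_def using tendsto_of_real[OF fejer_weight_tendsto] by simp
  qed
  have "op_bound (translate s) (4 * k / r)"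
    unfolding op_bound_def
  proof (intro conjI ballI allI)
    fix x assume x: "x \<in> E"
    have "N (translate s x) \<le> N (T l x - translate s x) + 4 * k / r * N x" for l
      using norm_le_diff[OF tr[OF x] T_mem, of l x] norm_diff_commute[OF tr[OF x] T_mem, of l x]
        T_le[OF x, of l] by simp
    moreover have "(\<lambda>l. N (T l x - translate s x) + 4 * k / r * N x) \<longlonglongrightarrow> 0 + 4 * k / r * N x"
      by (intro tendsto_intros lim x)
    ultimately show "N (translate s x) \<le> 4 * k / r * N x"
      using LIMSEQ_le_const[of _ "0 + 4 * k / r * N x" "N (translate s x)"] by auto
  qed (use tr x0(2) in \<open>auto simp: translate_add translate_cscale\<close>)
  then show ?thesis ..
qed

end


section \<open>Multipliers and convolution operators\<close>

context shift_space
begin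

definition multiplier_bound :: "(cseq \<Rightarrow> cseq) \<Rightarrow> real \<Rightarrow> bool" where
  "multiplier_bound T c \<longleftrightarrow> op_bound T c \<and> (\<forall>a\<in>finseq. T (shift a) = shift (T a))"

lemma multiplier_iff: "multiplier E N M \<longleftrightarrow> (\<exists>c. multiplier_bound M c)"
  by (auto simp: multiplier_def multiplier_bound_def bounded_operator_iff)

lemma multiplier_translate:
  assumes T: "multiplier_bound T c" and a: "a \<in> finseq"
  shows "T (translate j a) = translate j (T a)"
proof -
  have pos: "T (translate (int k) b) = translate (int k) (T b)" if "b \<in> finseq" for k b
  proof (induction k)
    case (Suc k)
    have "T (translate (int (Suc k)) b) = T (shift (translate (int k) b))"
      by (simp add: shift_eq_translate)
    also have "\<dots> = shift (T (translate (int k) b))"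
      using T finseq_translate[OF that] by (simp add: multiplier_bound_def)
    finally show ?case using Suc by (simp add: shift_eq_translate)
  qed simp
  show ?thesis
  proof (cases "0 \<le> j")
    case True
    then show ?thesis using pos[OF a, of "nat j"] by simp
  next
    case False
    have "T a = T (translate (int (nat (- j))) (translate j a))" using False by simp
    also have "\<dots> = translate (- j) (T (translate j a))"
      using pos[OF finseq_translate[OF a], of "nat (- j)" j] False by simp
    finally show ?thesis by simp
  qed
qed

lemma multiplier_eq_conv:
  assumes T: "multiplier_bound T c" and "x \<in> finseq"
  shows "T x = conv x (hat T)"
proof (rule finseq_induct[where P = "\<lambda>x. T x = conv x (hat T)", OF assms(2)])
  have Tb: "op_bound T c" using T by (simp add: multiplier_bound_def)
  show "T 0 = conv 0 (hat T)" by (simp add: op_bound_zero[OF Tb])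
  fix x j a assume x: "x \<in> finseq" "T x = conv x (hat T)"
  have "T (single j) = translate j (hat T)"
    using multiplier_translate[OF T, of "single 0" j] by (simp add: hat_def unit_seq_eq_single)
  then show "T (x + cscale a (single j)) = conv (x + cscale a (single j)) (hat T)"
    using x op_bound_add[OF Tb] op_bound_cscale[OF Tb] finseq_mem
    by (simp add: conv_step)
qed

lemma conv_coord_bound:
  assumes \<phi>: "\<phi> \<in> finseq"
  shows "\<exists>b. \<forall>x\<in>E. cmod (conv \<phi> x n) \<le> b * N x"
proof -
  have "\<forall>m. \<exists>b. \<forall>x\<in>E. cmod (x m) \<le> b * N x" using coord_bound by blast
  then obtain b where b: "\<And>m x. x \<in> E \<Longrightarrow> cmod (x m) \<le> b m * N x" by metis
  have "cmod (conv \<phi> x n) \<le> (\<Sum>k | \<phi> k \<noteq> 0. cmod (\<phi> k) * b (n - k)) * N x" if x: "x \<in> E" for x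
  proof -
    have "cmod (conv \<phi> x n) \<le> (\<Sum>k | \<phi> k \<noteq> 0. cmod (\<phi> k) * cmod (x (n - k)))"
      unfolding conv_def by (rule order_trans[OF norm_sum]) (simp add: norm_mult)
    also have "\<dots> \<le> (\<Sum>k | \<phi> k \<noteq> 0. cmod (\<phi> k) * (b (n - k) * N x))"
      by (intro sum_mono mult_left_mono b x) auto
    finally show ?thesis by (simp add: sum_distrib_right mult.assoc)
  qed
  then show ?thesis by blast
qed

lemma op_bound_convI:
  assumes \<phi>: "\<phi> \<in> finseq" and "0 \<le> c" and le: "\<And>x. x \<in> finseq \<Longrightarrow> N (conv \<phi> x) \<le> c * N x"
  shows "op_bound (conv \<phi>) c"
  using assms by (intro op_bound_extend conv_add_right conv_cscale_right conv_coord_bound)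
    (auto intro: finseq_mem)

text \<open>Modulating a multiplier, \<open>T \<mapsto> \<psi>\<^sub>z T \<psi>\<^sub>z\<^sup>-\<^sup>1\<close>, modulates its coefficients; so an averaging weight applied
  to the coefficients of \<open>T\<close> is, on every window, an average of operators of norm at most
  \<open>C\<^sup>2 c\<close>.  A Fejer mean on the left restricts to a window, at the cost of a further factor \<open>C\<close>.\<close>

lemma op_bound_conv_weight_hat:
  assumes T: "multiplier_bound T c" and w: "averaging_weight w" and fin: "finite {n. w n \<noteq> 0}"
  shows "op_bound (conv (weight w (hat T))) (modulation_bound ^ 3 * c)"
proof (rule op_bound_convI)
  have Tb: "op_bound T c" using T by (simp add: multiplier_bound_def)
  let ?C = modulation_bound
  note C1 = modulation_bound_ge_1 and c0 = op_bound_nonneg[OF Tb]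
  let ?\<phi> = "weight w (hat T)"
  show \<phi>: "?\<phi> \<in> finseq" using fin by (intro weight_mem_finseq) simp
  show "0 \<le> ?C ^ 3 * c" using C1 c0 by simp
  fix x assume x: "x \<in> finseq"
  have xE: "x \<in> E" using x by (rule finseq_mem)
  show "N (conv ?\<phi> x) \<le> ?C ^ 3 * c * N x"
  proof (rule norm_le_of_fejer)
    show "conv ?\<phi> x \<in> E" using \<phi> x by (intro finseq_mem conv_finseq)
    fix l
    obtain k where k: "\<And>n. x n \<noteq> 0 \<Longrightarrow> \<bar>n\<bar> \<le> int k" using finseq_window[OF x] by blast
    obtain Z c' where Z: "finite Z" "\<And>z. z \<in> Z \<Longrightarrow> cmod z = 1" "(\<Sum>z\<in>Z. cmod (c' z)) \<le> 1"
      "\<And>j. \<bar>j\<bar> \<le> int l + int k \<Longrightarrow> w j = (\<Sum>z\<in>Z. c' z * z powi j)"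
      by (rule averaging_weightE[OF w, of "int l + int k"]) blast
    have Z': "cmod (inverse z) = 1" if "z \<in> Z" for z using Z(2)[OF that] by (simp add: norm_inverse)
    define g where "g z = modulate z (T (modulate (inverse z) x))" for z
    define y where "y = (\<Sum>z\<in>Z. cscale (c' z) (g z))"
    have gE: "g z \<in> E" and g_le: "N (g z) \<le> ?C * (c * (?C * N x))" if z: "z \<in> Z" for z
    proof -
      note m = modulate_mem[OF Z'[OF z] xE]
      show "g z \<in> E" unfolding g_def by (intro modulate_mem Z(2)[OF z] op_bound_mem[OF Tb] m)
      have "N (g z) \<le> ?C * N (T (modulate (inverse z) x))"
        unfolding g_def by (intro norm_modulate_le Z(2)[OF z] op_bound_mem[OF Tb] m)
      also have "\<dots> \<le> ?C * (c * N (modulate (inverse z) x))"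
        using C1 by (intro mult_left_mono op_bound_le[OF Tb] m) auto
      also have "\<dots> \<le> ?C * (c * (?C * N x))"
        using C1 c0 by (intro mult_left_mono norm_modulate_le Z'[OF z] xE) auto
      finally show "N (g z) \<le> ?C * (c * (?C * N x))" .
    qed
    have g_eq: "g z n = (\<Sum>j | x j \<noteq> 0. x j * hat T (n - j) * z powi (n - j))" if z: "z \<in> Z" for z n
    proof -
      have nz: "z \<noteq> 0" using Z(2)[OF z] by auto
      have mx: "modulate (inverse z) x \<in> finseq"
        using x nz by (simp add: finseq_def modulate_def)
      have supp: "{j. modulate (inverse z) x j \<noteq> 0} = {j. x j \<noteq> 0}"
        using nz by (simp add: modulate_def)
      show ?thesis
        unfolding g_def multiplier_eq_conv[OF T mx] modulate_def[of z] conv_def supp sum_distrib_right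
        using nz by (intro sum.cong) (auto simp: modulate_def power_int_inverse power_int_diff field_simps)
    qed
    have yE: "y \<in> E" unfolding y_def by (intro sum_mem cscale_mem gE)
    have y_eq: "y n = conv ?\<phi> x n" if n: "\<bar>n\<bar> \<le> int l" for n
    proof -
      have "y n = (\<Sum>z\<in>Z. c' z * g z n)"
        unfolding y_def using Z(1)
        by (induction Z rule: finite_induct) (simp_all add: cseq_apply cscale_def)
      also have "\<dots> = (\<Sum>z\<in>Z. \<Sum>j | x j \<noteq> 0. c' z * (x j * hat T (n - j) * z powi (n - j)))"
        by (intro sum.cong) (auto simp: g_eq sum_distrib_left)
      also have "\<dots> = (\<Sum>j | x j \<noteq> 0. \<Sum>z\<in>Z. c' z * (x j * hat T (n - j) * z powi (n - j)))"
        by (rule sum.swap)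
      also have "\<dots> = (\<Sum>j | x j \<noteq> 0. x j * ?\<phi> (n - j))"
      proof (intro sum.cong refl)
        fix j assume "j \<in> {j. x j \<noteq> 0}"
        then have "\<bar>n - j\<bar> \<le> int l + int k" using k[of j] n by auto
        then have "w (n - j) = (\<Sum>z\<in>Z. c' z * z powi (n - j))" by (rule Z(4))
        then show "(\<Sum>z\<in>Z. c' z * (x j * hat T (n - j) * z powi (n - j))) = x j * ?\<phi> (n - j)"
          by (simp add: weight_def sum_distrib_left sum_distrib_right mult_ac)
      qed
      also have "\<dots> = conv x ?\<phi> n" by (simp add: conv_def)
      also have "\<dots> = conv ?\<phi> x n" using conv_commute[OF x \<phi>] by simp
      finally show ?thesis .
    qed
    have "fejer l (conv ?\<phi> x) = fejer l y"
    proof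
      fix n
      show "fejer l (conv ?\<phi> x) n = fejer l y n"
        using y_eq[of n] fejer_weight_support[of l n] by (cases "\<bar>n\<bar> \<le> int l") (auto simp: weight_def)
    qed
    then have "N (fejer l (conv ?\<phi> x)) \<le> ?C * N y"
      using op_bound_le[OF op_bound_fejer yE] by simp
    also have "N y \<le> (\<Sum>z\<in>Z. N (cscale (c' z) (g z)))"
      unfolding y_def by (intro norm_sum_le cscale_mem gE)
    also have "\<dots> = (\<Sum>z\<in>Z. cmod (c' z) * N (g z))"
      by (intro sum.cong) (auto simp: norm_cscale gE)
    also have "\<dots> \<le> (\<Sum>z\<in>Z. cmod (c' z) * (?C * (c * (?C * N x))))"
      by (intro sum_mono mult_left_mono g_le) auto
    also have "\<dots> = (\<Sum>z\<in>Z. cmod (c' z)) * (?C * (c * (?C * N x)))"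
      by (simp add: sum_distrib_right)
    also have "\<dots> \<le> 1 * (?C * (c * (?C * N x)))"
      using C1 c0 norm_nonneg[OF xE] by (intro mult_right_mono Z(3)) auto
    finally show "N (fejer l (conv ?\<phi> x)) \<le> ?C ^ 3 * c * N x"
      using C1 by (simp add: power3_eq_cube mult_ac)
  qed
qed

text \<open>If only one of the shifts is bounded, convolution by a finite sequence may fail to be bounded.\<close>

definition conv_symbols :: "cseq set" where
  "conv_symbols = {\<phi> \<in> finseq. \<exists>c. op_bound (conv \<phi>) c}"

lemma conv_symbols_finseq: "\<phi> \<in> conv_symbols \<Longrightarrow> \<phi> \<in> finseq"
  by (simp add: conv_symbols_def)

lemma conv_symbols_add: "\<phi> \<in> conv_symbols \<Longrightarrow> \<psi> \<in> conv_symbols \<Longrightarrow> \<phi> + \<psi> \<in> conv_symbols"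
proof -
  assume "\<phi> \<in> conv_symbols" "\<psi> \<in> conv_symbols"
  then obtain c d where "\<phi> \<in> finseq" "\<psi> \<in> finseq" "op_bound (conv \<phi>) c" "op_bound (conv \<psi>) d"
    by (auto simp: conv_symbols_def)
  then show ?thesis
    using op_bound_cong[OF op_bound_plus[of "conv \<phi>" c "conv \<psi>" d], of "conv (\<phi> + \<psi>)"]
    by (auto simp: conv_symbols_def conv_add_left)
qed

lemma conv_symbols_cscale: "\<phi> \<in> conv_symbols \<Longrightarrow> cscale a \<phi> \<in> conv_symbols"
proof -
  assume "\<phi> \<in> conv_symbols"
  then obtain c where "\<phi> \<in> finseq" "op_bound (conv \<phi>) c" by (auto simp: conv_symbols_def)
  then show ?thesis
    using op_bound_cong[OF op_bound_cmult[of "conv \<phi>" c a], of "conv (cscale a \<phi>)"]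
    by (auto simp: conv_symbols_def conv_cscale_left)
qed

lemma conv_symbols_diff: "\<phi> \<in> conv_symbols \<Longrightarrow> \<psi> \<in> conv_symbols \<Longrightarrow> \<phi> - \<psi> \<in> conv_symbols"
  using conv_symbols_add[of \<phi> "cscale (-1) \<psi>"] conv_symbols_cscale[of \<psi> "-1"]
  by (simp flip: uminus_eq_cscale)

lemma conv_symbols_conv: "\<phi> \<in> conv_symbols \<Longrightarrow> \<psi> \<in> conv_symbols \<Longrightarrow> conv \<phi> \<psi> \<in> conv_symbols"
proof -
  assume "\<phi> \<in> conv_symbols" "\<psi> \<in> conv_symbols"
  then obtain c d where "\<phi> \<in> finseq" "\<psi> \<in> finseq" "op_bound (conv \<phi>) c" "op_bound (conv \<psi>) d"
    by (auto simp: conv_symbols_def)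
  then show ?thesis
    using op_bound_cong[OF op_bound_comp[of "conv \<phi>" c "conv \<psi>" d], of "conv (conv \<phi> \<psi>)"]
    by (auto simp: conv_symbols_def conv_assoc)
qed

lemma single_conv_symbols_iff: "single j \<in> conv_symbols \<longleftrightarrow> (\<exists>c. op_bound (translate j) c)"
proof -
  have "conv (single j) = translate j" by (rule ext) simp
  then show ?thesis by (simp add: conv_symbols_def)
qed

lemma single_0_conv_symbols: "single 0 \<in> conv_symbols"
  using op_bound_cong[OF op_bound_id, of "translate 0"] by (auto simp: single_conv_symbols_iff)

lemma conv_minus_scalar:
  "\<phi> \<in> finseq \<Longrightarrow> conv (\<phi> - cscale l (single 0)) x = conv \<phi> x - cscale l x"
  by (simp add: conv_diff_left conv_cscale_left finseq_cscale)

end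

section \<open>Polynomials in the bounded one of the two shifts\<close>

text \<open>With \<open>s = 1\<close> the bounded shift is \<open>S\<close>, and with \<open>s = -1\<close> it is \<open>S\<^sup>-\<^sup>1\<close>; the latter
  is used only if \<open>S\<close> is not bounded.  Convolutions are studied as Laurent polynomials in the
  bounded shift, and an unbounded \<open>S\<close> enters only through its spectrum.\<close>

locale bounded_shift_space = shift_space +
  fixes s :: int
  assumes s_cases: "s = 1 \<or> s = -1"
    and translate_into: "translate s ` E \<subseteq> E"
    and shift_not_into: "s = -1 \<Longrightarrow> \<not> translate 1 ` E \<subseteq> E"
begin

lemma s_nonzero [simp]: "s \<noteq> 0"
  using s_cases by auto

lemma s_s [simp]: "s * s = 1" "s * (s * n) = n"
  using s_cases by auto

lemma powi_s_s [simp]: "((\<beta>::complex) powi s) powi s = \<beta>"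
  using s_cases by (auto simp: power_int_minus)

lemma translate_s_bounded: "\<exists>c. op_bound (translate s) c"
  by (rule translate_bounded[OF translate_into])

lemma translate_s_mem: "x \<in> E \<Longrightarrow> translate s x \<in> E"
  using translate_into by blast

text \<open>Convolution by this sequence is the polynomial \<open>p(S\<^sup>s)\<close>.\<close>

definition poly_seq :: "complex poly \<Rightarrow> cseq" where
  "poly_seq p = (\<lambda>n. if 0 \<le> s * n then coeff p (nat (s * n)) else 0)"

lemma poly_seq_0 [simp]: "poly_seq 0 = 0"
  by (auto simp: poly_seq_def cseq_apply)

lemma poly_seq_add: "poly_seq (p + q) = poly_seq p + poly_seq q"
  by (auto simp: poly_seq_def cseq_apply)

lemma poly_seq_diff: "poly_seq (p - q) = poly_seq p - poly_seq q"
  by (auto simp: poly_seq_def cseq_apply)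

lemma poly_seq_smult: "poly_seq (smult c p) = cscale c (poly_seq p)"
  by (auto simp: poly_seq_def cscale_def)

lemma poly_seq_monom: "poly_seq (monom 1 k) = single (s * int k)"
  using s_cases by (auto simp: poly_seq_def single_def)

lemma poly_seq_pCons: "poly_seq (pCons c p) = cscale c (single 0) + translate s (poly_seq p)"
proof
  fix n
  show "poly_seq (pCons c p) n = (cscale c (single 0) + translate s (poly_seq p)) n"
  proof (cases "s * n > 0")
    case True
    then have "nat (s * n) = Suc (nat (s * (n - s)))" "0 \<le> s * (n - s)" "n \<noteq> 0"
      by (auto simp: right_diff_distrib)
    then show ?thesis using True by (simp add: poly_seq_def cseq_apply cscale_def single_def translate_def)
  next
    case False
    then show ?thesis using s_cases
      by (cases "n = 0") (auto simp: poly_seq_def cseq_apply cscale_def single_def translate_def right_diff_distrib)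
  qed
qed

lemma poly_seq_finseq [simp]: "poly_seq p \<in> finseq"
  by (induction p rule: pCons_induct)
    (simp_all add: poly_seq_pCons finseq_add finseq_cscale finseq_translate)

lemma conv_poly_seq_pCons:
  "conv (poly_seq (pCons c p)) f = cscale c f + translate s (conv (poly_seq p) f)"
  by (simp add: poly_seq_pCons conv_step conv_translate_left finseq_translate)

lemma conv_poly_seq_mult: "conv (poly_seq (p * q)) f = conv (poly_seq p) (conv (poly_seq q) f)"
proof (induction p rule: pCons_induct)
  case (pCons a p)
  have "poly_seq (pCons a p * q) = cscale a (poly_seq q) + translate s (poly_seq (p * q))"
    by (simp add: poly_seq_add poly_seq_smult poly_seq_pCons)
  then show ?case using pCons
    by (simp add: conv_step conv_translate_left finseq_translate conv_poly_seq_pCons)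
qed simp

lemma conv_poly_seq_linear: "conv (poly_seq [:- \<beta>, 1:]) x = translate s x - cscale \<beta> x"
  by (simp add: conv_poly_seq_pCons)

lemma poly_seq_conv_symbols: "poly_seq p \<in> conv_symbols"
proof (induction p rule: pCons_induct)
  case 0
  show ?case using conv_symbols_cscale[OF single_0_conv_symbols, of 0] by simp
next
  case (pCons a p)
  have "single s \<in> conv_symbols" using translate_s_bounded by (simp add: single_conv_symbols_iff)
  from conv_symbols_conv[OF this pCons.IH] show ?case
    using conv_symbols_cscale[OF single_0_conv_symbols] by (simp add: poly_seq_pCons conv_symbols_add)
qed

lemma laurent_0: "\<phi> \<in> finseq \<Longrightarrow> laurent \<phi> 0 = \<phi> 0"
  by (subst laurent_eq_sum[of "insert 0 {n. \<phi> n \<noteq> 0}"])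
    (auto simp: finseq_def power_int_0_left_if if_distrib cong: if_cong)

lemma laurent_poly_seq: "laurent (poly_seq p) (\<beta> powi s) = poly p \<beta>"
proof (cases "\<beta> = 0")
  case True
  then have "\<beta> powi s = 0" by simp
  then show ?thesis using True by (simp add: laurent_0 poly_0_coeff_0) (simp add: poly_seq_def)
next
  case False
  then show ?thesis
  proof (induction p rule: pCons_induct)
    case (pCons a p)
    then show ?case
      by (simp add: poly_seq_pCons laurent_add laurent_cscale laurent_translate finseq_translate
          finseq_cscale)
  qed simp
qed

lemma exists_poly_seq:
  assumes \<phi>: "\<phi> \<in> finseq" and supp: "\<And>n. \<phi> n \<noteq> 0 \<Longrightarrow> 0 \<le> s * n"
  obtains p where "\<phi> = poly_seq p"
proof -
  obtain L where L: "\<And>n. \<phi> n \<noteq> 0 \<Longrightarrow> \<bar>n\<bar> \<le> int L" using finseq_window[OF \<phi>] by blast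
  define p where "p = Poly (map (\<lambda>i. \<phi> (s * int i)) [0..<Suc L])"
  have "\<phi> = poly_seq p"
  proof
    fix n
    show "\<phi> n = poly_seq p n"
    proof (cases "0 \<le> s * n")
      case True
      have "\<bar>n\<bar> = s * n" using True s_cases by auto
      then have "\<phi> n = 0" if "\<not> nat (s * n) < Suc L" using L[of n] that by fastforce
      then show ?thesis using True
        by (auto simp: poly_seq_def p_def coeff_Poly_eq nth_default_def simp del: upt_Suc)
    qed (use supp[of n] in \<open>auto simp: poly_seq_def\<close>)
  qed
  then show thesis by (rule that)
qed

lemma exists_translate_poly_seq:
  assumes \<phi>: "\<phi> \<in> finseq"
  obtains k p where "translate (s * int k) \<phi> = poly_seq p"
proof -
  obtain L where L: "\<And>n. \<phi> n \<noteq> 0 \<Longrightarrow> \<bar>n\<bar> \<le> int L" using finseq_window[OF \<phi>] by blast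
  have "0 \<le> s * n" if "translate (s * int L) \<phi> n \<noteq> 0" for n
    using L[of "n - s * int L"] that s_cases by (auto simp: translate_def)
  then obtain p where "translate (s * int L) \<phi> = poly_seq p"
    using exists_poly_seq[OF finseq_translate[OF \<phi>]] by blast
  then show thesis by (rule that)
qed

subsection \<open>The spectrum of the bounded shift\<close>

definition sigma :: "complex set" where
  "sigma = op_spectrum E N (graph_on E (translate s))"

lemma not_in_sigma_iff: "\<beta> \<notin> sigma \<longleftrightarrow> invertible_op (\<lambda>x. translate s x - cscale \<beta> x)"
  unfolding sigma_def by (rule not_in_spectrum_iff) (rule translate_s_mem)

lemma zero_not_in_sigma:
  assumes "single (- s) \<in> conv_symbols"
  shows "0 \<notin> sigma"
proof -
  obtain c where c: "op_bound (translate (- s)) c" using assms by (auto simp: single_conv_symbols_iff)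
  have "inverse_op (translate (- s)) (\<lambda>x. translate s x - cscale 0 x)"
    unfolding inverse_op_def using c by auto
  then show ?thesis unfolding not_in_sigma_iff invertible_op_def by blast
qed

text \<open>If \<open>S\<^sup>s\<close> is not invertible, then only polynomials in \<open>S\<^sup>s\<close> give bounded convolutions: a
  symbol with a nonzero coefficient at a negative power of \<open>z\<^sup>s\<close> would yield a bounded \<open>S\<^sup>-\<^sup>s\<close> after
  multiplication by a power of \<open>z\<^sup>s\<close> and subtraction of a polynomial.\<close>

lemma conv_symbols_support:
  assumes 0: "0 \<in> sigma" and \<phi>: "\<phi> \<in> conv_symbols"
  shows "\<exists>p. \<phi> = poly_seq p"
proof (rule ccontr)
  assume no: "\<not> ?thesis"
  let ?P = "\<lambda>k. \<exists>p. translate (s * int k) \<phi> = poly_seq p"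
  obtain k0 where "?P k0" using exists_translate_poly_seq[OF conv_symbols_finseq[OF \<phi>]] by metis
  define k where "k = (LEAST k. ?P k)"
  have k: "?P k" unfolding k_def using \<open>?P k0\<close> by (rule LeastI)
  have least: "\<not> ?P j" if "j < k" for j using not_less_Least[of j ?P] that by (simp add: k_def)
  have "k \<noteq> 0" using k no by (cases "k = 0") auto
  then obtain j where j: "k = Suc j" by (cases k) auto
  obtain p where p: "translate (s * int k) \<phi> = poly_seq p" using k by blast
  obtain c q where cq: "p = pCons c q" by (cases p)
  have "translate (- s) (translate (s * int k) \<phi>) = translate (s * int j) \<phi>"
    by (simp add: j distrib_left)
  moreover have "translate (- s) (poly_seq p) = cscale c (single (- s)) + poly_seq q"
    by (simp add: cq poly_seq_pCons translate_add translate_cscale)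
  ultimately have eq: "translate (s * int j) \<phi> = cscale c (single (- s)) + poly_seq q"
    using p by simp
  have "c \<noteq> 0"
  proof
    assume "c = 0"
    then have "translate (s * int j) \<phi> = poly_seq q" using eq by simp
    then show False using least[of j] j by blast
  qed
  have "translate (s * int j) \<phi> \<in> conv_symbols"
    using conv_symbols_conv[OF poly_seq_conv_symbols \<phi>, of "monom 1 j"] by (simp add: poly_seq_monom)
  then have "cscale (inverse c) (translate (s * int j) \<phi> - poly_seq q) \<in> conv_symbols"
    by (intro conv_symbols_cscale conv_symbols_diff poly_seq_conv_symbols)
  then have "single (- s) \<in> conv_symbols" using eq \<open>c \<noteq> 0\<close> by simp
  then show False using zero_not_in_sigma 0 by blast
qed

text \<open>Let \<open>\<psi> = \<phi> - l\<close> vanish at \<open>\<beta>\<^sup>s\<close>.  Up to a power \<open>B\<^sup>k\<close> of \<open>B = S\<^sup>s\<close> this is divisible,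
  \<open>B\<^sup>k \<psi> = (B - \<beta>) q(B)\<close>, and also \<open>B\<^sup>k - \<beta>\<^sup>k = (B - \<beta>) p(B)\<close>; so if \<open>R\<close> inverts the convolution by
  \<open>\<psi>\<close>, then \<open>\<beta>\<^sup>-\<^sup>k (q(B) R - p(B))\<close> inverts \<open>B - \<beta>\<close>.\<close>

lemma laurent_neq_of_invertible:
  assumes \<beta>: "\<beta> \<in> sigma" and \<phi>: "\<phi> \<in> conv_symbols"
    and inv: "invertible_op (\<lambda>x. conv \<phi> x - cscale l x)"
  shows "laurent \<phi> (\<beta> powi s) \<noteq> l"
proof
  assume l: "laurent \<phi> (\<beta> powi s) = l"
  define \<psi> where "\<psi> = \<phi> - cscale l (single 0)"
  have \<phi>F: "\<phi> \<in> finseq" using \<phi> by (rule conv_symbols_finseq)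
  have \<psi>F: "\<psi> \<in> finseq" unfolding \<psi>_def using \<phi>F by (intro finseq_diff finseq_cscale finseq_single)
  have \<psi>0: "laurent \<psi> (\<beta> powi s) = 0"
    using l \<phi>F by (simp add: \<psi>_def laurent_diff laurent_cscale finseq_cscale)
  (* For \<beta> = 0 the exponent must be k = 0, which is possible because the symbol is then a
     polynomial. *)
  obtain k p where p: "translate (s * int k) \<psi> = poly_seq p" "poly p \<beta> = 0" "\<beta> ^ k \<noteq> 0"
  proof (cases "\<beta> = 0")
    case True
    then obtain p0 where "\<phi> = poly_seq p0" using conv_symbols_support \<beta> \<phi> by blast
    then have "translate (s * int 0) \<psi> = poly_seq (p0 - [:l:])"
      by (simp add: \<psi>_def poly_seq_diff poly_seq_pCons)
    moreover from this have "poly (p0 - [:l:]) \<beta> = 0"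
      using \<psi>0 laurent_poly_seq[of "p0 - [:l:]" \<beta>] by simp
    ultimately show thesis using that[of 0] by simp
  next
    case False
    obtain k p where p: "translate (s * int k) \<psi> = poly_seq p"
      using exists_translate_poly_seq[OF \<psi>F] by blast
    have "poly p \<beta> = laurent (translate (s * int k) \<psi>) (\<beta> powi s)" by (simp add: p laurent_poly_seq)
    also have "\<dots> = 0" using \<psi>0 False by (simp add: laurent_translate[OF \<psi>F])
    finally show thesis using that p False by simp
  qed
  obtain q where q: "p = [:- \<beta>, 1:] * q" using p(2) by (auto simp: poly_eq_0_iff_dvd)
  have "poly (monom 1 k - [:\<beta> ^ k:]) \<beta> = 0" by (simp add: poly_monom)
  then have "[:- \<beta>, 1:] dvd monom 1 k - [:\<beta> ^ k:]" by (simp only: poly_eq_0_iff_dvd)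
  then obtain p' where p': "monom 1 k - [:\<beta> ^ k:] = [:- \<beta>, 1:] * p'" by (rule dvdE)
  define D where "D = conv (poly_seq [:- \<beta>, 1:])"
  have D_eq: "D x = translate s x - cscale \<beta> x" for x
    by (simp add: D_def conv_poly_seq_linear)
  obtain R d where R: "op_bound R d" "\<And>x. x \<in> E \<Longrightarrow> R (conv \<psi> x) = x" "\<And>x. x \<in> E \<Longrightarrow> conv \<psi> (R x) = x"
    using inv unfolding invertible_op_def inverse_op_def \<psi>_def conv_minus_scalar[OF \<phi>F] by blast
  define Y where "Y y = cscale (inverse (\<beta> ^ k)) (conv (poly_seq q) (R y) - conv (poly_seq p') y)" for y
  obtain dq dp where dq: "op_bound (conv (poly_seq q)) dq" and dp: "op_bound (conv (poly_seq p')) dp"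
    using poly_seq_conv_symbols[of q] poly_seq_conv_symbols[of p'] unfolding conv_symbols_def by blast
  have Y: "\<exists>c. op_bound Y c"
    unfolding Y_def using op_bound_cmult[OF op_bound_minus[OF op_bound_comp[OF dq R(1)] dp]] by blast
  then have YE: "Y y \<in> E" if "y \<in> E" for y using op_bound_mem that by blast
  have DY: "D (Y y) = y" if y: "y \<in> E" for y
  proof -
    have "D (conv (poly_seq q) (R y)) = conv (translate (s * int k) \<psi>) (R y)"
      by (simp add: D_def p(1) q flip: conv_poly_seq_mult)
    also have "\<dots> = translate (s * int k) y" using \<psi>F R(3)[OF y] by (simp add: conv_translate_left)
    finally have 1: "D (conv (poly_seq q) (R y)) = translate (s * int k) y" .
    have "D (conv (poly_seq p') y) = conv (poly_seq (monom 1 k - [:\<beta> ^ k:])) y"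
      by (simp add: D_def p' flip: conv_poly_seq_mult)
    also have "\<dots> = translate (s * int k) y - cscale (\<beta> ^ k) y"
      by (simp add: poly_seq_diff poly_seq_monom poly_seq_pCons conv_minus_scalar)
    finally have 2: "D (conv (poly_seq p') y) = translate (s * int k) y - cscale (\<beta> ^ k) y" .
    have "D (Y y) = cscale (inverse (\<beta> ^ k)) (D (conv (poly_seq q) (R y)) - D (conv (poly_seq p') y))"
      unfolding Y_def D_def conv_cscale_right conv_diff_right ..
    then show ?thesis unfolding 1 2 using p(3) by simp
  qed
  have inj: "x = 0" if x: "x \<in> E" "D x = 0" for x
  proof -
    have "translate (s * int k) (conv \<psi> x) = conv (poly_seq (q * [:- \<beta>, 1:])) x"
      using \<psi>F by (simp add: p(1) q mult.commute flip: conv_translate_left)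
    also have "\<dots> = 0" using x(2) by (simp only: conv_poly_seq_mult D_def[symmetric] conv_zero_right)
    finally have "conv \<psi> x = 0" by (metis translate_inject translate_zero)
    then show ?thesis using R(2)[OF x(1)] op_bound_zero[OF R(1)] by simp
  qed
  have YD: "Y (D x) = x" if x: "x \<in> E" for x
  proof -
    have Dx: "D x \<in> E" unfolding D_eq by (intro diff_mem translate_s_mem cscale_mem x)
    have "D (Y (D x) - x) = 0"
      using DY[OF Dx] by (simp add: D_def conv_diff_right)
    then have "Y (D x) - x = 0" by (rule inj[OF diff_mem[OF YE[OF Dx] x]])
    then show ?thesis by simp
  qed
  have "inverse_op Y D"
    unfolding inverse_op_def by (intro conjI ballI Y YD DY)
  moreover have "D = (\<lambda>x. translate s x - cscale \<beta> x)" by (rule ext) (rule D_eq)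
  ultimately have "\<beta> \<notin> sigma" unfolding not_in_sigma_iff invertible_op_def by blast
  then show False using \<beta> by contradiction
qed

text \<open>A number of modulus larger than the norm is not in the spectrum of an operator, so it is not a value of
  the symbol.\<close>

lemma laurent_le_of_sigma:
  assumes "\<beta> \<in> sigma" "\<phi> \<in> finseq" "op_bound (conv \<phi>) c"
  shows "cmod (laurent \<phi> (\<beta> powi s)) \<le> c"
proof (rule ccontr)
  assume "\<not> ?thesis"
  then have "invertible_op (\<lambda>x. conv \<phi> x - cscale (laurent \<phi> (\<beta> powi s)) x)"
    using assms by (intro invertible_op_diff_scalar) auto
  then show False
    using laurent_neq_of_invertible[OF assms(1)] assms(2,3) by (auto simp: conv_symbols_def)
qed

end


section \<open>The spectrum of the shift\<close>

lemma translate_uminus [simp]: "translate t (- x) = - translate t x"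
  by (auto simp: translate_def cseq_apply)

context banach_seq_space
begin

lemma invertible_op_cscale: "c \<noteq> 0 \<Longrightarrow> invertible_op (cscale c)"
proof -
  assume "c \<noteq> 0"
  then have "inverse_op (cscale (inverse c)) (cscale c)"
    using op_bound_cmult[OF op_bound_id, of "inverse c"] by (auto simp: inverse_op_def)
  then show ?thesis unfolding invertible_op_def by blast
qed

lemma continuous_map_op_bound:
  assumes T: "op_bound T c"
  shows "continuous_map mtopology mtopology T"
  unfolding metric_continuous_map[OF Metric_space_axioms]
proof (intro conjI ballI allI impI)
  show "T ` E \<subseteq> E" using op_bound_mem[OF T] by blast
  fix a and e :: real assume a: "a \<in> E" and "e > 0"
  define d where "d = e / (c + 1)"
  have "d > 0" using \<open>e > 0\<close> op_bound_nonneg[OF T] by (simp add: d_def)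
  have "seq_dist E N (T a) (T x) < e" if x: "x \<in> E" "seq_dist E N a x < d" for x
  proof -
    have less: "N (a - x) < d" using x a by (simp add: seq_dist_def)
    have "N (T a - T x) \<le> c * N (a - x)"
      using op_bound_le[OF T diff_mem[OF a x(1)]] op_bound_diff[OF T a x(1)] by simp
    also have "\<dots> \<le> c * d" using less op_bound_nonneg[OF T] by (intro mult_left_mono) auto
    also have "\<dots> < (c + 1) * d" using \<open>d > 0\<close> by simp
    also have "\<dots> = e" using op_bound_nonneg[OF T] by (simp add: d_def)
    finally show ?thesis using op_bound_mem[OF T] a x by (simp add: seq_dist_def)
  qed
  then show "\<exists>d>0. \<forall>x. x \<in> E \<and> seq_dist E N a x < d \<longrightarrow> seq_dist E N (T a) (T x) < e"
    using \<open>d > 0\<close> by blast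
qed

lemma limitin_of_norm_tendsto:
  assumes x: "\<And>k. x k \<in> E" "y \<in> E" "(\<lambda>k. N (x k - y)) \<longlonglongrightarrow> 0"
  shows "limitin mtopology x y sequentially"
  unfolding limit_metric_sequentially
proof (intro conjI allI impI)
  fix e :: real assume "e > 0"
  then have "\<forall>\<^sub>F k in sequentially. N (x k - y) < e"
    using x(3) by (intro order_tendstoD) auto
  then show "\<exists>K. \<forall>n\<ge>K. x n \<in> E \<and> seq_dist E N (x n) y < e"
    using x(1,2) by (simp add: eventually_sequentially seq_dist_def)
qed (rule x)

end

context bounded_shift_space
begin

lemma invertible_op_modulate:
  assumes "cmod z = 1"
  shows "invertible_op (modulate z)"
proof -
  have "z \<noteq> 0" using assms by auto
  then have "modulate (inverse z) (modulate z x) = x" "modulate z (modulate (inverse z) x) = x" for x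
    by (auto simp: modulate_def power_int_inverse)
  moreover have "\<exists>c. op_bound (modulate (inverse z)) c"
    using op_bound_modulate[of "inverse z"] assms by (auto simp: norm_inverse)
  ultimately show ?thesis unfolding invertible_op_def inverse_op_def by blast
qed

text \<open>Conjugation by a modulation multiplies the shift by a number of modulus \<open>1\<close>.\<close>

lemma sigma_rotate:
  assumes "\<beta> \<in> sigma" and z: "cmod z = 1"
  shows "z * \<beta> \<in> sigma"
proof (rule ccontr)
  assume "z * \<beta> \<notin> sigma"
  then have inv: "invertible_op (\<lambda>x. translate s x - cscale (z * \<beta>) x)"
    by (simp add: not_in_sigma_iff)
  define u where "u = z powi (- s)"
  have z0: "z \<noteq> 0" and u0: "u \<noteq> 0" and u1: "cmod u = 1" "cmod (inverse u) = 1"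
    using z by (auto simp: u_def norm_power_int norm_inverse)
  have uz: "u powi (- s) = z"
    using s_cases by (auto simp: u_def power_int_minus)
  have eq: "translate s x - cscale \<beta> x
      = cscale (inverse z) (modulate (inverse u)
          (translate s (modulate u x) - cscale (z * \<beta>) (modulate u x)))" for x
  proof
    fix n
    have "u powi (n - s) = u powi n * z"
      using power_int_add[of u n "- s"] u0 uz by simp
    then show "(translate s x - cscale \<beta> x) n
      = cscale (inverse z) (modulate (inverse u)
          (translate s (modulate u x) - cscale (z * \<beta>) (modulate u x))) n"
      using z0 u0
      by (simp add: cseq_apply translate_def cscale_def modulate_def power_int_inverse field_simps)
  qed
  have m1: "modulate u x \<in> E" if "x \<in> E" for x using modulate_mem u1 that by blast
  have m2: "translate s (modulate u x) - cscale (z * \<beta>) (modulate u x) \<in> E" if "x \<in> E" for x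
    by (intro diff_mem translate_s_mem cscale_mem m1 that)
  have 1: "invertible_op (\<lambda>x. translate s (modulate u x) - cscale (z * \<beta>) (modulate u x))"
    by (rule invertible_op_comp[OF inv invertible_op_modulate[OF u1(1)] m1])
  have 2: "invertible_op (\<lambda>x. modulate (inverse u)
      (translate s (modulate u x) - cscale (z * \<beta>) (modulate u x)))"
    by (rule invertible_op_comp[OF invertible_op_modulate[OF u1(2)] 1 m2])
  have "invertible_op (\<lambda>x. translate s x - cscale \<beta> x)"
    unfolding eq
    by (rule invertible_op_comp[OF invertible_op_cscale 2]) (use z0 modulate_mem u1 m2 in auto)
  then show False using assms(1) by (simp add: not_in_sigma_iff[symmetric])
qed

lemma closed_sigma: "closed sigma"
proof -
  obtain c where B: "op_bound (translate s) c" using translate_s_bounded by blast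
  have "open (- sigma)"
    unfolding open_dist
  proof
    fix \<beta> assume "\<beta> \<in> - sigma"
    then have inv: "invertible_op (\<lambda>x. translate s x - cscale \<beta> x)" by (simp add: not_in_sigma_iff)
    then obtain R d where R: "op_bound R d"
        "\<And>x. x \<in> E \<Longrightarrow> translate s (R x) - cscale \<beta> (R x) = x"
      unfolding invertible_op_def inverse_op_def by blast
    have d0: "0 \<le> d" by (rule op_bound_nonneg[OF R(1)])
    define e where "e = 1 / (d + 1)"
    have "e > 0" using d0 by (simp add: e_def)
    have "\<gamma> \<in> - sigma" if \<gamma>: "dist \<gamma> \<beta> < e" for \<gamma>
    proof -
      define U where "U x = cscale (\<gamma> - \<beta>) (R x)" for x
      have U: "op_bound U (cmod (\<gamma> - \<beta>) * d)"
        unfolding U_def by (rule op_bound_cmult[OF R(1)])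
      have "cmod (\<gamma> - \<beta>) * d \<le> e * d"
        using \<gamma> d0 by (intro mult_right_mono) (auto simp: dist_norm)
      also have "\<dots> < 1" using d0 by (simp add: e_def)
      finally have "invertible_op (\<lambda>x. x - U x)" by (intro invertible_op_id_minus[OF U]) simp
      then have *: "invertible_op (\<lambda>x. translate s (x - U x) - cscale \<beta> (x - U x))"
        by (rule invertible_op_comp[OF inv]) (intro diff_mem op_bound_mem[OF U])
      have "invertible_op (\<lambda>x. translate s x - cscale \<gamma> x)"
      proof (rule invertible_op_cong[OF *])
        fix x assume x: "x \<in> E"
        have "translate s (x - U x) - cscale \<beta> (x - U x)
            = (translate s x - cscale \<beta> x) - cscale (\<gamma> - \<beta>) (translate s (R x) - cscale \<beta> (R x))"
          by (auto simp: U_def translate_def cscale_def cseq_apply algebra_simps)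
        also have "\<dots> = translate s x - cscale \<gamma> x"
          unfolding R(2)[OF x] by (auto simp: cscale_def cseq_apply algebra_simps)
        finally show "translate s x - cscale \<gamma> x = translate s (x - U x) - cscale \<beta> (x - U x)" ..
      qed
      then show ?thesis by (simp add: not_in_sigma_iff[symmetric])
    qed
    then show "\<exists>e>0. \<forall>y. dist y \<beta> < e \<longrightarrow> y \<in> - sigma" using \<open>e > 0\<close> by blast
  qed
  then show ?thesis by (simp add: closed_def)
qed

text \<open>If only \<open>U = S\<^sup>-\<^sup>1\<close> is bounded, the smallest closed extension of \<open>S\<close> is the inverse of \<open>U\<close>: its
  graph is closed because \<open>U\<close> is continuous, and the finite sequences are dense.\<close>

lemma smallest_closed_extension_shift:
  assumes "s = -1"
  shows "smallest_closed_extension E N (graph_on finseq shift) = (\<lambda>y. (translate s y, y)) ` E"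
proof
  obtain c where U: "op_bound (translate s) c" using translate_s_bounded by blast
  let ?G = "(\<lambda>y. (translate s y, y)) ` E"
  let ?T = "prod_topology mtopology mtopology"
  have shift_U: "shift (translate s x) = x" "translate s (shift x) = x" for x
    using assms by (auto simp: shift_eq_translate)
  have "closedin ?T {p \<in> topspace ?T. fst p = translate s (snd p)}"
    using continuous_map_compose[OF continuous_map_snd continuous_map_op_bound[OF U]]
    by (intro closedin_continuous_maps_eq[OF Hausdorff_space_mtopology] continuous_map_fst) (simp add: o_def)
  also have "{p \<in> topspace ?T. fst p = translate s (snd p)} = ?G"
    using translate_s_mem by (auto simp: image_iff)
  finally have "closedin ?T ?G" .
  moreover have "linear_relation ?G"
    unfolding linear_relation_def
  proof (intro conjI allI impI)
    show "(0, 0) \<in> ?G" by (auto simp: image_iff intro!: bexI[of _ 0])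
    show "(x + x', y + y') \<in> ?G" if "(x, y) \<in> ?G" "(x', y') \<in> ?G" for x y x' y'
      using that add_mem[of y y'] by (auto simp: image_iff translate_add)
    show "(cscale a x, cscale a y) \<in> ?G" if "(x, y) \<in> ?G" for a x y
      using that cscale_mem[of y a] by (auto simp: image_iff translate_cscale)
  qed
  moreover have "single_valued ?G"
    by (auto simp: single_valued_def translate_inject)
  ultimately have "closed_operator E N ?G" by (simp add: closed_operator_def seq_topology_def)
  moreover have "graph_on finseq shift \<subseteq> ?G"
  proof -
    have "(x, shift x) \<in> ?G" if "x \<in> finseq" for x
      using shift_U finseq_mem[OF finseq_translate[OF that, of 1]]
      by (auto simp: image_iff shift_eq_translate)
    then show ?thesis by (auto simp: graph_on_def)
  qed
  ultimately show "smallest_closed_extension E N (graph_on finseq shift) \<subseteq> ?G"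
    unfolding smallest_closed_extension_def by (intro hull_minimal)
  show "?G \<subseteq> smallest_closed_extension E N (graph_on finseq shift)"
    unfolding smallest_closed_extension_def hull_def
  proof (rule Inter_greatest)
    fix H assume "H \<in> {H. closed_operator E N H \<and> graph_on finseq shift \<subseteq> H}"
    then have H: "closedin ?T H" "graph_on finseq shift \<subseteq> H"
      by (auto simp: closed_operator_def seq_topology_def)
    show "?G \<subseteq> H"
    proof
      fix p assume "p \<in> ?G"
      then obtain y where y: "y \<in> E" "p = (translate s y, y)" by blast
      obtain a where a: "\<And>k. a k \<in> finseq" "(\<lambda>k. N (a k - y)) \<longlonglongrightarrow> 0"
        using finseq_sequence[OF y(1)] by blast
      have aE: "a k \<in> E" for k by (rule finseq_mem[OF a(1)])
      show "p \<in> H"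
      proof (rule limitin_closedin[OF _ H(1), of "\<lambda>k. (translate s (a k), a k)" p sequentially])
        show "limitin ?T (\<lambda>k. (translate s (a k), a k)) p sequentially"
          unfolding limitin_pairwise y(2)
          using limitin_of_norm_tendsto[OF aE y(1) a(2)]
            limitin_of_norm_tendsto[OF op_bound_mem[OF U aE] op_bound_mem[OF U y(1)]
              op_bound_tendsto[OF U aE y(1) a(2)]]
          by (simp add: o_def)
        have "(translate s (a k), shift (translate s (a k))) \<in> graph_on finseq shift" for k
          unfolding graph_on_def by (intro imageI finseq_translate a)
        then have "(translate s (a k), a k) \<in> H" for k
          using H(2) unfolding shift_U by blast
        then show "\<forall>\<^sub>F k in sequentially. (translate s (a k), a k) \<in> H" by simp
      qed simp
    qed
  qed
qed

text \<open>The resolvents \<open>R\<close> of \<open>U\<^sup>-\<^sup>1\<close> at \<open>\<alpha>\<close> and \<open>W\<close> of \<open>U\<close> at \<open>\<alpha>\<^sup>-\<^sup>1\<close> determine each other by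
  \<open>W = -\<alpha> (1 + \<alpha> R)\<close> and \<open>R = -\<alpha>\<^sup>-\<^sup>1 U W\<close>.\<close>

lemma not_in_inverse_spectrum_iff:
  assumes "\<alpha> \<noteq> 0"
  shows "\<alpha> \<notin> op_spectrum E N ((\<lambda>y. (translate s y, y)) ` E) \<longleftrightarrow> inverse \<alpha> \<notin> sigma"
proof -
  let ?U = "translate s"
  obtain c where U: "op_bound ?U c" using translate_s_bounded by blast
  have lhs: "\<alpha> \<notin> op_spectrum E N ((\<lambda>y. (?U y, y)) ` E) \<longleftrightarrow>
      (\<exists>R. (\<exists>d. op_bound R d) \<and> (\<forall>y\<in>E. R (y - cscale \<alpha> (?U y)) = ?U y) \<and>
        (\<forall>y\<in>E. R y = ?U (y + cscale \<alpha> (R y))))"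
  proof -
    have "(R y, y + cscale \<alpha> (R y)) \<in> (\<lambda>y. (?U y, y)) ` E \<longleftrightarrow> R y = ?U (y + cscale \<alpha> (R y))"
      if "op_bound R d" "y \<in> E" for R d y
      using op_bound_mem[OF that] that(2) by (auto simp: add_mem cscale_mem)
    then show ?thesis
      unfolding op_spectrum_def bounded_operator_iff by (simp add: image_iff) blast
  qed
  show ?thesis
    unfolding lhs not_in_sigma_iff
  proof
    assume "\<exists>R. (\<exists>d. op_bound R d) \<and> (\<forall>y\<in>E. R (y - cscale \<alpha> (?U y)) = ?U y) \<and>
        (\<forall>y\<in>E. R y = ?U (y + cscale \<alpha> (R y)))"
    then obtain R d where R: "op_bound R d" "\<And>y. y \<in> E \<Longrightarrow> R (y - cscale \<alpha> (?U y)) = ?U y"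
        "\<And>y. y \<in> E \<Longrightarrow> R y = ?U (y + cscale \<alpha> (R y))" by blast
    define W where "W y = cscale (- \<alpha>) (y + cscale \<alpha> (R y))" for y
    have "\<exists>d. op_bound W d"
      unfolding W_def using op_bound_cmult[OF op_bound_plus[OF op_bound_id op_bound_cmult[OF R(1)]]] by blast
    moreover have "?U (W y) - cscale (inverse \<alpha>) (W y) = y" if y: "y \<in> E" for y
    proof -
      have "?U (W y) = cscale (- \<alpha>) (R y)"
        using R(3)[OF y] by (simp add: W_def translate_cscale)
      moreover have "cscale (inverse \<alpha>) (W y) = - (y + cscale \<alpha> (R y))"
        using assms by (simp add: W_def)
      ultimately show ?thesis by simp
    qed
    moreover have "W (?U y - cscale (inverse \<alpha>) y) = y" if y: "y \<in> E" for y
    proof -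
      let ?v = "?U y - cscale (inverse \<alpha>) y"
      have vE: "?v \<in> E" by (intro diff_mem translate_s_mem cscale_mem y)
      have "cscale \<alpha> (R ?v) = - R (y - cscale \<alpha> (?U y))"
      proof -
        have "cscale \<alpha> (R ?v) = R (cscale \<alpha> ?v)" using op_bound_cscale[OF R(1) vE] by simp
        also have "cscale \<alpha> ?v = cscale (-1) (y - cscale \<alpha> (?U y))"
          using assms by (auto simp: cscale_def cseq_apply algebra_simps)
        also have "R \<dots> = cscale (-1) (R (y - cscale \<alpha> (?U y)))"
          by (intro op_bound_cscale[OF R(1)] diff_mem y cscale_mem translate_s_mem)
        finally show ?thesis by (simp flip: uminus_eq_cscale)
      qed
      also have "\<dots> = - ?U y" using R(2)[OF y] by simp
      finally have "W ?v = cscale (- \<alpha>) (?v - ?U y)" by (simp add: W_def)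
      then show ?thesis using assms by (auto simp: cscale_def cseq_apply)
    qed
    ultimately show "invertible_op (\<lambda>x. ?U x - cscale (inverse \<alpha>) x)"
      unfolding invertible_op_def inverse_op_def by blast
  next
    assume "invertible_op (\<lambda>x. ?U x - cscale (inverse \<alpha>) x)"
    then obtain W d where W: "op_bound W d" "\<And>y. y \<in> E \<Longrightarrow> W (?U y - cscale (inverse \<alpha>) y) = y"
        "\<And>y. y \<in> E \<Longrightarrow> ?U (W y) - cscale (inverse \<alpha>) (W y) = y"
      unfolding invertible_op_def inverse_op_def by blast
    define R where "R y = cscale (- inverse \<alpha>) (?U (W y))" for y
    have "\<exists>d. op_bound R d"
      unfolding R_def using op_bound_cmult[OF op_bound_comp[OF U W(1)]] by blast
    moreover have "R (y - cscale \<alpha> (?U y)) = ?U y" if y: "y \<in> E" for y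
    proof -
      have vE: "?U y - cscale (inverse \<alpha>) y \<in> E" by (intro diff_mem translate_s_mem cscale_mem y)
      have "y - cscale \<alpha> (?U y) = cscale (- \<alpha>) (?U y - cscale (inverse \<alpha>) y)"
        using assms by (auto simp: cscale_def cseq_apply algebra_simps)
      then have "W (y - cscale \<alpha> (?U y)) = cscale (- \<alpha>) y"
        by (simp only: op_bound_cscale[OF W(1) vE] W(2)[OF y])
      then show ?thesis using assms by (simp add: R_def translate_cscale)
    qed
    moreover have "R y = ?U (y + cscale \<alpha> (R y))" if y: "y \<in> E" for y
    proof -
      have "y + cscale \<alpha> (R y) = y - ?U (W y)"
        using assms by (auto simp: R_def cscale_def cseq_apply)
      also have "\<dots> = cscale (- inverse \<alpha>) (W y)"
        using W(3)[OF y, symmetric] by (metis add_diff_cancel_left' cseq.scale_minus_left diff_add_cancel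
            diff_minus_eq_add minus_diff_eq)
      finally show ?thesis by (simp add: R_def translate_cscale)
    qed
    ultimately show "\<exists>R. (\<exists>d. op_bound R d) \<and> (\<forall>y\<in>E. R (y - cscale \<alpha> (?U y)) = ?U y) \<and>
        (\<forall>y\<in>E. R y = ?U (y + cscale \<alpha> (R y)))" by blast
  qed
qed

lemma shift_spectrum_iff: "\<alpha> \<in> shift_spectrum E N \<longleftrightarrow> (s = 1 \<or> \<alpha> \<noteq> 0) \<and> \<alpha> powi s \<in> sigma"
proof (cases "s = 1")
  case True
  then show ?thesis
    unfolding shift_spectrum_def sigma_def shift_eq_translate using translate_into by simp
next
  case False
  then have s: "s = -1" using s_cases by simp
  have spec: "shift_spectrum E N = op_spectrum E N ((\<lambda>y. (translate s y, y)) ` E)"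
    using shift_not_into[OF s] smallest_closed_extension_shift[OF s]
    by (simp add: shift_spectrum_def shift_eq_translate)
  show ?thesis
  proof (cases "\<alpha> = 0")
    case True
    have "\<exists>R. bounded_operator E N R \<and>
        (\<forall>(x, y)\<in>(\<lambda>y. (translate s y, y)) ` E. R (y - cscale 0 x) = x) \<and>
        (\<forall>y\<in>E. (R y, y + cscale 0 (R y)) \<in> (\<lambda>y. (translate s y, y)) ` E)"
      using translate_s_bounded by (intro exI[of _ "translate s"]) (auto simp: bounded_operator_iff)
    then show ?thesis using True s by (simp add: spec op_spectrum_def)
  next
    case False
    then show ?thesis
      using not_in_inverse_spectrum_iff[OF False] s by (auto simp: spec power_int_minus)
  qed
qed

lemma laurent_le_of_shift_spectrum:
  assumes "\<alpha> \<in> shift_spectrum E N" "\<phi> \<in> finseq" "op_bound (conv \<phi>) c"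
  shows "cmod (laurent \<phi> \<alpha>) \<le> c"
  using laurent_le_of_sigma[of "\<alpha> powi s" \<phi> c] assms by (simp add: shift_spectrum_iff)

lemma shift_spectrum_rotate:
  assumes "\<alpha> \<in> shift_spectrum E N" "cmod z = 1"
  shows "z * \<alpha> \<in> shift_spectrum E N"
proof -
  have "cmod (z powi s) = 1" using assms(2) by (simp add: norm_power_int)
  then show ?thesis
    using assms sigma_rotate[of "\<alpha> powi s" "z powi s"]
    by (auto simp: shift_spectrum_iff power_int_mult_distrib)
qed

lemma sphere_subset_shift_spectrum:
  assumes "\<alpha> \<in> shift_spectrum E N"
  shows "sphere 0 (cmod \<alpha>) \<subseteq> shift_spectrum E N"
proof
  fix \<gamma> :: complex assume "\<gamma> \<in> sphere 0 (cmod \<alpha>)"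
  then have \<gamma>: "cmod \<gamma> = cmod \<alpha>" by simp
  show "\<gamma> \<in> shift_spectrum E N"
  proof (cases "\<alpha> = 0")
    case False
    have "cmod (\<gamma> / \<alpha>) = 1" using \<gamma> False by (simp add: norm_divide)
    from shift_spectrum_rotate[OF assms this] show ?thesis using False by simp
  qed (use \<gamma> assms in simp)
qed

text \<open>For \<open>s = -1\<close> the spectrum is the inverse of a closed set, and it stays away from \<open>0\<close> because
  \<open>|\<alpha>|\<^sup>-\<^sup>1\<close> is at most the norm of \<open>S\<^sup>-\<^sup>1\<close>.\<close>

lemma closed_shift_spectrum: "closed (shift_spectrum E N)"
proof (cases "s = 1")
  case True
  then have "shift_spectrum E N = sigma" by (auto simp: shift_spectrum_iff)
  then show ?thesis using closed_sigma by simp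
next
  case False
  then have s: "s = -1" using s_cases by simp
  obtain c where c: "op_bound (translate s) c" using translate_s_bounded by blast
  have cs: "op_bound (conv (single s)) c" using op_bound_cong[OF c, of "conv (single s)"] by simp
  show ?thesis
    unfolding closed_sequential_limits
  proof (intro allI impI, elim conjE)
    fix x l assume x: "\<forall>n. x n \<in> shift_spectrum E N" and lim: "x \<longlonglongrightarrow> l"
    have le: "1 \<le> c * cmod (x n)" for n
    proof -
      have "cmod (laurent (single s) (x n)) \<le> c"
        by (rule laurent_le_of_shift_spectrum[OF _ finseq_single cs]) (use x in blast)
      moreover have "x n \<noteq> 0" using x s by (auto simp: shift_spectrum_iff)
      ultimately show ?thesis using s by (simp add: power_int_minus norm_inverse norm_divide field_simps)
    qed
    have "1 \<le> c * cmod l"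
      by (rule LIMSEQ_le_const[OF tendsto_mult[OF tendsto_const tendsto_norm[OF lim]]]) (use le in auto)
    then have "l \<noteq> 0" by auto
    have conv: "(\<lambda>n. x n powi s) \<longlonglongrightarrow> l powi s"
      using tendsto_inverse[OF lim \<open>l \<noteq> 0\<close>] s by (simp add: power_int_minus)
    have "x n powi s \<in> sigma" for n using x by (simp add: shift_spectrum_iff)
    from closed_sequentially[OF closed_sigma this conv] have "l powi s \<in> sigma" .
    then show "l \<in> shift_spectrum E N" using \<open>l \<noteq> 0\<close> by (simp add: shift_spectrum_iff)
  qed
qed

lemma multiplier_fejer_conv:
  assumes "multiplier_bound T c"
  shows "op_bound (conv (fejer k (hat T))) (modulation_bound ^ 3 * c)"
  by (rule op_bound_conv_weight_hat[OF assms averaging_weight_fejer finite_fejer_support])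

lemma laurent_fejer_le:
  assumes "multiplier_bound T c" "\<alpha> \<in> shift_spectrum E N"
  shows "cmod (laurent (fejer k (hat T)) \<alpha>) \<le> modulation_bound ^ 3 * c"
  by (rule laurent_le_of_shift_spectrum[OF assms(2) fejer_finseq multiplier_fejer_conv[OF assms(1)]])

text \<open>The average of modulations that extracts a single coefficient turns the multiplier into a
  multiple of a power of the shift.\<close>

lemma hat_coeff_le:
  assumes T: "multiplier_bound T c" and \<alpha>: "\<alpha> \<in> shift_spectrum E N"
  shows "cmod (hat T n * \<alpha> powi n) \<le> modulation_bound ^ 3 * c"
proof -
  have eq: "weight (single n) (hat T) = cscale (hat T n) (single n)"
    by (auto simp: weight_def cscale_def single_def)
  have "op_bound (conv (weight (single n) (hat T))) (modulation_bound ^ 3 * c)"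
    by (rule op_bound_conv_weight_hat[OF T averaging_weight_single]) (simp add: single_def)
  from laurent_le_of_shift_spectrum[OF \<alpha> _ this]
  show ?thesis by (simp add: eq laurent_cscale finseq_cscale)
qed

text \<open>If \<open>0\<close> is in the spectrum of \<open>S\<close>, the Fejer means of the symbol are polynomials.  This matters for the
  circle of radius \<open>0\<close>, where negative powers take the default value \<open>0\<close>.\<close>

lemma hat_nonneg_support:
  assumes T: "multiplier_bound T c" and 0: "0 \<in> shift_spectrum E N" and "hat T n \<noteq> 0"
  shows "0 \<le> n"
proof (rule ccontr)
  assume n: "\<not> 0 \<le> n"
  have s: "s = 1" and 00: "0 \<in> sigma" using 0 by (auto simp: shift_spectrum_iff)
  define k where "k = nat \<bar>n\<bar>"
  have "fejer k (hat T) \<in> conv_symbols"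
    using multiplier_fejer_conv[OF T] fejer_finseq by (auto simp: conv_symbols_def)
  then obtain p where p: "fejer k (hat T) = poly_seq p" using conv_symbols_support[OF 00] by blast
  have "fejer k (hat T) n = 0" unfolding p poly_seq_def using s n by simp
  moreover have "fejer_weight k n > 0"
  proof -
    have "\<bar>real_of_int n\<bar> < real (Suc k)" by (simp add: k_def)
    then have "0 < 1 - \<bar>real_of_int n\<bar> / real (Suc k)" by (simp add: field_simps)
    then show ?thesis using fejer_weight_lower[of n k] by linarith
  qed
  ultimately show False using assms(3) by (simp add: weight_def)
qed

end


section \<open>Values of a symbol on circles\<close>

lemma circle_integral_powi_eq_fourier_coeff:
  "(LINT z|circle_measure. f z * z powi m) = 2 * pi * fourier_coeff f (- m)"
  by (simp add: fourier_coeff_def)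

lemma circle_LinfE:
  assumes "f \<in> circle_Linf"
  obtains B where "f \<in> borel_measurable borel" "B \<ge> 0" "AE z in circle_measure. cmod (f z) \<le> B"
proof -
  obtain B where f: "f \<in> borel_measurable borel" and B: "AE z in circle_measure. cmod (f z) \<le> B"
    using assms by (auto simp: circle_Linf_def)
  have "AE z in circle_measure. cmod (f z) \<le> max B 0"
    using B by eventually_elim auto
  then show thesis by (intro that[OF f, of "max B 0"]) auto
qed

text \<open>On a set \<open>S\<close> integrate \<open>c = (c + h\<^sub>k) - h\<^sub>k\<close>; the last term contributes nothing in the limit.\<close>

lemma weakly_null_le_on_set:
  assumes h: "weakly_null h" and S [measurable]: "S \<in> sets borel"
    and pos: "emeasure circle_measure S > 0"
    and le: "\<And>k. AE z in circle_measure. z \<in> S \<longrightarrow> cmod (c + h k z) \<le> b" and "0 \<le> b"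
  shows "cmod c \<le> b"
proof -
  define m where "m = measure circle_measure S"
  have "m > 0"
    using pos by (simp add: m_def circle.emeasure_eq_measure)
  let ?i = "\<lambda>z. complex_of_real (indicator S z)"
  note hm [measurable] = weakly_null_measurable[OF h]
  have ind: "integrable circle_measure ?i"
    by (rule circle_integrable_bounded[where C = 1]) auto
  have hint: "integrable circle_measure (\<lambda>z. ?i z * h k z)" for k
  proof -
    obtain C where C: "C > 0" "\<And>k. AE z in circle_measure. cmod (h k z) \<le> C"
      using weakly_null_bounded[OF h] by metis
    show ?thesis
    proof (rule circle_integrable_bounded[where C = C])
      show "AE z in circle_measure. cmod (?i z * h k z) \<le> C"
        using C(2)[of k] by eventually_elim (use C(1) in \<open>auto simp: indicator_def\<close>)
    qed measurable
  qed
  have bound: "cmod c * m \<le> b * m + cmod (LINT z|circle_measure. ?i z * h k z)" for k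
  proof -
    have "c * of_real m = (LINT z|circle_measure. ?i z * c)"
      using ind by (simp add: m_def mult.commute)
    also have "\<dots> = (LINT z|circle_measure. (?i z * c + ?i z * h k z) - ?i z * h k z)" by simp
    also have "\<dots> = (LINT z|circle_measure. ?i z * c + ?i z * h k z) - (LINT z|circle_measure. ?i z * h k z)"
      using ind hint[of k] by (subst Bochner_Integration.integral_diff) auto
    finally have "cmod (c * of_real m) \<le> cmod (LINT z|circle_measure. ?i z * c + ?i z * h k z)
        + cmod (LINT z|circle_measure. ?i z * h k z)"
      by (simp only: norm_triangle_ineq4)
    moreover have "cmod (LINT z|circle_measure. ?i z * c + ?i z * h k z) \<le> b * m"
    proof -
      have "cmod (LINT z|circle_measure. ?i z * c + ?i z * h k z)
          \<le> (LINT z|circle_measure. cmod (?i z * c + ?i z * h k z))" by simp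
      also have "\<dots> \<le> (LINT z|circle_measure. b * indicator S z)"
      proof (rule integral_mono_AE)
        show "integrable circle_measure (\<lambda>z. cmod (?i z * c + ?i z * h k z))"
          using ind hint[of k] by auto
        show "integrable circle_measure (\<lambda>z. b * indicat_real S z)"
          by (intro integrable_mult_right circle_integrable_bounded_real[where C = 1]) auto
        show "AE z in circle_measure. cmod (?i z * c + ?i z * h k z) \<le> b * indicator S z"
          using le[of k] by eventually_elim (auto simp: indicator_def)
      qed
      finally show ?thesis by (simp add: m_def)
    qed
    ultimately show ?thesis using \<open>m > 0\<close> by (simp add: norm_mult)
  qed
  have "(\<lambda>k. b * m + cmod (LINT z|circle_measure. ?i z * h k z)) \<longlonglongrightarrow> b * m + cmod 0"
    by (intro tendsto_intros weakly_null_integral_borel[OF h S])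
  then have "cmod c * m \<le> b * m + cmod 0"
    by (rule LIMSEQ_le_const) (use bound in auto)
  then show ?thesis using \<open>m > 0\<close> by simp
qed

lemma essential_range_ball:
  assumes "w \<in> essential_range circle_measure f" "f \<in> borel_measurable borel" "e > 0"
  shows "{z. dist (f z) w < e} \<in> sets borel" "emeasure circle_measure {z. dist (f z) w < e} > 0"
  using assms by (auto simp: essential_range_def)

text \<open>Weak limits do not preserve pointwise values, but on the set where \<open>f\<close> is close to \<open>w\<close> the functions
  \<open>w + (q\<^sub>k - f)\<close> are bounded by little more than \<open>B\<close> and converge weakly to the constant \<open>w\<close>.\<close>

lemma essential_range_norm_le:
  assumes f: "f \<in> borel_measurable borel" and wn: "weakly_null (\<lambda>k z. q k z - f z)"
    and q: "\<And>k. AE z in circle_measure. cmod (q k z) \<le> B" and "0 \<le> B"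
    and w: "w \<in> essential_range circle_measure f"
  shows "cmod w \<le> B"
proof (rule field_le_epsilon)
  fix e :: real assume "e > 0"
  note S = essential_range_ball[OF w f \<open>e > 0\<close>]
  show "cmod w \<le> B + e"
  proof (rule weakly_null_le_on_set[OF wn S])
    fix k
    show "AE z in circle_measure. z \<in> {z. dist (f z) w < e} \<longrightarrow> cmod (w + (q k z - f z)) \<le> B + e"
      using q[of k]
    proof (eventually_elim, safe)
      fix z assume *: "cmod (q k z) \<le> B" "dist (f z) w < e"
      have "cmod (w + (q k z - f z)) \<le> cmod (q k z) + cmod (w - f z)"
        using norm_triangle_ineq[of "q k z" "w - f z"] by (simp add: algebra_simps)
      then show "cmod (w + (q k z - f z)) \<le> B + e"
        using * by (simp add: dist_norm norm_minus_commute)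
    qed
  qed (use \<open>e > 0\<close> \<open>0 \<le> B\<close> in auto)
qed

text \<open>Where \<open>f\<close> is close to \<open>w\<close>, the functions \<open>q\<^sub>k f\<close> are bounded by about \<open>B |w|\<close>, and their weak limit is \<open>1\<close>.\<close>

lemma essential_range_lower:
  assumes f: "f \<in> borel_measurable borel" and wn: "weakly_null (\<lambda>k z. q k z * f z - 1)"
    and q: "\<And>k. AE z in circle_measure. cmod (q k z) \<le> B" and "0 \<le> B"
    and w: "w \<in> essential_range circle_measure f"
  shows "1 \<le> B * cmod w"
proof (rule field_le_epsilon)
  fix e' :: real assume "e' > 0"
  define e where "e = e' / (B + 1)"
  have "e > 0" using \<open>e' > 0\<close> \<open>0 \<le> B\<close> by (simp add: e_def)
  note S = essential_range_ball[OF w f \<open>e > 0\<close>]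
  have "cmod 1 \<le> B * (cmod w + e)"
  proof (rule weakly_null_le_on_set[OF wn S])
    fix k
    show "AE z in circle_measure. z \<in> {z. dist (f z) w < e} \<longrightarrow> cmod (1 + (q k z * f z - 1)) \<le> B * (cmod w + e)"
      using q[of k]
    proof (eventually_elim, safe)
      fix z assume *: "cmod (q k z) \<le> B" "dist (f z) w < e"
      have "cmod (f z) \<le> cmod w + e"
        using *(2) norm_triangle_sub[of "f z" w] by (simp add: dist_norm)
      then show "cmod (1 + (q k z * f z - 1)) \<le> B * (cmod w + e)"
        using * \<open>0 \<le> B\<close> by (auto simp: norm_mult intro!: mult_mono)
    qed
  qed (use \<open>e > 0\<close> \<open>0 \<le> B\<close> in auto)
  also have "\<dots> = B * cmod w + B * e" by (simp add: distrib_left)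
  also have "B * e \<le> (B + 1) * e" using \<open>e > 0\<close> by simp
  also have "(B + 1) * e = e'" using \<open>0 \<le> B\<close> by (simp add: e_def)
  finally show "1 \<le> B * cmod w + e'" by simp
qed

text \<open>Uniqueness of Fourier coefficients, for bounded functions.\<close>

lemma weakly_null_const_AE_0:
  assumes "weakly_null (\<lambda>_. h)"
  shows "AE z in circle_measure. h z = 0"
proof -
  have h: "h \<in> borel_measurable borel" using weakly_null_measurable[OF assms] .
  have "w = 0" if w: "w \<in> essential_range circle_measure h" for w
  proof -
    have "cmod (- w) \<le> 0 + e" if "e > 0" for e
      by (rule weakly_null_le_on_set[OF assms essential_range_ball[OF w h that]])
        (use that in \<open>auto simp: dist_norm norm_minus_commute\<close>)
    then have "cmod (- w) \<le> 0" by (rule field_le_epsilon)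
    then show ?thesis by simp
  qed
  then show ?thesis using AE_essential_range[OF h] by (auto elim: eventually_mono)
qed

text \<open>Where the Laurent series converges absolutely on a circle, it is continuous there and agrees
  almost everywhere with every bounded function with the same Fourier coefficients.\<close>

lemma laurent_mem_essential_range:
  assumes sum: "(\<lambda>n. cmod (a n * of_real r powi n)) summable_on UNIV"
    and f: "f \<in> circle_Linf" and coeff: "\<And>n. fourier_coeff f n = a n * of_real r powi n"
    and z0: "cmod z0 = 1"
  shows "laurent a (of_real r * z0) \<in> essential_range circle_measure f"
proof -
  define b where "b n = a n * of_real r powi n" for n
  define g where "g z = (\<Sum>\<^sub>\<infinity>n. b n * z powi n)" for z
  have g_eq: "laurent a (of_real r * z) = g z" for z
    by (simp add: laurent_def g_def b_def power_int_mult_distrib mult.assoc)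
  have term_norm: "cmod (b n * z powi n) = cmod (b n)" if "cmod z = 1" for n z
    using that by (simp add: norm_mult norm_power_int)
  have bsum: "(\<lambda>n. cmod (b n)) summable_on UNIV" using sum by (simp add: b_def)
  define p where "p k z = (\<Sum>n\<in>{- int k..int k}. b n * z powi n)" for k z
  have p_lim: "(\<lambda>k. p k z) \<longlonglongrightarrow> g z" if z: "cmod z = 1" for z
  proof -
    have "(\<lambda>k. \<Sum>\<^sub>\<infinity>n. (if n \<in> {- int k..int k} then b n * z powi n else 0)) \<longlonglongrightarrow> g z"
      unfolding g_def
    proof (rule infsum_tendsto_dominated[OF bsum])
      show "cmod (if n \<in> {- int k..int k} then b n * z powi n else 0) \<le> cmod (b n)" for k n
        using term_norm[OF z, of n] by auto
      fix n
      have "\<forall>\<^sub>F k in sequentially. (if n \<in> {- int k..int k} then b n * z powi n else 0) = b n * z powi n"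
        unfolding eventually_sequentially by (intro exI[of _ "nat \<bar>n\<bar>"]) auto
      then show "(\<lambda>k. if n \<in> {- int k..int k} then b n * z powi n else 0) \<longlonglongrightarrow> b n * z powi n"
        by (rule tendsto_eventually)
    qed
    moreover have "(\<Sum>\<^sub>\<infinity>n. (if n \<in> {- int k..int k} then b n * z powi n else 0)) = p k z" for k
    proof -
      have "(\<Sum>\<^sub>\<infinity>n. (if n \<in> {- int k..int k} then b n * z powi n else 0))
          = infsum (\<lambda>n. b n * z powi n) {- int k..int k}"
        by (rule infsum_cong_neutral) auto
      then show ?thesis by (simp add: p_def)
    qed
    ultimately show ?thesis by simp
  qed
  define Q where "Q = (\<Sum>\<^sub>\<infinity>n. cmod (b n))"
  have p_le: "cmod (p k z) \<le> Q" if z: "cmod z = 1" for k z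
  proof -
    have "cmod (p k z) \<le> (\<Sum>n\<in>{- int k..int k}. cmod (b n))"
      unfolding p_def using norm_sum[of "\<lambda>n. b n * z powi n" "{- int k..int k}"] term_norm[OF z] by simp
    also have "\<dots> \<le> Q"
      unfolding Q_def using bsum by (intro finite_sum_le_infsum) auto
    finally show ?thesis .
  qed
  define g' where "g' z = lim (\<lambda>k. p k z)" for z
  have pm [measurable]: "p k \<in> borel_measurable borel" for k unfolding p_def by measurable
  have g'm [measurable]: "g' \<in> borel_measurable borel" unfolding g'_def by measurable
  have g': "g' z = g z" if "cmod z = 1" for z
    unfolding g'_def using p_lim[OF that] by (rule limI)
  obtain B where fm [measurable]: "f \<in> borel_measurable borel"
    and B: "B \<ge> 0" "AE z in circle_measure. cmod (f z) \<le> B" using circle_LinfE[OF f] by blast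
  have g'b: "AE z in circle_measure. cmod (g' z) \<le> Q"
    using AE_circle_norm
  proof eventually_elim
    case (elim z)
    show ?case unfolding g'[OF elim]
      by (rule LIMSEQ_le_const2[OF tendsto_norm[OF p_lim[OF elim]]]) (use p_le[OF elim] in auto)
  qed
  have "weakly_null (\<lambda>_ z. g' z - f z)"
  proof (rule weakly_nullI)
    show "AE z in circle_measure. cmod (g' z - f z) \<le> Q + B"
      using g'b B(2) by eventually_elim (rule order_trans[OF norm_triangle_ineq4], simp)
    fix m
    have int_g: "(LINT z|circle_measure. g' z * z powi m) = 2 * pi * b (- m)"
    proof -
      have "(\<lambda>k. LINT z|circle_measure. p k z * z powi m) \<longlonglongrightarrow> (LINT z|circle_measure. g' z * z powi m)"
      proof (rule integral_dominated_convergence[where w = "\<lambda>_. Q"])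
        show "AE z in circle_measure. (\<lambda>k. p k z * z powi m) \<longlonglongrightarrow> g' z * z powi m"
          using AE_circle_norm by eventually_elim (auto simp: g' intro!: tendsto_intros p_lim)
        show "AE z in circle_measure. norm (p k z * z powi m) \<le> Q" for k
          using AE_circle_norm by eventually_elim (simp add: norm_mult norm_power_int p_le)
      qed auto
      moreover have "\<forall>\<^sub>F k in sequentially. (LINT z|circle_measure. p k z * z powi m) = 2 * pi * b (- m)"
        unfolding p_def integral_circle_powi_sum[OF finite_atLeastAtMost_int] eventually_sequentially
        by (intro exI[of _ "nat \<bar>m\<bar>"]) auto
      then have "(\<lambda>k. LINT z|circle_measure. p k z * z powi m) \<longlonglongrightarrow> 2 * pi * b (- m)"
        by (rule tendsto_eventually)
      ultimately show ?thesis by (rule LIMSEQ_unique)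
    qed
    have "integrable circle_measure (\<lambda>z. g' z * z powi m)"
      by (rule circle_integrable_bounded[where C = Q])
        (use g'b AE_circle_norm in \<open>auto simp: norm_mult norm_power_int elim: eventually_elim2\<close>)
    moreover have "integrable circle_measure (\<lambda>z. f z * z powi m)"
      by (rule circle_integrable_bounded[where C = B])
        (use B AE_circle_norm in \<open>auto simp: norm_mult norm_power_int elim: eventually_elim2\<close>)
    ultimately have "(LINT z|circle_measure. (g' z - f z) * z powi m)
        = (LINT z|circle_measure. g' z * z powi m) - (LINT z|circle_measure. f z * z powi m)"
      by (simp add: left_diff_distrib)
    also have "\<dots> = 0"
      by (simp add: int_g circle_integral_powi_eq_fourier_coeff coeff b_def)
    finally show "(\<lambda>_. LINT z|circle_measure. (g' z - f z) * z powi m) \<longlonglongrightarrow> 0" by simp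
  qed measurable
  then have "AE z in circle_measure. g' z - f z = 0" by (rule weakly_null_const_AE_0)
  with AE_circle_norm have fg: "AE z in circle_measure. cmod z = 1 \<and> f z = g z"
    by eventually_elim (simp add: g')
  have cont: "continuous_on (sphere 0 1) g"
    unfolding continuous_on_sequentially
  proof (intro allI ballI impI, elim conjE)
    fix x :: "nat \<Rightarrow> complex" and z :: complex
    assume x: "\<forall>n. x n \<in> sphere 0 1" and z: "z \<in> sphere 0 1" and lim: "x \<longlonglongrightarrow> z"
    have "z \<noteq> 0" using z by auto
    show "(g \<circ> x) \<longlonglongrightarrow> g z"
      unfolding g_def o_def
    proof (rule infsum_tendsto_dominated[OF bsum])
      show "cmod (b n * x k powi n) \<le> cmod (b n)" for k n
        using term_norm[of "x k" n] x by simp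
      show "(\<lambda>k. b n * x k powi n) \<longlonglongrightarrow> b n * z powi n" for n
        using \<open>z \<noteq> 0\<close> by (intro tendsto_intros lim) auto
    qed
  qed
  have "emeasure circle_measure {z. dist (f z) (g z0) < e} > 0" if "e > 0" for e
  proof (rule ccontr)
    assume "\<not> ?thesis"
    then have "emeasure circle_measure {z. dist (f z) (g z0) < e} = 0" by (simp add: zero_less_iff_neq_zero)
    then have "AE z in circle_measure. \<not> dist (f z) (g z0) < e"
      by (intro AE_I[where N = "{z. dist (f z) (g z0) < e}"]) auto
    with fg have "AE z in circle_measure. z \<in> sphere 0 1 \<inter> g -` {y. e \<le> dist y (g z0)}"
      by eventually_elim auto
    moreover have "closed (sphere 0 1 \<inter> g -` {y. e \<le> dist y (g z0)})"
      by (rule continuous_closed_preimage[OF cont])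
        (auto intro!: closed_Collect_le continuous_intros)
    ultimately have "z0 \<in> sphere 0 1 \<inter> g -` {y. e \<le> dist y (g z0)}"
      using z0 by (intro AE_circle_closedD)
    then show False using that by simp
  qed
  then show ?thesis unfolding g_eq by (auto simp: essential_range_def)
qed

lemma summable_on_int_geometric:
  fixes \<theta> :: real
  assumes "0 \<le> \<theta>" "\<theta> < 1"
  shows "(\<lambda>n::int. B * \<theta> ^ nat \<bar>n\<bar>) summable_on UNIV"
proof -
  have nat: "(\<lambda>i::nat. B * \<theta> ^ (i + j)) summable_on UNIV" for j
    using assms by (intro summable_on_cmult_right)
      (simp add: summable_on_UNIV_nonneg_real_iff power_add summable_mult2 summable_geometric)
  have 1: "(\<lambda>n::int. B * \<theta> ^ nat \<bar>n\<bar>) summable_on (range int)"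
    using nat[of 0] by (subst summable_on_reindex) (auto simp: o_def)
  have 2: "(\<lambda>n::int. B * \<theta> ^ nat \<bar>n\<bar>) summable_on (range (\<lambda>i. - int i - 1))"
  proof (subst summable_on_reindex)
    have "nat \<bar>- int i - 1\<bar> = i + 1" for i by simp
    then show "((\<lambda>n::int. B * \<theta> ^ nat \<bar>n\<bar>) \<circ> (\<lambda>i. - int i - 1)) summable_on UNIV"
      using nat[of 1] by (simp only: o_def)
  qed (auto simp: inj_on_def)
  have "range int \<union> range (\<lambda>i. - int i - 1) = UNIV"
  proof -
    have "n \<in> range int \<union> range (\<lambda>i. - int i - 1)" for n
      by (cases n) (auto simp: image_iff)
    then show ?thesis by auto
  qed
  moreover have "range int \<inter> range (\<lambda>i. - int i - 1) = {}"
  proof -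
    have "int i \<noteq> - int j - 1" for i j by linarith
    then show ?thesis by blast
  qed
  ultimately show ?thesis
    using summable_on_Un_disjoint[OF 1 2] by simp
qed

text \<open>The integral is a Fourier coefficient of the product of a trigonometric polynomial with \<open>f\<close>, that
  is, a coefficient of the convolution.  For \<open>r = 0\<close> the powers of \<open>r\<close> multiply up only
  if there are no negative exponents.\<close>

lemma integral_symbol_product:
  assumes \<phi>: "\<phi> \<in> finseq" and f: "f \<in> circle_Linf"
    and coeff: "\<And>n. fourier_coeff f n = a n * of_real r powi n"
    and r: "r \<noteq> 0 \<or> (\<forall>n. \<phi> n \<noteq> 0 \<longrightarrow> 0 \<le> n) \<and> (\<forall>n. a n \<noteq> 0 \<longrightarrow> 0 \<le> n)"
  shows "(LINT z|circle_measure. laurent \<phi> (of_real r * z) * f z * z powi m)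
    = 2 * pi * (of_real r powi (- m) * conv \<phi> a (- m))"
proof -
  let ?A = "{j. \<phi> j \<noteq> 0}"
  have fin: "finite ?A" using \<phi> by (simp add: finseq_def)
  obtain B where fm [measurable]: "f \<in> borel_measurable borel"
    and B: "B \<ge> 0" "AE z in circle_measure. cmod (f z) \<le> B" using circle_LinfE[OF f] by blast
  have int: "integrable circle_measure (\<lambda>z. f z * z powi n)" for n
    by (rule circle_integrable_bounded[where C = B])
      (use B AE_circle_norm in \<open>auto simp: norm_mult norm_power_int elim: eventually_elim2\<close>)
  have lau: "laurent \<phi> (of_real r * z) = (\<Sum>j\<in>?A. \<phi> j * of_real r powi j * z powi j)" for z
    using laurent_eq_sum[OF fin, of \<phi>] by (simp add: power_int_mult_distrib mult.assoc)
  have "(LINT z|circle_measure. laurent \<phi> (of_real r * z) * f z * z powi m)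
      = (LINT z|circle_measure. (\<Sum>j\<in>?A. \<phi> j * of_real r powi j * (f z * z powi (j + m))))"
  proof (rule integral_cong_AE)
    show "AE z in circle_measure. laurent \<phi> (of_real r * z) * f z * z powi m
        = (\<Sum>j\<in>?A. \<phi> j * of_real r powi j * (f z * z powi (j + m)))"
      using AE_circle_norm
    proof eventually_elim
      case (elim z)
      then have "z \<noteq> 0" by auto
      then show ?case
        unfolding lau sum_distrib_right by (intro sum.cong) (auto simp: power_int_add)
    qed
  qed (unfold lau, measurable)
  also have "\<dots> = (\<Sum>j\<in>?A. \<phi> j * of_real r powi j * (LINT z|circle_measure. f z * z powi (j + m)))"
    using int by (subst Bochner_Integration.integral_sum) auto
  also have "\<dots> = (\<Sum>j\<in>?A. 2 * pi * (of_real r powi (- m) * (\<phi> j * a (- m - j))))"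
  proof (intro sum.cong refl)
    fix j assume j: "j \<in> ?A"
    have "complex_of_real r powi j * (a (- m - j) * of_real r powi (- m - j))
        = of_real r powi (- m) * a (- m - j)"
    proof (cases "a (- m - j) = 0")
      case False
      then have "complex_of_real r \<noteq> 0 \<or> 0 \<le> j \<and> 0 \<le> - m - j" using r j by auto
      then have "complex_of_real r powi j * of_real r powi (- m - j) = of_real r powi (- m)"
      proof
        assume "complex_of_real r \<noteq> 0"
        then show ?thesis using power_int_add[of "complex_of_real r" j "- m - j"] by simp
      next
        assume "0 \<le> j \<and> 0 \<le> - m - j"
        then have "nat j + nat (- m - j) = nat (- m)" "0 \<le> - m" by auto
        then show ?thesis using \<open>0 \<le> j \<and> 0 \<le> - m - j\<close>
          by (auto simp: power_int_def simp flip: power_add)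
      qed
      then show ?thesis by (simp add: mult_ac)
    qed simp
    note key = this
    have idx: "- (j + m) = - m - j" by simp
    have "\<phi> j * of_real r powi j * (LINT z|circle_measure. f z * z powi (j + m))
        = 2 * pi * (\<phi> j * (of_real r powi j * (a (- m - j) * of_real r powi (- m - j))))"
      unfolding circle_integral_powi_eq_fourier_coeff coeff idx by (simp add: mult_ac)
    then show "\<phi> j * of_real r powi j * (LINT z|circle_measure. f z * z powi (j + m))
        = 2 * pi * (of_real r powi (- m) * (\<phi> j * a (- m - j)))"
      unfolding key by (simp add: mult_ac)
  qed
  also have "\<dots> = 2 * pi * (of_real r powi (- m) * conv \<phi> a (- m))"
    by (simp add: conv_def sum_distrib_left)
  finally show ?thesis .
qed

context bounded_shift_space
begin

definition symbol_function :: "(cseq \<Rightarrow> cseq) \<Rightarrow> real \<Rightarrow> (complex \<Rightarrow> complex) \<Rightarrow> bool" where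
  "symbol_function T r f \<longleftrightarrow> f \<in> circle_Linf \<and> (\<forall>n. fourier_coeff f n = hat T n * of_real r powi n)"

lemma sphere_mem_shift_spectrum:
  assumes "of_real r \<in> shift_spectrum E N" "cmod z = 1"
  shows "of_real r * z \<in> shift_spectrum E N"
  using shift_spectrum_rotate[OF assms] by (simp add: mult.commute)

lemma circle_symbol_symbol_function:
  assumes T: "multiplier_bound T c" and r: "of_real r \<in> shift_spectrum E N"
  shows "symbol_function T r (circle_symbol (hat T) r)"
proof -
  obtain f where "f \<in> circle_Linf" "\<And>n. fourier_coeff f n = hat T n * of_real r powi n"
  proof (rule bounded_function_of_bounded_means[of fejer_weight "\<lambda>n. hat T n * of_real r powi n"
        "modulation_bound ^ 3 * c"])
    fix k and z :: complex assume z: "cmod z = 1"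
    have "laurent (fejer k (hat T)) (of_real r * z)
        = (\<Sum>n\<in>{- int k..int k}. fejer k (hat T) n * (of_real r * z) powi n)"
      by (rule laurent_eq_sum) (use fejer_weight_support[of k] in \<open>force simp: weight_def\<close>)+
    also have "\<dots> = (\<Sum>n\<in>{- int k..int k}. (fejer_weight k n * (hat T n * of_real r powi n)) * z powi n)"
      by (intro sum.cong) (auto simp: weight_def power_int_mult_distrib)
    finally show "cmod (\<Sum>n\<in>{- int k..int k}. (fejer_weight k n * (hat T n * of_real r powi n)) * z powi n)
        \<le> modulation_bound ^ 3 * c"
      using laurent_fejer_le[OF T sphere_mem_shift_spectrum[OF r z], of k] by simp
  next
    show "n \<in> {- int k..int k}" if "fejer_weight k n \<noteq> 0" for k n
      using fejer_weight_support[OF that] by auto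
  qed (auto simp: fejer_weight_nonneg fejer_weight_le_1 fejer_weight_tendsto)
  then have "\<exists>f. f \<in> circle_Linf \<and> (\<forall>n. fourier_coeff f n = hat T n * of_real r powi n)" by blast
  from someI_ex[OF this] show ?thesis by (simp add: symbol_function_def circle_symbol_def)
qed

lemma support_condition:
  assumes T: "multiplier_bound T c" and R: "multiplier_bound R d" and r: "of_real r \<in> shift_spectrum E N"
  shows "r \<noteq> 0 \<or> (\<forall>n. fejer k (hat R) n \<noteq> 0 \<longrightarrow> 0 \<le> n) \<and> (\<forall>n. hat T n \<noteq> 0 \<longrightarrow> 0 \<le> n)"
  using hat_nonneg_support[OF T] hat_nonneg_support[OF R] r by (auto simp: weight_def)

text \<open>The Fejer means of the symbol satisfy this bound on the circle and converge weakly to \<open>f\<close>.\<close>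

lemma symbol_function_le:
  assumes T: "multiplier_bound T c" and r: "of_real r \<in> shift_spectrum E N"
    and f: "symbol_function T r f" and w: "w \<in> essential_range circle_measure f"
  shows "cmod w \<le> modulation_bound ^ 3 * c"
proof -
  let ?C = "modulation_bound ^ 3 * c"
  have f': "f \<in> circle_Linf" "\<And>n. fourier_coeff f n = hat T n * of_real r powi n"
    using f by (auto simp: symbol_function_def)
  obtain B where fm [measurable]: "f \<in> borel_measurable borel"
    and B: "B \<ge> 0" "AE z in circle_measure. cmod (f z) \<le> B" using circle_LinfE[OF f'(1)] by blast
  define q where "q k z = laurent (fejer k (hat T)) (of_real r * z)" for k z
  have q_eq: "q k z = (\<Sum>n | fejer k (hat T) n \<noteq> 0. fejer k (hat T) n * of_real r powi n * z powi n)" for k z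
    unfolding q_def using fejer_finseq[of k "hat T"]
    by (subst laurent_eq_sum[of "{n. fejer k (hat T) n \<noteq> 0}"])
      (auto simp: finseq_def power_int_mult_distrib mult.assoc)
  have qm [measurable]: "q k \<in> borel_measurable borel" for k unfolding q_eq by measurable
  have C0: "0 \<le> ?C"
    using T modulation_bound_ge_1 op_bound_nonneg by (auto simp: multiplier_bound_def)
  have ql: "AE z in circle_measure. cmod (q k z) \<le> ?C" for k
    using AE_circle_norm unfolding q_def
    by eventually_elim (rule laurent_fejer_le[OF T sphere_mem_shift_spectrum[OF r]])
  have one: "(\<lambda>z. 1) \<in> circle_Linf" by (auto simp: circle_Linf_def)
  have one_coeff: "fourier_coeff (\<lambda>z. 1) n = single 0 n * of_real r powi n" for n
    using integral_circle_powi[of "- n"] by (auto simp: fourier_coeff_def single_def)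
  have q_coeff: "(LINT z|circle_measure. q k z * z powi m)
      = 2 * pi * (of_real r powi (- m) * (of_real (fejer_weight k (- m)) * hat T (- m)))" for k m
  proof -
    have "conv (fejer k (hat T)) (single 0) = fejer k (hat T)"
      using conv_commute[OF fejer_finseq finseq_single, of k "hat T" 0] by simp
    moreover have "r \<noteq> 0 \<or> (\<forall>n. fejer k (hat T) n \<noteq> 0 \<longrightarrow> 0 \<le> n) \<and> (\<forall>n. single 0 n \<noteq> 0 \<longrightarrow> 0 \<le> n)"
      using support_condition[OF T T r, of k] by (auto simp: single_def)
    ultimately show ?thesis
      using integral_symbol_product[OF fejer_finseq one one_coeff, of k "hat T" m]
      by (simp add: q_def weight_def)
  qed
  have wn: "weakly_null (\<lambda>k z. q k z - f z)"
  proof (rule weakly_nullI)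
    show "AE z in circle_measure. cmod (q k z - f z) \<le> ?C + B" for k
      using ql[of k] B(2) by eventually_elim (rule order_trans[OF norm_triangle_ineq4], simp)
    fix m
    have qi: "integrable circle_measure (\<lambda>z. q k z * z powi m)" for k
      by (rule circle_integrable_bounded[where C = ?C])
        (use ql[of k] AE_circle_norm in \<open>auto simp: norm_mult norm_power_int elim: eventually_elim2\<close>)
    have fi: "integrable circle_measure (\<lambda>z. f z * z powi m)"
      by (rule circle_integrable_bounded[where C = B])
        (use B AE_circle_norm in \<open>auto simp: norm_mult norm_power_int elim: eventually_elim2\<close>)
    have eq: "(LINT z|circle_measure. (q k z - f z) * z powi m)
        = 2 * pi * (of_real r powi (- m) * ((of_real (fejer_weight k (- m)) - 1) * hat T (- m)))" for k
    proof -
      have "(LINT z|circle_measure. (q k z - f z) * z powi m)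
          = (LINT z|circle_measure. q k z * z powi m) - (LINT z|circle_measure. f z * z powi m)"
        using qi[of k] fi by (simp add: left_diff_distrib)
      then show ?thesis
        unfolding q_coeff circle_integral_powi_eq_fourier_coeff f'(2) by (simp add: algebra_simps)
    qed
    have "(\<lambda>k. 2 * pi * (of_real r powi (- m) * ((complex_of_real (fejer_weight k (- m)) - 1) * hat T (- m))))
        \<longlonglongrightarrow> 2 * pi * (of_real r powi (- m) * ((of_real 1 - 1) * hat T (- m)))"
      by (intro tendsto_intros fejer_weight_tendsto)
    then show "(\<lambda>k. LINT z|circle_measure. (q k z - f z) * z powi m) \<longlonglongrightarrow> 0"
      unfolding eq by simp
  qed measurable
  show ?thesis by (rule essential_range_norm_le[OF fm wn ql C0 w])
qed

text \<open>Let \<open>\<rho>\<^sub>k\<close> be the Fejer means of the coefficients of \<open>R = T\<^sup>-\<^sup>1\<close>.  They are bounded on the circle, and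
  \<open>\<rho>\<^sub>k f\<close> tends weakly to \<open>1\<close>, because its coefficients are those of \<open>T \<rho>\<^sub>k \<longrightarrow> T R e\<^sub>0 = e\<^sub>0\<close>.\<close>

lemma symbol_function_lower:
  assumes T: "multiplier_bound T c" and R: "multiplier_bound R d"
    and TR: "T (R unit_seq) = unit_seq"
    and r: "of_real r \<in> shift_spectrum E N"
    and f: "symbol_function T r f" and w: "w \<in> essential_range circle_measure f"
  shows "1 \<le> modulation_bound ^ 3 * d * cmod w"
proof -
  let ?C = "modulation_bound ^ 3 * d"
  have Tb: "op_bound T c" and Rb: "op_bound R d" using T R by (auto simp: multiplier_bound_def)
  have f': "f \<in> circle_Linf" "\<And>n. fourier_coeff f n = hat T n * of_real r powi n"
    using f by (auto simp: symbol_function_def)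
  obtain B where fm [measurable]: "f \<in> borel_measurable borel"
    and B: "B \<ge> 0" "AE z in circle_measure. cmod (f z) \<le> B" using circle_LinfE[OF f'(1)] by blast
  define q where "q k z = laurent (fejer k (hat R)) (of_real r * z)" for k z
  have q_eq: "q k z = (\<Sum>n | fejer k (hat R) n \<noteq> 0. fejer k (hat R) n * of_real r powi n * z powi n)" for k z
    unfolding q_def using fejer_finseq[of k "hat R"]
    by (subst laurent_eq_sum[of "{n. fejer k (hat R) n \<noteq> 0}"])
      (auto simp: finseq_def power_int_mult_distrib mult.assoc)
  have qm [measurable]: "q k \<in> borel_measurable borel" for k unfolding q_eq by measurable
  have C0: "0 \<le> ?C" using modulation_bound_ge_1 op_bound_nonneg[OF Rb] by simp
  have ql: "AE z in circle_measure. cmod (q k z) \<le> ?C" for k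
    using AE_circle_norm unfolding q_def
    by eventually_elim (rule laurent_fejer_le[OF R sphere_mem_shift_spectrum[OF r]])
  have u: "unit_seq \<in> E" by (simp add: unit_seq_eq_single finseq_mem)
  have RE: "hat R \<in> E" unfolding hat_def by (rule op_bound_mem[OF Rb u])
  have conv_lim: "(\<lambda>k. conv (fejer k (hat R)) (hat T) n) \<longlonglongrightarrow> single 0 n" for n
  proof -
    have "(\<lambda>k. N (T (fejer k (hat R)) - T (hat R))) \<longlonglongrightarrow> 0"
      by (intro op_bound_tendsto[OF Tb] finseq_mem fejer_finseq RE fejer_tendsto)
    then have "(\<lambda>k. T (fejer k (hat R)) n) \<longlonglongrightarrow> T (hat R) n"
      by (intro coord_tendsto op_bound_mem[OF Tb] finseq_mem fejer_finseq RE)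
    then show ?thesis
      using TR by (simp add: multiplier_eq_conv[OF T fejer_finseq] hat_def unit_seq_eq_single)
  qed
  have wn: "weakly_null (\<lambda>k z. q k z * f z - 1)"
  proof (rule weakly_nullI)
    have qf: "AE z in circle_measure. cmod (q k z * f z) \<le> ?C * B" for k
      using ql[of k] B(2) by eventually_elim (use C0 B(1) in \<open>auto simp: norm_mult intro!: mult_mono\<close>)
    show "AE z in circle_measure. cmod (q k z * f z - 1) \<le> ?C * B + 1" for k
      using qf[of k] by eventually_elim (rule order_trans[OF norm_triangle_ineq4], simp)
    fix m
    have qi: "integrable circle_measure (\<lambda>z. q k z * f z * z powi m)" for k
      by (rule circle_integrable_bounded[where C = "?C * B"])
        (use qf[of k] AE_circle_norm in \<open>auto simp: norm_mult norm_power_int elim: eventually_elim2\<close>)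
    have oi: "integrable circle_measure (\<lambda>z. z powi m)"
      by (rule circle_integrable_bounded[where C = 1])
        (use AE_circle_norm in \<open>auto simp: norm_power_int elim: eventually_mono\<close>)
    have one: "(LINT z|circle_measure. z powi m) = 2 * pi * (of_real r powi (- m) * single 0 (- m))"
      by (simp add: integral_circle_powi single_def)
    have eq: "(LINT z|circle_measure. (q k z * f z - 1) * z powi m)
        = 2 * pi * (of_real r powi (- m) * (conv (fejer k (hat R)) (hat T) (- m) - single 0 (- m)))" for k
    proof -
      have "(LINT z|circle_measure. (q k z * f z - 1) * z powi m)
          = (LINT z|circle_measure. q k z * f z * z powi m) - (LINT z|circle_measure. z powi m)"
        using qi[of k] oi by (simp add: left_diff_distrib)
      then show ?thesis
        unfolding one q_def
          integral_symbol_product[OF fejer_finseq f' support_condition[OF T R r]]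
        by (simp add: right_diff_distrib)
    qed
    have "(\<lambda>k. 2 * pi * (of_real r powi (- m) * (conv (fejer k (hat R)) (hat T) (- m) - single 0 (- m))))
        \<longlonglongrightarrow> 2 * pi * (of_real r powi (- m) * (single 0 (- m) - single 0 (- m)))"
      by (intro tendsto_intros conv_lim)
    then show "(\<lambda>k. LINT z|circle_measure. (q k z * f z - 1) * z powi m) \<longlonglongrightarrow> 0"
      unfolding eq by simp
  qed measurable
  show ?thesis by (rule essential_range_lower[OF fm wn ql C0 w])
qed

end


section \<open>The range of the symbol lies in the spectrum\<close>

context bounded_shift_space
begin

text \<open>If \<open>\<alpha> \<noteq> 0\<close>, slightly larger and slightly smaller circles still lie in the spectrum, and the terms of the
  series are bounded on each of them; so they decay geometrically on the circle through \<open>\<alpha>\<close>.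
  If \<open>\<alpha> = 0\<close>, only the constant term is left.\<close>

lemma hat_summable_interior:
  assumes T: "multiplier_bound T c" and \<alpha>: "\<alpha> \<in> interior (shift_spectrum E N)"
  shows "(\<lambda>n. cmod (hat T n * of_real (cmod \<alpha>) powi n)) summable_on UNIV"
proof (cases "\<alpha> = 0")
  case True
  have "cmod (hat T n * of_real (cmod \<alpha>) powi n) \<le> cmod (hat T 0) * 0 ^ nat \<bar>n\<bar>" for n
    using True by (cases "n = 0") (auto simp: power_int_0_left_if)
  then show ?thesis
    using Infinite_Sum.abs_summable_on_comparison_test'[OF summable_on_int_geometric[of 0 "cmod (hat T 0)"],
        of "\<lambda>n. hat T n * of_real (cmod \<alpha>) powi n"] by simp
next
  case False
  define C where "C = modulation_bound ^ 3 * c"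
  define r where "r = cmod \<alpha>"
  have "r > 0" using False by (simp add: r_def)
  obtain e where e: "e > 0" "ball \<alpha> e \<subseteq> shift_spectrum E N"
    using \<alpha> by (auto simp: mem_interior)
  define t where "t = min (1 / 2) (e / (2 * r))"
  have t: "0 < t" "t < 1" "t * r < e"
  proof -
    have "t * r \<le> e / (2 * r) * r" using \<open>r > 0\<close> by (intro mult_right_mono) (auto simp: t_def)
    also have "\<dots> < e" using \<open>r > 0\<close> e(1) by simp
    finally show "t * r < e" .
  qed (use e(1) \<open>r > 0\<close> in \<open>auto simp: t_def\<close>)
  have mem: "of_real (1 + u) * \<alpha> \<in> shift_spectrum E N" if "\<bar>u\<bar> = t" for u :: real
  proof -
    have "\<alpha> - of_real (1 + u) * \<alpha> = - of_real u * \<alpha>" by (simp add: algebra_simps)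
    then have "dist \<alpha> (of_real (1 + u) * \<alpha>) = t * r"
      by (simp add: dist_norm norm_mult that r_def)
    then show ?thesis using e(2) t(3) by (auto simp: subset_iff)
  qed
  have le: "cmod (hat T n) * ((1 + u) * r) powi n \<le> C" if "\<bar>u\<bar> = t" for u n
  proof -
    have "0 < 1 + u" using that t by linarith
    have "cmod (of_real (1 + u) * \<alpha>) = (1 + u) * r"
      using \<open>0 < 1 + u\<close> by (simp add: norm_mult r_def del: of_real_add)
    then show ?thesis
      using hat_coeff_le[OF T mem[OF that], of n] by (simp add: norm_mult norm_power_int C_def)
  qed
  define \<theta> where "\<theta> = 1 / (1 + t)"
  have \<theta>: "0 < \<theta>" "\<theta> < 1" using t by (auto simp: \<theta>_def)
  have \<theta>': "1 - t \<le> \<theta>"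
  proof -
    have "(1 - t) * (1 + t) \<le> 1" by (simp add: algebra_simps)
    then show ?thesis using t(1) by (simp add: \<theta>_def pos_le_divide_eq)
  qed
  have C0: "0 \<le> C"
    using order_trans[OF _ le[of t 0]] t(1) by simp
  have "cmod (hat T n * of_real r powi n) \<le> C * \<theta> ^ nat \<bar>n\<bar>" for n
  proof (cases "0 \<le> n")
    case True
    then obtain k where n: "n = int k" using nonneg_int_cases by blast
    have "cmod (hat T n * of_real r powi n) = cmod (hat T n) * ((1 + t) * r) ^ k * \<theta> ^ k"
      using \<open>r > 0\<close> t(1)
      by (simp add: n norm_mult norm_power \<theta>_def power_mult_distrib power_divide)
    also have "\<dots> \<le> C * \<theta> ^ k"
      using le[of t n] t(1) \<theta> by (intro mult_right_mono) (auto simp: n)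
    finally show ?thesis by (simp add: n)
  next
    case False
    define k where "k = nat (- n)"
    have n: "n = - int k" "nat \<bar>n\<bar> = k" using False by (auto simp: k_def)
    have "cmod (hat T n * of_real r powi n) = cmod (hat T n) * (v * r) powi n * v ^ k" if "v > 0" for v
      using \<open>r > 0\<close> that
      by (simp add: n norm_mult norm_power norm_inverse power_int_minus power_mult_distrib)
    from this[of "1 - t"] t(2)
    have "cmod (hat T n * of_real r powi n) = cmod (hat T n) * ((1 - t) * r) powi n * (1 - t) ^ k"
      by (simp only: diff_gt_0_iff_gt)
    also have "\<dots> \<le> C * (1 - t) ^ k"
      using le[of "- t" n] t by (intro mult_right_mono) auto
    also have "\<dots> \<le> C * \<theta> ^ k"
      using \<theta>' t C0 by (intro mult_left_mono power_mono) auto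
    finally show ?thesis by (simp add: n)
  qed
  then show ?thesis
    using Infinite_Sum.abs_summable_on_comparison_test'[OF summable_on_int_geometric[of \<theta> C],
        of "\<lambda>n. hat T n * of_real r powi n"] \<theta> by (simp add: r_def)
qed

lemma complex_polarE:
  fixes \<alpha> :: complex
  obtains z where "cmod z = 1" "\<alpha> = of_real (cmod \<alpha>) * z"
proof (cases "\<alpha> = 0")
  case True
  then show thesis using that[of 1] by simp
next
  case False
  then show thesis using that[of "\<alpha> / of_real (cmod \<alpha>)"] by (simp add: norm_divide)
qed

lemma laurent_interior_mem_essential_range:
  assumes T: "multiplier_bound T c" and \<alpha>: "\<alpha> \<in> interior (shift_spectrum E N)"
    and f: "symbol_function T (cmod \<alpha>) f"
  shows "laurent (hat T) \<alpha> \<in> essential_range circle_measure f"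
proof -
  obtain z0 where z0: "cmod z0 = 1" "\<alpha> = of_real (cmod \<alpha>) * z0" by (rule complex_polarE)
  have "laurent (hat T) (of_real (cmod \<alpha>) * z0) \<in> essential_range circle_measure f"
    using f z0(1)
    by (intro laurent_mem_essential_range hat_summable_interior[OF T \<alpha>]) (auto simp: symbol_function_def)
  then show ?thesis using z0(2) by simp
qed

lemma cmod_mem_shift_spectrum:
  "\<alpha> \<in> shift_spectrum E N \<Longrightarrow> of_real (cmod \<alpha>) \<in> shift_spectrum E N"
  using sphere_subset_shift_spectrum by (auto simp: subset_iff)

text \<open>The value at an interior point is also in the essential range on the circle through that point, so
  the two parts of the range of the symbol can be treated alike.\<close>

lemma symbol_rangeE:
  assumes T: "multiplier_bound T c" and w: "w \<in> symbol_range (hat T) (shift_spectrum E N)"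
  obtains r where "of_real r \<in> shift_spectrum E N"
    "w \<in> essential_range circle_measure (circle_symbol (hat T) r)"
proof -
  consider \<alpha> where "\<alpha> \<in> interior (shift_spectrum E N)" "w = laurent (hat T) \<alpha>"
    | r where "r \<ge> 0" "sphere 0 r \<subseteq> frontier (shift_spectrum E N)"
        "w \<in> essential_range circle_measure (circle_symbol (hat T) r)"
    using w unfolding symbol_range_def by blast
  then show thesis
  proof cases
    case 1
    have r: "of_real (cmod \<alpha>) \<in> shift_spectrum E N"
      using 1(1) interior_subset cmod_mem_shift_spectrum by blast
    show thesis
      using that[OF r] laurent_interior_mem_essential_range[OF T 1(1) circle_symbol_symbol_function[OF T r]]
      by (simp add: 1(2))
  next
    case 2
    have "of_real r \<in> sphere (0::complex) r" using 2(1) by simp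
    then have "of_real r \<in> shift_spectrum E N"
      using 2(2) closed_shift_spectrum frontier_subset_closed by blast
    then show thesis using that 2(3) by blast
  qed
qed

lemma symbol_function_diff_conv:
  assumes M: "multiplier_bound M c" and f: "symbol_function M r f"
    and \<phi>: "\<phi> \<in> finseq" and r: "r \<noteq> 0 \<or> (\<forall>n. \<phi> n \<noteq> 0 \<longrightarrow> 0 \<le> n)"
  shows "symbol_function (\<lambda>x. M x - conv \<phi> x) r (\<lambda>z. f z - laurent \<phi> (of_real r * z))"
proof -
  have f': "f \<in> circle_Linf" "\<And>n. fourier_coeff f n = hat M n * of_real r powi n"
    using f by (auto simp: symbol_function_def)
  obtain B where fm [measurable]: "f \<in> borel_measurable borel"
    and B: "B \<ge> 0" "AE z in circle_measure. cmod (f z) \<le> B" using circle_LinfE[OF f'(1)] by blast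
  define p where "p z = laurent \<phi> (of_real r * z)" for z
  define Q where "Q = (\<Sum>n | \<phi> n \<noteq> 0. cmod (\<phi> n * of_real r powi n))"
  have fin: "finite {n. \<phi> n \<noteq> 0}" using \<phi> by (simp add: finseq_def)
  have p_eq: "p z = (\<Sum>n | \<phi> n \<noteq> 0. \<phi> n * of_real r powi n * z powi n)" for z
    unfolding p_def using laurent_eq_sum[OF fin, of \<phi>] by (simp add: power_int_mult_distrib mult.assoc)
  have pm [measurable]: "p \<in> borel_measurable borel" unfolding p_eq by measurable
  have pb: "AE z in circle_measure. cmod (p z) \<le> Q"
    using AE_circle_norm unfolding p_eq Q_def
    by eventually_elim (rule order_trans[OF norm_sum], simp add: norm_mult norm_power_int)
  have one: "(\<lambda>z. 1) \<in> circle_Linf" by (auto simp: circle_Linf_def)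
  have one_coeff: "fourier_coeff (\<lambda>z. 1) n = single 0 n * of_real r powi n" for n
    using integral_circle_powi[of "- n"] by (auto simp: fourier_coeff_def single_def)
  have conv0: "conv \<phi> (single 0) = \<phi>"
    using conv_commute[OF \<phi> finseq_single, of 0] by simp
  have p_coeff: "(LINT z|circle_measure. p z * z powi m) = 2 * pi * (of_real r powi (- m) * \<phi> (- m))" for m
  proof -
    have "r \<noteq> 0 \<or> (\<forall>n. \<phi> n \<noteq> 0 \<longrightarrow> 0 \<le> n) \<and> (\<forall>n. single 0 n \<noteq> 0 \<longrightarrow> 0 \<le> n)"
      using r by (auto simp: single_def)
    from integral_symbol_product[OF \<phi> one one_coeff this, of m] show ?thesis
      by (simp add: p_def conv0)
  qed
  have "(\<lambda>z. f z - p z) \<in> circle_Linf"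
  proof -
    have "AE z in circle_measure. cmod (f z - p z) \<le> B + Q"
      using B(2) pb by eventually_elim (rule order_trans[OF norm_triangle_ineq4], simp)
    then show ?thesis by (auto simp: circle_Linf_def)
  qed
  moreover have "fourier_coeff (\<lambda>z. f z - p z) n = hat (\<lambda>x. M x - conv \<phi> x) n * of_real r powi n" for n
  proof -
    have "integrable circle_measure (\<lambda>z. f z * z powi (- n))"
      by (rule circle_integrable_bounded[where C = B])
        (use B AE_circle_norm in \<open>auto simp: norm_mult norm_power_int norm_inverse elim: eventually_elim2\<close>)
    moreover have "integrable circle_measure (\<lambda>z. p z * z powi (- n))"
      by (rule circle_integrable_bounded[where C = Q])
        (use pb AE_circle_norm in \<open>auto simp: norm_mult norm_power_int norm_inverse elim: eventually_elim2\<close>)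
    ultimately have "fourier_coeff (\<lambda>z. f z - p z) n = fourier_coeff f n - fourier_coeff p n"
      by (simp add: fourier_coeff_def left_diff_distrib diff_divide_distrib)
    also have "fourier_coeff p n = \<phi> n * of_real r powi n"
      using p_coeff[of "- n"] by (simp add: fourier_coeff_def mult.commute)
    finally show ?thesis
      by (simp add: f'(2) hat_def unit_seq_eq_single conv0 cseq_apply left_diff_distrib)
  qed
  ultimately show ?thesis by (simp add: symbol_function_def p_def)
qed

lemma multiplier_bound_diff_conv:
  assumes M: "multiplier_bound M c" and \<phi>: "\<phi> \<in> conv_symbols"
  shows "\<exists>d. multiplier_bound (\<lambda>x. M x - conv \<phi> x) d"
proof -
  obtain d where d: "op_bound (conv \<phi>) d" using \<phi> by (auto simp: conv_symbols_def)
  have "M (shift a) - conv \<phi> (shift a) = shift (M a - conv \<phi> a)" if "a \<in> finseq" for a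
    using M that by (simp add: multiplier_bound_def shift_eq_translate conv_translate_right translate_diff)
  then show ?thesis
    using op_bound_minus[OF _ d, of M c] M unfolding multiplier_bound_def by blast
qed

lemma multiplier_translate_s:
  assumes T: "multiplier_bound T c" and x: "x \<in> E"
  shows "T (translate s x) = translate s (T x)"
proof -
  have Tb: "op_bound T c" using T by (simp add: multiplier_bound_def)
  obtain d where d: "op_bound (translate s) d" using translate_s_bounded by blast
  show ?thesis
    by (rule op_eq_dense[OF op_bound_comp[OF Tb d] op_bound_comp[OF d Tb] multiplier_translate[OF T] x])
qed

lemma inverse_multiplier:
  assumes R: "op_bound R d" and T: "\<And>x. x \<in> E \<Longrightarrow> T x \<in> E"
    and comm: "\<And>x. x \<in> E \<Longrightarrow> T (translate s x) = translate s (T x)"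
    and inv: "\<And>x. x \<in> E \<Longrightarrow> R (T x) = x" "\<And>x. x \<in> E \<Longrightarrow> T (R x) = x"
  shows "multiplier_bound R d"
proof -
  have Rs: "R (translate s x) = translate s (R x)" if x: "x \<in> E" for x
  proof -
    have Rx: "R x \<in> E" by (rule op_bound_mem[OF R x])
    have "R (translate s x) = R (T (translate s (R x)))"
      using comm[OF Rx] inv(2)[OF x] by simp
    then show ?thesis using inv(1)[OF translate_s_mem[OF Rx]] by simp
  qed
  have "R (shift a) = shift (R a)" if a: "a \<in> finseq" for a
  proof (cases "s = 1")
    case True
    then show ?thesis using Rs[OF finseq_mem[OF a]] by (simp add: shift_eq_translate)
  next
    case False
    then have s: "s = -1" using s_cases by simp
    have "translate s (R (translate 1 a)) = R a"
      using Rs[OF finseq_mem[OF finseq_translate[OF a, of 1]]] s by simp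
    then have "translate 1 (translate s (R (translate 1 a))) = translate 1 (R a)" by simp
    then show ?thesis using s by (simp add: shift_eq_translate)
  qed
  then show ?thesis using R by (simp add: multiplier_bound_def)
qed

lemma multiplier_mem: "multiplier_bound M c \<Longrightarrow> x \<in> E \<Longrightarrow> M x \<in> E"
  using op_bound_mem by (auto simp: multiplier_bound_def)

text \<open>The lower bound for \<open>|w - l|\<close> does not depend on \<open>w\<close>, so it passes to the closure.\<close>

lemma closure_symbol_range_subset_spectrum:
  assumes M: "multiplier_bound M c"
  shows "closure (symbol_range (hat M) (shift_spectrum E N)) \<subseteq> op_spectrum E N (graph_on E M)"
proof
  fix l assume l: "l \<in> closure (symbol_range (hat M) (shift_spectrum E N))"
  show "l \<in> op_spectrum E N (graph_on E M)"
  proof (rule ccontr)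
    assume "l \<notin> op_spectrum E N (graph_on E M)"
    then have "invertible_op (\<lambda>x. M x - cscale l x)"
      using not_in_spectrum_iff[OF multiplier_mem[OF M]] by simp
    then obtain R d where R: "op_bound R d" "\<And>x. x \<in> E \<Longrightarrow> R (M x - cscale l x) = x"
        "\<And>x. x \<in> E \<Longrightarrow> M (R x) - cscale l (R x) = x"
      unfolding invertible_op_def inverse_op_def by blast
    let ?\<phi> = "cscale l (single 0)"
    have \<phi>: "?\<phi> \<in> conv_symbols" by (intro conv_symbols_cscale single_0_conv_symbols)
    have conv_\<phi>: "conv ?\<phi> x = cscale l x" for x by (simp add: conv_cscale_left)
    define T where "T = (\<lambda>x. M x - conv ?\<phi> x)"
    obtain c' where T: "multiplier_bound T c'"
      unfolding T_def using multiplier_bound_diff_conv[OF M \<phi>] by blast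
    have RT: "R (T x) = x" "T (R x) = x" if "x \<in> E" for x
      using R(2,3)[OF that] by (simp_all add: T_def conv_\<phi>)
    have Rm: "multiplier_bound R d"
      by (rule inverse_multiplier[OF R(1) multiplier_mem[OF T] multiplier_translate_s[OF T] RT])
    have u: "unit_seq \<in> E" by (simp add: unit_seq_eq_single finseq_mem)
    define C where "C = modulation_bound ^ 3 * d"
    have lower: "1 \<le> C * cmod (w - l)" if w: "w \<in> symbol_range (hat M) (shift_spectrum E N)" for w
    proof -
      obtain r where r: "of_real r \<in> shift_spectrum E N"
          "w \<in> essential_range circle_measure (circle_symbol (hat M) r)"
        using symbol_rangeE[OF M w] by blast
      have "symbol_function T r (\<lambda>z. circle_symbol (hat M) r z - laurent ?\<phi> (of_real r * z))"
        unfolding T_def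
        by (rule symbol_function_diff_conv[OF M circle_symbol_symbol_function[OF M r(1)]])
          (use finseq_cscale[OF finseq_single] in \<open>auto simp: cscale_def single_def\<close>)
      then have "symbol_function T r (\<lambda>z. circle_symbol (hat M) r z - l)"
        by (simp add: laurent_cscale)
      moreover have "w - l \<in> essential_range circle_measure (\<lambda>z. circle_symbol (hat M) r z - l)"
        using r(2) by (simp add: essential_range_def dist_norm)
      ultimately show ?thesis
        unfolding C_def by (rule symbol_function_lower[OF T Rm RT(2)[OF u] r(1)])
    qed
    have "closed {w. 1 \<le> C * cmod (w - l)}"
      by (intro closed_Collect_le continuous_intros)
    then have "closure (symbol_range (hat M) (shift_spectrum E N)) \<subseteq> {w. 1 \<le> C * cmod (w - l)}"
      using lower by (intro closure_minimal) auto
    then have "1 \<le> C * cmod (l - l)" using l by blast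
    then show False by simp
  qed
qed

end


section \<open>A spectral radius estimate\<close>

context banach_seq_space
begin

lemma op_bound_cscale_sum:
  assumes B: "op_bound B b" and f: "\<And>i. i \<in> Z \<Longrightarrow> f i \<in> E"
  shows "B (cscale a (sum f Z)) = cscale a (\<Sum>i\<in>Z. B (f i))"
proof -
  have "sum f Z \<in> E" using f by (rule sum_mem)
  then show ?thesis by (simp add: op_bound_cscale[OF B] op_bound_sum[OF B f])
qed

lemma invertible_op_below:
  assumes "invertible_op T"
  shows "\<exists>d>0. \<forall>x\<in>E. T x \<in> E \<longrightarrow> N x \<le> d * N (T x)"
proof -
  obtain R d where R: "op_bound R d" "\<And>x. x \<in> E \<Longrightarrow> R (T x) = x"
    using assms unfolding invertible_op_def inverse_op_def by blast
  have "N x \<le> (d + 1) * N (T x)" if "x \<in> E" "T x \<in> E" for x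
  proof -
    have "N x \<le> d * N (T x)" using op_bound_le[OF R(1) that(2)] R(2)[OF that(1)] by simp
    then show ?thesis using norm_nonneg[OF that(2)] by (simp add: distrib_right)
  qed
  then show ?thesis using op_bound_nonneg[OF R(1)] by (intro exI[of _ "d + 1"]) auto
qed

text \<open>Otherwise there are \<open>w\<^sub>k\<close>, convergent to some \<open>l\<close>, for which the resolvents are unbounded; but \<open>1 - l A\<close> is bounded
  below, and the operators \<open>1 - w\<^sub>k A\<close> differ little from it.\<close>

lemma resolvent_uniform_bound:
  assumes A: "op_bound A a"
    and inv: "\<And>w. cmod w \<le> 1 \<Longrightarrow> invertible_op (\<lambda>x. x - cscale w (A x))"
  shows "\<exists>L>0. \<forall>w. cmod w \<le> 1 \<longrightarrow> (\<forall>x\<in>E. N x \<le> L * N (x - cscale w (A x)))"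
proof (rule ccontr)
  assume no: "\<not> ?thesis"
  let ?T = "\<lambda>w x. x - cscale w (A x)"
  have TE: "?T w x \<in> E" if "x \<in> E" for w x
    by (intro diff_mem cscale_mem op_bound_mem[OF A] that)
  have "\<exists>w x. cmod w \<le> 1 \<and> x \<in> E \<and> N x > real (Suc k) * N (?T w x)" for k
  proof -
    have "\<not> (\<forall>w. cmod w \<le> 1 \<longrightarrow> (\<forall>x\<in>E. N x \<le> real (Suc k) * N (?T w x)))"
      using no of_nat_0_less_iff[of "Suc k"] by blast
    then show ?thesis by (meson not_le)
  qed
  then obtain w x where wx: "\<And>k. cmod (w k) \<le> 1" "\<And>k. x k \<in> E"
      "\<And>k. N (x k) > real (Suc k) * N (?T (w k) (x k))" by metis
  have "compact (cball (0::complex) 1)" by simp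
  then obtain l r where l: "cmod l \<le> 1" "strict_mono r" "(w \<circ> r) \<longlonglongrightarrow> l"
    using wx(1) unfolding compact_def by (metis mem_cball_0)
  obtain d where d: "d > 0" "\<And>x. x \<in> E \<Longrightarrow> N x \<le> d * N (?T l x)"
    using invertible_op_below[OF inv[OF l(1)]] TE by blast
  define e where "e = 1 / (2 * d * (a + 1))"
  have a0: "0 \<le> a" by (rule op_bound_nonneg[OF A])
  have "e > 0" using d(1) a0 by (simp add: e_def)
  then have "\<forall>\<^sub>F k in sequentially. dist ((w \<circ> r) k) l < e" by (rule tendstoD[OF l(3)])
  then obtain k0 where k0: "\<And>k. k \<ge> k0 \<Longrightarrow> cmod (w (r k) - l) < e"
    by (auto simp: eventually_sequentially dist_norm)
  define k where "k = max k0 (nat \<lceil>2 * d\<rceil>)"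
  let ?w = "w (r k)" and ?x = "x (r k)"
  have xE: "?x \<in> E" by (rule wx(2))
  have "N ?x > 0"
  proof -
    have "0 \<le> real (Suc (r k)) * N (?T ?w ?x)" by (intro mult_nonneg_nonneg norm_nonneg TE xE) simp
    then show ?thesis using wx(3)[of "r k"] by linarith
  qed
  have "N (?T l ?x) \<le> N (?T ?w ?x) + cmod (?w - l) * (a * N ?x)"
  proof -
    have eq: "?T l ?x = ?T ?w ?x + cscale (?w - l) (A ?x)"
      by (simp add: cseq.scale_left_diff_distrib)
    have "N (?T l ?x) \<le> N (?T ?w ?x) + N (cscale (?w - l) (A ?x))"
      unfolding eq by (rule norm_triangle[OF TE[OF xE] cscale_mem[OF op_bound_mem[OF A xE]]])
    moreover have "N (cscale (?w - l) (A ?x)) \<le> cmod (?w - l) * (a * N ?x)"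
      using norm_cscale[OF op_bound_mem[OF A xE]] op_bound_le[OF A xE] by (simp add: mult_left_mono)
    ultimately show ?thesis by linarith
  qed
  also have "cmod (?w - l) * (a * N ?x) \<le> e * ((a + 1) * N ?x)"
    using k0[of k] a0 \<open>N ?x > 0\<close> less_imp_le[OF \<open>e > 0\<close>] by (intro mult_mono) (auto simp: k_def)
  finally have "d * N (?T l ?x) \<le> d * (N (?T ?w ?x) + e * ((a + 1) * N ?x))"
    using d(1) by (intro mult_left_mono) auto
  also have "\<dots> = d * N (?T ?w ?x) + N ?x / 2"
  proof -
    define b where "b = a + 1"
    have "b > 0" using a0 by (simp add: b_def)
    then have "d * e * b = 1 / 2" using d(1) by (simp add: e_def flip: b_def)
    moreover have "d * (N (?T ?w ?x) + e * (b * N ?x)) = d * N (?T ?w ?x) + (d * e * b) * N ?x"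
      by (simp add: algebra_simps)
    ultimately show ?thesis unfolding b_def[symmetric] by simp
  qed
  finally have "N ?x \<le> 2 * d * N (?T ?w ?x)"
    using d(2)[OF xE] by linarith
  also have "\<dots> \<le> real (Suc (r k)) * N (?T ?w ?x)"
  proof (rule mult_right_mono)
    have "2 * d \<le> real k" unfolding k_def by linarith
    also have "real k \<le> real (Suc (r k))" using seq_suble[OF l(2), of k] by linarith
    finally show "2 * d \<le> real (Suc (r k))" .
  qed (intro norm_nonneg TE xE)
  finally show False using wx(3)[of "r k"] by linarith
qed

text \<open>This is the inequality \<open>sup \<parallel>A\<^sup>m\<parallel> < \<infinity>\<close> behind the spectral radius formula, in an elementary form due to
  Rickart.  Averaging the resolvents \<open>Q\<^sub>w = (1 - w A)\<^sup>-\<^sup>1\<close> over \<open>w = t \<omega>\<close>, \<open>\<omega>\<^sup>m = 1\<close>, gives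
  \<open>P\<^sub>m(t) = (1 - t\<^sup>m A\<^sup>m)\<^sup>-\<^sup>1\<close>, which is Lipschitz in \<open>t\<close> uniformly in \<open>m\<close>.  If the powers of \<open>t A\<close> are
  bounded, those of \<open>\<tau> A\<close> with \<open>\<tau> < t\<close> tend to \<open>0\<close>, so \<open>P\<^sub>m(\<tau>)\<close> is close to \<open>1\<close>; hence so is
  \<open>P\<^sub>m(t')\<close> for \<open>t'\<close> slightly above \<open>t\<close>, which bounds the powers of \<open>t' A\<close>.  In steps of a fixed length this
  reaches \<open>t = 1\<close>.\<close>

lemma powers_bounded:
  assumes A: "op_bound A a"
    and inv: "\<And>w. cmod w \<le> 1 \<Longrightarrow> invertible_op (\<lambda>x. x - cscale w (A x))"
  shows "\<exists>K\<ge>0. \<forall>m. \<forall>x\<in>E. N ((A ^^ m) x) \<le> K * N x"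
proof -
  let ?T = "\<lambda>w x. x - cscale w (A x)"
  have a0: "0 \<le> a" by (rule op_bound_nonneg[OF A])
  have AE: "A x \<in> E" if "x \<in> E" for x by (rule op_bound_mem[OF A that])
  have powE: "(A ^^ m) x \<in> E" if "x \<in> E" for m x by (rule op_bound_mem[OF op_bound_pow[OF A] that])
  have TE: "?T w x \<in> E" if "x \<in> E" for w x by (intro diff_mem cscale_mem AE that)
  obtain L where L: "L > 0" "\<And>w x. cmod w \<le> 1 \<Longrightarrow> x \<in> E \<Longrightarrow> N x \<le> L * N (?T w x)"
    using resolvent_uniform_bound[OF A inv] by blast
  have "\<forall>w. \<exists>R. cmod w \<le> 1 \<longrightarrow> inverse_op R (?T w)"
    using inv unfolding invertible_op_def by blast
  then obtain Q where Q: "\<And>w. cmod w \<le> 1 \<Longrightarrow> inverse_op (Q w) (?T w)" by metis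
  have QE: "Q w x \<in> E" and QT: "Q w (?T w x) = x" and TQ: "?T w (Q w x) = x"
    if "cmod w \<le> 1" "x \<in> E" for w x
    using Q[OF that(1)] that(2) op_bound_mem unfolding inverse_op_def by blast+
  have Q_le: "N (Q w x) \<le> L * N x" if "cmod w \<le> 1" "x \<in> E" for w x
    using L(2)[OF that(1) QE[OF that]] TQ[OF that] by simp
  have QA: "Q w (A x) = A (Q w x)" if w: "cmod w \<le> 1" "x \<in> E" for w x
  proof -
    have "?T w (A (Q w x)) = A (?T w (Q w x))"
      using op_bound_diff[OF A QE[OF w] cscale_mem[OF AE[OF QE[OF w]]]] op_bound_cscale[OF A AE[OF QE[OF w]]]
      by simp
    then have "?T w (A (Q w x)) = A x" using TQ[OF w] by simp
    then show ?thesis using QT[OF w(1) AE[OF QE[OF w]]] by simp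
  qed
  have Q_lip: "N (Q w x - Q v x) \<le> cmod (w - v) * (a * L\<^sup>2) * N x"
    if w: "cmod w \<le> 1" and v: "cmod v \<le> 1" and x: "x \<in> E" for w v x
  proof -
    note Qw = QE[OF w x] and Qv = QE[OF v x]
    have "?T w (Q w x - Q v x) = ?T w (Q w x) - ?T v (Q v x) + cscale (w - v) (A (Q v x))"
      using op_bound_diff[OF A Qw Qv]
      by (simp add: cseq.scale_left_diff_distrib cseq.scale_right_diff_distrib)
    then have eq: "?T w (Q w x - Q v x) = cscale (w - v) (A (Q v x))"
      using TQ[OF w x] TQ[OF v x] by simp
    have "N (Q w x - Q v x) \<le> L * N (cscale (w - v) (A (Q v x)))"
      using L(2)[OF w diff_mem[OF Qw Qv]] unfolding eq .
    also have "\<dots> = L * (cmod (w - v) * N (A (Q v x)))" using norm_cscale[OF AE[OF Qv]] by simp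
    also have "\<dots> \<le> L * (cmod (w - v) * (a * (L * N x)))"
      using L(1) a0 op_bound_le[OF A Qv] Q_le[OF v x]
      by (intro mult_left_mono order_trans[OF op_bound_le[OF A Qv]]) auto
    finally show ?thesis by (simp add: power2_eq_square mult_ac)
  qed
  define P where "P m t x = cscale (1 / of_nat m) (\<Sum>\<omega> | \<omega> ^ m = 1. Q (of_real t * \<omega>) x)"
    for m :: nat and t :: real and x
  have root: "cmod (of_real t * \<omega>) \<le> 1" if "0 < m" "\<omega> ^ m = 1" "0 \<le> t" "t \<le> 1" for m t \<omega>
    using root_of_unity_norm[OF that(1,2)] that(3,4) by (simp add: norm_mult)
  have PE: "P m t x \<in> E" if "0 < m" "0 \<le> t" "t \<le> 1" "x \<in> E" for m t x
    unfolding P_def using that root by (intro cscale_mem sum_mem QE) auto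
  have avg: "N (cscale (1 / of_nat m) (\<Sum>\<omega> | \<omega> ^ m = 1. f \<omega>)) \<le> b"
    if m: "0 < m" and f: "\<And>\<omega>. \<omega> ^ m = 1 \<Longrightarrow> f \<omega> \<in> E" "\<And>\<omega>. \<omega> ^ m = 1 \<Longrightarrow> N (f \<omega>) \<le> b"
    for m :: nat and f :: "complex \<Rightarrow> cseq" and b
  proof -
    have "N (cscale (1 / of_nat m) (\<Sum>\<omega> | \<omega> ^ m = 1. f \<omega>)) = N (\<Sum>\<omega> | \<omega> ^ m = 1. f \<omega>) / m"
      using norm_cscale[OF sum_mem, of "{\<omega>. \<omega> ^ m = 1}" f "1 / of_nat m"] f(1)
      by (simp add: norm_divide)
    also have "\<dots> \<le> (\<Sum>\<omega> | \<omega> ^ m = 1. N (f \<omega>)) / m"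
      using f(1) by (intro divide_right_mono norm_sum_le) auto
    also have "\<dots> \<le> (\<Sum>\<omega>::complex | \<omega> ^ m = 1. b) / m"
      using f(2) by (intro divide_right_mono sum_mono) auto
    also have "\<dots> = b" using m card_roots_unity_eq[of m] by simp
    finally show ?thesis .
  qed
  have P_le: "N (P m t x) \<le> L * N x" if m: "0 < m" and t: "0 \<le> t" "t \<le> 1" and x: "x \<in> E" for m t x
    unfolding P_def using root[OF m _ t] by (intro avg m QE Q_le x) auto
  have P_lip: "N (P m t x - P m u x) \<le> \<bar>t - u\<bar> * (a * L\<^sup>2) * N x"
    if m: "0 < m" and t: "0 \<le> t" "t \<le> 1" and u: "0 \<le> u" "u \<le> 1" and x: "x \<in> E" for m t u x
  proof -
    have eq: "P m t x - P m u x = cscale (1 / of_nat m)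
        (\<Sum>\<omega> | \<omega> ^ m = 1. Q (of_real t * \<omega>) x - Q (of_real u * \<omega>) x)"
      by (simp add: P_def sum_subtractf cseq.scale_right_diff_distrib)
    show ?thesis
      unfolding eq
    proof (rule avg[OF m])
      fix \<omega> :: complex assume \<omega>: "\<omega> ^ m = 1"
      note r = root[OF m \<omega> t] root[OF m \<omega> u]
      show "Q (of_real t * \<omega>) x - Q (of_real u * \<omega>) x \<in> E" by (intro diff_mem QE r x)
      have "cmod (of_real t * \<omega> - of_real u * \<omega>) = \<bar>t - u\<bar>"
        using root_of_unity_norm[OF m \<omega>]
        by (metis left_diff_distrib mult.right_neutral norm_mult norm_of_real of_real_diff)
      then show "N (Q (of_real t * \<omega>) x - Q (of_real u * \<omega>) x) \<le> \<bar>t - u\<bar> * (a * L\<^sup>2) * N x"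
        using Q_lip[OF r x] by simp
    qed
  qed
  have P_inv: "P m t x - cscale (of_real t ^ m) ((A ^^ m) (P m t x)) = x"
    if m: "0 < m" and t: "0 \<le> t" "t \<le> 1" and x: "x \<in> E" for m t x
  proof -
    let ?Z = "{\<omega>::complex. \<omega> ^ m = 1}"
    have Qx: "Q (of_real t * \<omega>) x \<in> E" if "\<omega> \<in> ?Z" for \<omega>
      using QE[OF root[OF m _ t] x] that by simp
    have geo: "y - cscale (w ^ m) ((A ^^ m) y) = (\<Sum>i<m. cscale (w ^ i) ((A ^^ i) (?T w y)))"
      if y: "y \<in> E" for w y
    proof -
      have "cscale (w ^ i) ((A ^^ i) (?T w y))
          = cscale (w ^ i) ((A ^^ i) y) - cscale (w ^ Suc i) ((A ^^ Suc i) y)" for i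
      proof -
        have "(A ^^ i) (?T w y) = (A ^^ i) y - cscale w ((A ^^ Suc i) y)"
          using op_bound_diff[OF op_bound_pow[OF A] y cscale_mem[OF AE[OF y]]]
            op_bound_cscale[OF op_bound_pow[OF A] AE[OF y]]
          by (simp only: funpow_Suc_right o_apply)
        then show ?thesis
          by (simp add: cseq.scale_right_diff_distrib mult.commute del: funpow.simps)
      qed
      then show ?thesis
        using sum_lessThan_telescope'[of "\<lambda>i. cscale (w ^ i) ((A ^^ i) y)" m] by simp
    qed
    have each: "Q (of_real t * \<omega>) x - cscale (of_real t ^ m) ((A ^^ m) (Q (of_real t * \<omega>) x))
        = (\<Sum>i<m. cscale (of_real t ^ i * \<omega> ^ i) ((A ^^ i) x))" if \<omega>: "\<omega> \<in> ?Z" for \<omega>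
    proof -
      have "of_real t ^ m = (of_real t * \<omega>) ^ m" using \<omega> by (simp add: power_mult_distrib)
      then show ?thesis
        using geo[OF Qx[OF \<omega>], of "of_real t * \<omega>"] TQ[OF root[OF m _ t] x, of \<omega>] \<omega>
        by (simp add: power_mult_distrib)
    qed
    have "P m t x - cscale (of_real t ^ m) ((A ^^ m) (P m t x))
        = cscale (1 / of_nat m)
          (\<Sum>\<omega>\<in>?Z. Q (of_real t * \<omega>) x - cscale (of_real t ^ m) ((A ^^ m) (Q (of_real t * \<omega>) x)))"
    proof -
      have "(A ^^ m) (P m t x) = cscale (1 / of_nat m) (\<Sum>\<omega>\<in>?Z. (A ^^ m) (Q (of_real t * \<omega>) x))"
        unfolding P_def by (rule op_bound_cscale_sum[OF op_bound_pow[OF A]]) (rule Qx)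
      then show ?thesis
        by (simp add: P_def sum_subtractf cseq.scale_right_diff_distrib cseq.scale_sum_right mult.commute)
    qed
    also have "\<dots> = cscale (1 / of_nat m) (\<Sum>\<omega>\<in>?Z. \<Sum>i<m. cscale (of_real t ^ i * \<omega> ^ i) ((A ^^ i) x))"
      using each by simp
    also have "(\<Sum>\<omega>\<in>?Z. \<Sum>i<m. cscale (of_real t ^ i * \<omega> ^ i) ((A ^^ i) x))
        = (\<Sum>i<m. \<Sum>\<omega>\<in>?Z. cscale (of_real t ^ i * \<omega> ^ i) ((A ^^ i) x))"
      by (rule sum.swap)
    also have "\<dots> = (\<Sum>i<m. cscale (of_real t ^ i * (\<Sum>\<omega>\<in>?Z. \<omega> ^ i)) ((A ^^ i) x))"
      by (simp add: cseq.scale_sum_left sum_distrib_left)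
    also have "\<dots> = (\<Sum>i<m. if i = 0 then cscale (of_nat m) x else 0)"
    proof (intro sum.cong refl)
      fix i assume i: "i \<in> {..<m}"
      have "(\<Sum>\<omega>\<in>?Z. \<omega> ^ i) = (if i = 0 then of_nat m else 0)"
        using sum_roots_of_unity[OF m, of "int i"] i by (auto dest: nat_dvd_not_less)
      then show "cscale (of_real t ^ i * (\<Sum>\<omega>\<in>?Z. \<omega> ^ i)) ((A ^^ i) x)
          = (if i = 0 then cscale (of_nat m) x else 0)" by auto
    qed
    also have "\<dots> = cscale (of_nat m) x" using m by (simp add: sum.delta)
    finally show ?thesis using m by simp
  qed
  have PA: "P m t ((A ^^ k) x) = (A ^^ k) (P m t x)"
    if m: "0 < m" and t: "0 \<le> t" "t \<le> 1" and x: "x \<in> E" for m t k x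
  proof (induction k)
    case (Suc k)
    have "P m t (A y) = A (P m t y)" if y: "y \<in> E" for y
    proof -
      have Qy: "Q (of_real t * \<omega>) y \<in> E" if "\<omega> \<in> {\<omega>. \<omega> ^ m = 1}" for \<omega>
        using QE[OF root[OF m _ t] y] that by simp
      have "A (P m t y) = cscale (1 / of_nat m) (\<Sum>\<omega> | \<omega> ^ m = 1. A (Q (of_real t * \<omega>) y))"
        unfolding P_def by (rule op_bound_cscale_sum[OF A]) (rule Qy)
      then show ?thesis
        unfolding P_def using QA[OF root[OF m _ t] y] by simp
    qed
    then show ?case using Suc powE[OF x] by simp
  qed simp
  (* The step length 1 / n0 makes P vary by at most 1 / 4 over two steps, and at t = 1 / n0 the
     norm of t A is at most 1. *)
  define G where "G t \<longleftrightarrow> (\<exists>K. \<forall>m. \<forall>x\<in>E. t ^ m * N ((A ^^ m) x) \<le> K * N x)" for t :: real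
  define n0 where "n0 = Suc (nat \<lceil>max (a + 1) (8 * (a * L\<^sup>2 + 1))\<rceil>)"
  have n0: "real n0 \<ge> a + 1" "real n0 \<ge> 8 * (a * L\<^sup>2 + 1)" "0 < n0"
    unfolding n0_def by linarith+
  have "G (real i / real n0)" if "1 \<le> i" "i \<le> n0" for i
    using that
  proof (induction i rule: dec_induct)
    case base
    have "(1 / real n0) ^ m * N ((A ^^ m) x) \<le> 1 * N x" if x: "x \<in> E" for m x
    proof -
      have "(1 / real n0) ^ m * N ((A ^^ m) x) \<le> (1 / real n0) ^ m * (a ^ m * N x)"
        by (intro mult_left_mono op_bound_le[OF op_bound_pow[OF A]] x) simp
      also have "\<dots> = (a / real n0) ^ m * N x" by (simp add: power_divide)
      also have "\<dots> \<le> 1 * N x"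
        using n0 a0 by (intro mult_right_mono norm_nonneg x power_le_one) auto
      finally show ?thesis .
    qed
    then show ?case unfolding G_def by (intro exI[of _ 1]) simp
  next
    case (step i)
    define t where "t = real i / real n0"
    define \<tau> where "\<tau> = real (i - 1) / real n0"
    define t' where "t' = real (Suc i) / real n0"
    have t: "0 < t" "0 \<le> \<tau>" "\<tau> \<le> 1" "0 \<le> t'" "t' \<le> 1" "\<tau> < t" "t' - \<tau> = 2 / n0"
      using step.hyps step.prems n0(3)
      by (auto simp: t_def \<tau>_def t'_def divide_simps of_nat_diff)
    obtain K where K: "\<And>m x. x \<in> E \<Longrightarrow> t ^ m * N ((A ^^ m) x) \<le> K * N x"
      using step unfolding G_def t_def by auto
    define q where "q = \<tau> / t"
    have q: "0 \<le> q" "q < 1" "\<tau> = q * t" using t by (auto simp: q_def)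
    have "(\<lambda>m. q ^ m * (\<bar>K\<bar> * L)) \<longlonglongrightarrow> 0"
      using q LIMSEQ_power_zero[of q] by (intro tendsto_mult_left_zero) auto
    then have "\<forall>\<^sub>F m in sequentially. q ^ m * (\<bar>K\<bar> * L) < 1 / 4" by (rule order_tendstoD) simp
    then obtain m0 where m0: "\<And>m. m \<ge> m0 \<Longrightarrow> q ^ m * (\<bar>K\<bar> * L) < 1 / 4"
      by (auto simp: eventually_sequentially)
    have large: "t' ^ m * N ((A ^^ m) x) \<le> N x" if m: "m \<ge> m0" "0 < m" and x: "x \<in> E" for m x
    proof -
      have close: "N (P m t' y - y) \<le> N y / 2" if y: "y \<in> E" for y
      proof -
        note Pt = PE[OF m(2) t(2,3) y] and Pt' = PE[OF m(2) t(4,5) y]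
        have "P m \<tau> y - y = cscale (of_real \<tau> ^ m) ((A ^^ m) (P m \<tau> y))"
          using P_inv[OF m(2) t(2,3) y] by (metis add_diff_cancel_left' diff_add_cancel)
        then have "N (P m \<tau> y - y) = \<tau> ^ m * N ((A ^^ m) (P m \<tau> y))"
          using norm_cscale[OF powE[OF Pt]] t(2) by (simp add: norm_power)
        also have "\<dots> = q ^ m * (t ^ m * N ((A ^^ m) (P m \<tau> y)))"
          by (simp add: q(3) power_mult_distrib)
        also have "\<dots> \<le> q ^ m * (\<bar>K\<bar> * (L * N y))"
        proof (rule mult_left_mono)
          have "t ^ m * N ((A ^^ m) (P m \<tau> y)) \<le> K * N (P m \<tau> y)" by (rule K[OF Pt])
          also have "\<dots> \<le> \<bar>K\<bar> * N (P m \<tau> y)" by (intro mult_right_mono norm_nonneg Pt) simp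
          also have "\<dots> \<le> \<bar>K\<bar> * (L * N y)" by (intro mult_left_mono P_le m t y) simp
          finally show "t ^ m * N ((A ^^ m) (P m \<tau> y)) \<le> \<bar>K\<bar> * (L * N y)" .
        qed (use q in simp)
        also have "\<dots> = (q ^ m * (\<bar>K\<bar> * L)) * N y" by simp
        also have "\<dots> \<le> 1 / 4 * N y" using m0[OF m(1)] by (intro mult_right_mono norm_nonneg y) simp
        finally have 1: "N (P m \<tau> y - y) \<le> 1 / 4 * N y" .
        have "N (P m t' y - P m \<tau> y) \<le> \<bar>t' - \<tau>\<bar> * (a * L\<^sup>2) * N y"
          by (intro P_lip m t y)
        also have "\<bar>t' - \<tau>\<bar> * (a * L\<^sup>2) \<le> 1 / 4"
          unfolding t(7) using n0 a0 by (simp add: divide_simps)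
        finally have 2: "N (P m t' y - P m \<tau> y) \<le> 1 / 4 * N y"
          using norm_nonneg[OF y] by (simp add: mult_right_mono)
        show ?thesis using 1 2 norm_diff_triangle[OF Pt' Pt y] by linarith
      qed
      let ?B = "cscale (of_real t' ^ m) ((A ^^ m) x)"
      have BE: "?B \<in> E" by (intro cscale_mem powE x)
      let ?y = "x - ?B"
      have yE: "?y \<in> E" by (intro diff_mem x BE)
      have "P m t' ?y = x"
      proof -
        have Qb: "Q w (u - v) = Q w u - Q w v" "Q w (cscale c u) = cscale c (Q w u)"
          if "cmod w \<le> 1" "u \<in> E" "v \<in> E" for w u v c
          using Q[OF that(1)] op_bound_diff op_bound_cscale that(2,3) unfolding inverse_op_def by blast+
        have "P m t' ?y = P m t' x - cscale (of_real t' ^ m) (P m t' ((A ^^ m) x))"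
          unfolding P_def using Qb[OF root[OF m(2) _ t(4,5)]] x BE powE[OF x]
          by (simp add: sum_subtractf cseq.scale_right_diff_distrib cseq.scale_sum_right mult.commute)
        also have "\<dots> = x"
          using PA[OF m(2) t(4,5) x, of m] P_inv[OF m(2) t(4,5) x] by simp
        finally show ?thesis .
      qed
      then have "N ?B \<le> N ?y / 2" using close[OF yE] by simp
      also have "\<dots> \<le> (N x + N ?B) / 2" using norm_diff_le[OF x BE] by simp
      finally have "N ?B \<le> N x" by simp
      then show ?thesis using norm_cscale[OF powE[OF x]] t(4) by (simp add: norm_power)
    qed
    define K' where "K' = 1 + (\<Sum>j\<le>m0. a ^ j)"
    have "t' ^ m * N ((A ^^ m) x) \<le> K' * N x" if x: "x \<in> E" for m x
    proof (cases "m \<le> m0")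
      case True
      have "t' ^ m * N ((A ^^ m) x) \<le> 1 * (a ^ m * N x)"
        using t(4,5) by (intro mult_mono power_le_one op_bound_le[OF op_bound_pow[OF A]] x norm_nonneg powE) auto
      also have "a ^ m \<le> (\<Sum>j\<le>m0. a ^ j)"
        using True a0 by (intro member_le_sum) auto
      then have "1 * (a ^ m * N x) \<le> K' * N x"
        unfolding K'_def mult_1 by (intro mult_right_mono norm_nonneg x) auto
      finally show ?thesis .
    next
      case False
      then have "t' ^ m * N ((A ^^ m) x) \<le> N x" by (intro large x) auto
      also have "\<dots> \<le> K' * N x"
        using norm_nonneg[OF x] a0 by (simp add: K'_def distrib_right sum_nonneg)
      finally show ?thesis .
    qed
    then show ?case unfolding G_def t'_def[symmetric] by blast
  qed
  from this[of n0] have "G 1" using n0(3) by simp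
  then obtain K where K: "\<And>m x. x \<in> E \<Longrightarrow> N ((A ^^ m) x) \<le> K * N x" by (auto simp: G_def)
  have "N ((A ^^ m) x) \<le> \<bar>K\<bar> * N x" if "x \<in> E" for m x
    using order_trans[OF K[OF that] mult_right_mono[OF abs_ge_self norm_nonneg[OF that]]] .
  then show ?thesis by (intro exI[of _ "\<bar>K\<bar>"]) simp
qed

end


section \<open>Inverting convolution operators\<close>

context bounded_shift_space
begin

text \<open>All roots of \<open>p\<close> lie outside the spectrum, so \<open>p(S\<^sup>s)\<close> is a product of invertible operators.\<close>

lemma invertible_op_poly_seq:
  assumes "p \<noteq> 0" "\<And>\<beta>. \<beta> \<in> sigma \<Longrightarrow> poly p \<beta> \<noteq> 0"
  shows "invertible_op (conv (poly_seq p))"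
  using assms
proof (induction "degree p" arbitrary: p rule: less_induct)
  case less
  show ?case
  proof (cases "degree p = 0")
    case True
    then obtain c where c: "p = [:c:]" by (rule degree_eq_zeroE)
    then have "c \<noteq> 0" using less.prems(1) by simp
    moreover have "conv (poly_seq p) x = cscale c x" for x
      by (simp add: c conv_poly_seq_pCons)
    ultimately show ?thesis using invertible_op_cong[OF invertible_op_cscale] by blast
  next
    case False
    then have "\<not> constant (poly p)" by (simp add: constant_degree)
    then obtain b where b: "poly p b = 0" using fundamental_theorem_of_algebra by blast
    then obtain q where q: "p = [:- b, 1:] * q" by (auto simp: poly_eq_0_iff_dvd)
    have "q \<noteq> 0" using q less.prems(1) by auto
    have "degree p = Suc (degree q)" unfolding q using \<open>q \<noteq> 0\<close> by (subst degree_mult_eq) auto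
    moreover have "poly q \<beta> \<noteq> 0" if "\<beta> \<in> sigma" for \<beta> using less.prems(2)[OF that] q by auto
    ultimately have inv_q: "invertible_op (conv (poly_seq q))"
      using less.hyps[of q] \<open>q \<noteq> 0\<close> by simp
    have "b \<notin> sigma" using b less.prems(2) by blast
    then have inv_b: "invertible_op (\<lambda>x. translate s x - cscale b x)" by (simp add: not_in_sigma_iff)
    obtain c where c: "op_bound (conv (poly_seq q)) c"
      using poly_seq_conv_symbols by (auto simp: conv_symbols_def)
    have "conv (poly_seq p) x = translate s (conv (poly_seq q) x) - cscale b (conv (poly_seq q) x)" for x
      unfolding q conv_poly_seq_mult conv_poly_seq_linear ..
    then show ?thesis
      using invertible_op_cong[OF invertible_op_comp[OF inv_b inv_q op_bound_mem[OF c]]] by simp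
  qed
qed

lemma invertible_op_translate_inverse:
  assumes "0 \<notin> sigma"
  shows "invertible_op (translate (- s * int k))"
proof -
  have "invertible_op (\<lambda>x. translate s x - cscale 0 x)" using assms by (simp add: not_in_sigma_iff)
  then obtain R d where R: "op_bound R d" "\<And>x. x \<in> E \<Longrightarrow> translate s (R x) = x"
    unfolding invertible_op_def inverse_op_def by auto
  have R_eq: "R x = translate (- s) x" if x: "x \<in> E" for x
  proof -
    have "translate (- s) (translate s (R x)) = translate (- s) x" using R(2)[OF x] by simp
    then show ?thesis by simp
  qed
  have mem: "translate (- s) x \<in> E" if "x \<in> E" for x
    using op_bound_mem[OF R(1) that] R_eq[OF that] by simp
  have inv: "invertible_op (translate (- s))"
    unfolding invertible_op_def inverse_op_def
    using translate_s_bounded by (intro exI[of _ "translate s"]) auto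
  have memk: "translate (- s * int k) x \<in> E" if "x \<in> E" for k x
  proof (induction k)
    case (Suc k)
    have "translate (- s * int (Suc k)) x = translate (- s) (translate (- s * int k) x)"
      by (simp add: algebra_simps)
    then show ?case using mem[OF Suc] by simp
  qed (use that in simp)
  show ?thesis
  proof (induction k)
    case 0
    have "inverse_op (\<lambda>x. x) (translate (- s * int 0))"
      unfolding inverse_op_def using op_bound_id by auto
    then show ?case unfolding invertible_op_def by blast
  next
    case (Suc k)
    have "invertible_op (\<lambda>x. translate (- s) (translate (- s * int k) x))"
      by (rule invertible_op_comp[OF inv Suc memk])
    then show ?case by (rule invertible_op_cong) (simp add: algebra_simps)
  qed
qed

text \<open>If \<open>S\<^sup>s\<close> is invertible, a power of it turns \<open>\<psi>\<close> into a polynomial; otherwise \<open>\<psi>\<close> is one already.\<close>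

lemma invertible_op_conv:
  assumes \<psi>: "\<psi> \<in> conv_symbols" and ne: "sigma \<noteq> {}"
    and nz: "\<And>\<beta>. \<beta> \<in> sigma \<Longrightarrow> laurent \<psi> (\<beta> powi s) \<noteq> 0"
  shows "invertible_op (conv \<psi>)"
proof (cases "0 \<in> sigma")
  case True
  then obtain p where p: "\<psi> = poly_seq p" using conv_symbols_support \<psi> by blast
  have "poly p \<beta> \<noteq> 0" if "\<beta> \<in> sigma" for \<beta> using nz[OF that] by (simp add: p laurent_poly_seq)
  moreover from this have "p \<noteq> 0" using ne by auto
  ultimately show ?thesis unfolding p by (intro invertible_op_poly_seq)
next
  case False
  have \<psi>F: "\<psi> \<in> finseq" using \<psi> by (rule conv_symbols_finseq)
  obtain k p where p: "translate (s * int k) \<psi> = poly_seq p"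
    using exists_translate_poly_seq[OF \<psi>F] by blast
  have "poly p \<beta> \<noteq> 0" if \<beta>: "\<beta> \<in> sigma" for \<beta>
  proof -
    have "\<beta> \<noteq> 0" using \<beta> False by auto
    have "poly p \<beta> = (\<beta> powi s) powi (s * int k) * laurent \<psi> (\<beta> powi s)"
      using \<open>\<beta> \<noteq> 0\<close> by (simp add: laurent_poly_seq[symmetric] p[symmetric] laurent_translate[OF \<psi>F])
    then show ?thesis using nz[OF \<beta>] \<open>\<beta> \<noteq> 0\<close> by simp
  qed
  moreover from this have "p \<noteq> 0" using ne by auto
  ultimately have inv: "invertible_op (conv (poly_seq p))" by (intro invertible_op_poly_seq)
  obtain c where c: "op_bound (conv (poly_seq p)) c"
    using poly_seq_conv_symbols by (auto simp: conv_symbols_def)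
  have "conv \<psi> x = translate (- s * int k) (conv (poly_seq p) x)" for x
    by (simp add: p[symmetric] conv_translate_left[OF \<psi>F])
  then show ?thesis
    using invertible_op_cong[OF invertible_op_comp[OF invertible_op_translate_inverse[OF False] inv op_bound_mem[OF c]]]
    by simp
qed

text \<open>If \<open>S\<close> is unbounded, \<open>\<sigma>(S\<^sup>-\<^sup>1)\<close> contains with \<open>\<beta>\<^sub>0\<close> the punctured disc \<open>0 < |\<beta>| < |\<beta>\<^sub>0|\<close>.  Otherwise the
  coefficients of the resolvent \<open>W\<close> at some such \<open>\<beta>\<close> satisfy a two-term recursion.  Those with
  positive index vanish, because each would make \<open>S\<close> bounded, so \<open>W(-m)\<close> is a
  multiple of \<open>\<beta>\<^sup>-\<^sup>m\<close>; but it is \<open>O(\<beta>\<^sub>0\<^sup>-\<^sup>m)\<close>, because \<open>\<beta>\<^sub>0\<close> lies in the spectrum.\<close>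

lemma sigma_contains_punctured_disc:
  assumes s: "s = -1" and \<beta>0: "\<beta>\<^sub>0 \<in> sigma" and \<beta>: "\<beta> \<noteq> 0" "cmod \<beta> < cmod \<beta>\<^sub>0"
  shows "\<beta> \<in> sigma"
proof (rule ccontr)
  assume "\<beta> \<notin> sigma"
  then have "invertible_op (\<lambda>x. translate s x - cscale \<beta> x)" by (simp add: not_in_sigma_iff)
  then obtain W d where W: "op_bound W d" "\<And>x. x \<in> E \<Longrightarrow> W (translate s x - cscale \<beta> x) = x"
      "\<And>x. x \<in> E \<Longrightarrow> translate s (W x) - cscale \<beta> (W x) = x"
    unfolding invertible_op_def inverse_op_def by blast
  have Wm: "multiplier_bound W d"
    by (rule inverse_multiplier[OF W(1) _ _ W(2,3)])
      (auto simp: translate_diff translate_cscale intro!: diff_mem translate_s_mem cscale_mem)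
  define x where "x = hat W"
  have uE: "unit_seq \<in> E" by (simp add: unit_seq_eq_single finseq_mem)
  have rec: "x (n + 1) = \<beta> * x n + (if n = 0 then 1 else 0)" for n
  proof -
    have "(translate s x - cscale \<beta> x) n = single 0 n"
      using W(3)[OF uE] by (simp add: x_def hat_def unit_seq_eq_single)
    then show ?thesis
      using s by (simp add: translate_def cscale_def cseq_apply single_def algebra_simps split: if_splits)
  qed
  have pos: "x n = 0" if n: "n \<ge> 1" for n
  proof (rule ccontr)
    assume "x n \<noteq> 0"
    have eq: "weight (single n) (hat W) = cscale (x n) (single n)"
      by (auto simp: weight_def cscale_def single_def x_def)
    have "op_bound (conv (cscale (x n) (single n))) (modulation_bound ^ 3 * d)"
      using op_bound_conv_weight_hat[OF Wm averaging_weight_single, of n] unfolding eq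
      by (simp add: single_def)
    then have "cscale (x n) (single n) \<in> conv_symbols"
      by (auto simp: conv_symbols_def finseq_cscale)
    then have "cscale (inverse (x n)) (cscale (x n) (single n)) \<in> conv_symbols"
      by (rule conv_symbols_cscale)
    then have "single n \<in> conv_symbols" using \<open>x n \<noteq> 0\<close> by simp
    from conv_symbols_conv[OF poly_seq_conv_symbols this, of "monom 1 (nat (n - 1))"]
    have "single (s * int (nat (n - 1)) + n) \<in> conv_symbols" unfolding poly_seq_monom by simp
    moreover have "s * int (nat (n - 1)) + n = 1" using n s by simp
    ultimately have "single 1 \<in> conv_symbols" by simp
    then have "translate 1 ` E \<subseteq> E" using op_bound_mem by (auto simp: single_conv_symbols_iff)
    then show False using shift_not_into[OF s] by contradiction
  qed
  have x0: "x 0 \<noteq> 0" using rec[of 0] pos[of 1] \<beta>(1) by (auto simp: add_eq_0_iff2)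
  have neg: "x (- int m) * \<beta> ^ m = x 0" for m
  proof (induction m)
    case (Suc m)
    have "x (- int m) = \<beta> * x (- int (Suc m))" using rec[of "- int (Suc m)"] by simp
    then show ?case using Suc by (simp add: mult_ac)
  qed simp
  have \<beta>00: "\<beta>\<^sub>0 \<noteq> 0" using \<beta>(2) by auto
  have mem: "inverse \<beta>\<^sub>0 \<in> shift_spectrum E N"
    using \<beta>0 \<beta>00 s by (simp add: shift_spectrum_iff power_int_minus)
  define C where "C = modulation_bound ^ 3 * d"
  define \<kappa> where "\<kappa> = cmod \<beta>\<^sub>0 / cmod \<beta>"
  have "\<kappa> > 1" using \<beta> by (simp add: \<kappa>_def)
  have le: "cmod (x 0) * \<kappa> ^ m \<le> C" for m
  proof -
    have "cmod (x (- int m) * inverse \<beta>\<^sub>0 powi (- int m)) \<le> C"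
      unfolding x_def C_def by (rule hat_coeff_le[OF Wm mem])
    moreover have "x (- int m) = x 0 / \<beta> ^ m" using neg[of m] \<beta>(1) by (simp add: field_simps)
    ultimately show ?thesis
      using \<beta>(1) \<beta>00
      by (simp add: \<kappa>_def norm_mult norm_divide norm_power norm_inverse power_int_minus power_divide power_inverse)
  qed
  obtain m where "C / cmod (x 0) < \<kappa> ^ m" using real_arch_pow[OF \<open>\<kappa> > 1\<close>] by blast
  then have "C < cmod (x 0) * \<kappa> ^ m" using x0 by (simp add: field_simps)
  then show False using le[of m] by linarith
qed

section \<open>Limits of convolution operators\<close>

lemma conv_algebra_eq_conv:
  assumes "A \<in> conv_algebra E N"
  shows "\<exists>\<phi>\<in>conv_symbols. A = conv \<phi>"
  using assms unfolding conv_algebra_def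
proof (induction rule: generated_algebra.induct)
  case (generator A)
  then show ?case by (auto simp: conv_symbols_def bounded_operator_iff)
next
  case (add A B)
  then obtain \<phi> \<psi> where "\<phi> \<in> conv_symbols" "A = conv \<phi>" "\<psi> \<in> conv_symbols" "B = conv \<psi>" by blast
  then show ?case
    by (intro bexI[of _ "\<phi> + \<psi>"] conv_symbols_add ext) (simp_all add: conv_add_left conv_symbols_finseq)
next
  case (scale A c)
  then obtain \<phi> where "\<phi> \<in> conv_symbols" "A = conv \<phi>" by blast
  then show ?case
    by (intro bexI[of _ "cscale c \<phi>"] conv_symbols_cscale ext) (simp_all add: conv_cscale_left conv_symbols_finseq)
next
  case (compose A B)
  then obtain \<phi> \<psi> where "\<phi> \<in> conv_symbols" "A = conv \<phi>" "\<psi> \<in> conv_symbols" "B = conv \<psi>" by blast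
  then show ?case
    by (intro bexI[of _ "conv \<phi> \<psi>"] conv_symbols_conv ext) (simp_all add: conv_assoc conv_symbols_finseq)
qed

lemma conv_closure_approx:
  assumes "M \<in> conv_closure E N" "e > 0"
  obtains \<phi> where "\<phi> \<in> conv_symbols" "\<And>x. x \<in> E \<Longrightarrow> N (M x - conv \<phi> x) \<le> e * N x"
  using assms conv_algebra_eq_conv unfolding conv_closure_def by blast

text \<open>If \<open>S\<close> is unbounded, commutation with \<open>S\<close> does not pass to limits of operators directly; it does so
  coordinate by coordinate, because the coordinates are continuous.\<close>

lemma conv_closure_multiplier:
  assumes M: "M \<in> conv_closure E N"
  shows "\<exists>c. multiplier_bound M c"
proof -
  obtain c where Mb: "op_bound M c" using M by (auto simp: conv_closure_def bounded_operator_iff)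
  have "M (shift a) = shift (M a)" if a: "a \<in> finseq" for a
  proof
    fix n
    have sa: "shift a \<in> finseq" unfolding shift_eq_translate by (rule finseq_translate[OF a])
    note aE = finseq_mem[OF a] and saE = finseq_mem[OF sa]
    obtain b where b: "b \<ge> 0" "\<And>x. x \<in> E \<Longrightarrow> cmod (x n) \<le> b * N x" using coord_bound by blast
    obtain b' where b': "b' \<ge> 0" "\<And>x. x \<in> E \<Longrightarrow> cmod (x (n - 1)) \<le> b' * N x" using coord_bound by blast
    define D where "D = b * N (shift a) + b' * N a"
    have D0: "0 \<le> D" unfolding D_def
      by (intro add_nonneg_nonneg mult_nonneg_nonneg b(1) b'(1) norm_nonneg aE saE)
    have le: "cmod (M (shift a) n - shift (M a) n) \<le> e * D" if e: "e > 0" for e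
    proof -
      obtain \<phi> where \<phi>: "\<phi> \<in> conv_symbols" "\<And>x. x \<in> E \<Longrightarrow> N (M x - conv \<phi> x) \<le> e * N x"
        using conv_closure_approx[OF M e] by blast
      have cE: "conv \<phi> x \<in> E" if "x \<in> E" for x
        using \<phi>(1) op_bound_mem that by (auto simp: conv_symbols_def)
      note mE = op_bound_mem[OF Mb]
      have 1: "cmod ((M (shift a) - conv \<phi> (shift a)) n) \<le> b * (e * N (shift a))"
        by (rule order_trans[OF b(2) mult_left_mono[OF \<phi>(2)]])
          (intro diff_mem mE cE saE b(1))+
      have 2: "cmod ((M a - conv \<phi> a) (n - 1)) \<le> b' * (e * N a)"
        by (rule order_trans[OF b'(2) mult_left_mono[OF \<phi>(2)]])
          (intro diff_mem mE cE aE b'(1))+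
      have "conv \<phi> (shift a) n = conv \<phi> a (n - 1)"
        unfolding shift_eq_translate conv_translate_right by (simp add: translate_def)
      then have "M (shift a) n - shift (M a) n
          = (M (shift a) - conv \<phi> (shift a)) n - (M a - conv \<phi> a) (n - 1)"
        by (simp add: cseq_apply shift_def)
      then have "cmod (M (shift a) n - shift (M a) n) \<le> b * (e * N (shift a)) + b' * (e * N a)"
        using 1 2 by (simp only:) (rule order_trans[OF norm_triangle_ineq4 add_mono])
      then show ?thesis by (simp add: D_def algebra_simps)
    qed
    have "cmod (M (shift a) n - shift (M a) n) \<le> 0"
    proof (rule field_le_epsilon)
      fix e :: real assume "e > 0"
      then have "e / (D + 1) > 0" using D0 by simp
      from le[OF this] have "cmod (M (shift a) n - shift (M a) n) \<le> e * (D / (D + 1))" by simp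
      also have "\<dots> \<le> e * 1" using \<open>e > 0\<close> D0 by (intro mult_left_mono) auto
      finally show "cmod (M (shift a) n - shift (M a) n) \<le> 0 + e" by simp
    qed
    then show "M (shift a) n = shift (M a) n" by simp
  qed
  then show ?thesis using Mb by (auto simp: multiplier_bound_def)
qed

lemma multiplier_conv_commute:
  assumes M: "multiplier_bound M c" and \<phi>: "\<phi> \<in> conv_symbols" and x: "x \<in> E"
  shows "M (conv \<phi> x) = conv \<phi> (M x)"
proof -
  have \<phi>F: "\<phi> \<in> finseq" using \<phi> by (rule conv_symbols_finseq)
  obtain d where d: "op_bound (conv \<phi>) d" using \<phi> by (auto simp: conv_symbols_def)
  have Mb: "op_bound M c" using M by (simp add: multiplier_bound_def)
  show ?thesis
  proof (rule op_eq_dense[OF op_bound_comp[OF Mb d] op_bound_comp[OF d Mb] _ x])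
    fix a assume a: "a \<in> finseq"
    then show "M (conv \<phi> a) = conv \<phi> (M a)"
      using \<phi>F by (simp add: multiplier_eq_conv[OF M] conv_finseq conv_assoc)
  qed
qed

text \<open>The norm of \<open>C\<^sup>-\<^sup>1\<close> is not controlled by \<open>r\<close>, but its spectral radius is: the operators \<open>C - v\<close> are invertible,
  so the powers of \<open>r C\<^sup>-\<^sup>1\<close> are bounded.  As \<open>C\<^sup>-\<^sup>1\<close> commutes with \<open>D\<close>, the powers of \<open>C\<^sup>-\<^sup>1 D\<close> decay
  geometrically, and \<open>C - D = C (1 - C\<^sup>-\<^sup>1 D)\<close>.\<close>

lemma invertible_op_perturbation:
  assumes C: "op_bound C c" and r: "0 < r" and inv: "\<And>v. cmod v \<le> r \<Longrightarrow> invertible_op (\<lambda>x. C x - cscale v x)"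
    and D: "op_bound D e" "e < r" and comm: "\<And>x. x \<in> E \<Longrightarrow> D (C x) = C (D x)"
  shows "invertible_op (\<lambda>x. C x - D x)"
proof -
  have invC: "invertible_op C" using inv[of 0] r by simp
  then obtain B b where B: "op_bound B b" "\<And>x. x \<in> E \<Longrightarrow> B (C x) = x" "\<And>x. x \<in> E \<Longrightarrow> C (B x) = x"
    unfolding invertible_op_def inverse_op_def by blast
  note BE = op_bound_mem[OF B(1)] and DE = op_bound_mem[OF D(1)] and CE = op_bound_mem[OF C]
  have invB: "invertible_op B"
    unfolding invertible_op_def inverse_op_def using B C by blast
  define A where "A = (\<lambda>x. cscale (of_real r) (B x))"
  have A: "op_bound A (r * b)"
    using op_bound_cmult[OF B(1), of "of_real r"] r by (simp add: A_def)
  have "invertible_op (\<lambda>x. x - cscale w (A x))" if w: "cmod w \<le> 1" for w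
  proof -
    have "cmod (w * of_real r) \<le> r" using w r by (simp add: norm_mult)
    from invertible_op_comp[OF inv[OF this] invB BE]
    show ?thesis
    proof (rule invertible_op_cong)
      fix x assume "x \<in> E"
      then have "C (B x) = x" by (rule B(3))
      then show "x - cscale w (A x) = C (B x) - cscale (w * of_real r) (B x)" by (simp add: A_def)
    qed
  qed
  from powers_bounded[OF A this] obtain K where
    K: "K \<ge> 0" "\<And>m x. x \<in> E \<Longrightarrow> N ((A ^^ m) x) \<le> K * N x" by blast
  have Apow: "(A ^^ m) x = cscale (of_real r ^ m) ((B ^^ m) x)" if x: "x \<in> E" for m x
  proof (induction m)
    case (Suc m)
    have "B (cscale (of_real r ^ m) ((B ^^ m) x)) = cscale (of_real r ^ m) (B ((B ^^ m) x))"
      by (rule op_bound_cscale[OF B(1) op_bound_mem[OF op_bound_pow[OF B(1)] x]])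
    then show ?case using Suc by (simp add: A_def)
  qed simp
  have DB: "D (B x) = B (D x)" if x: "x \<in> E" for x
    using B(2)[OF DE[OF BE[OF x]]] comm[OF BE[OF x]] B(3)[OF x] by simp
  have BmE: "(B ^^ m) x \<in> E" and DmE: "(D ^^ m) x \<in> E" if "x \<in> E" for m x
    using op_bound_mem[OF op_bound_pow] B(1) D(1) that by blast+
  have DBm: "D ((B ^^ m) x) = (B ^^ m) (D x)" if x: "x \<in> E" for m x
    by (induction m) (simp_all add: DB BmE[OF x])
  define T where "T x = B (D x)" for x
  have T: "op_bound T (b * e)" unfolding T_def by (rule op_bound_comp[OF B(1) D(1)])
  have Tpow: "(T ^^ m) x = (B ^^ m) ((D ^^ m) x)" if x: "x \<in> E" for m x
  proof (induction m)
    case (Suc m)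
    then show ?case using DBm[OF DmE[OF x]] by (simp add: T_def)
  qed simp
  have e0: "0 \<le> e" by (rule op_bound_nonneg[OF D(1)])
  have "invertible_op (\<lambda>x. x - T x)"
  proof (rule neumann[OF T])
    show "0 \<le> e / r" "e / r < 1" using e0 D(2) r by auto
    fix m x assume x: "x \<in> E"
    have "r ^ m * N ((T ^^ m) x) = N ((A ^^ m) ((D ^^ m) x))"
      using norm_cscale[OF BmE[OF DmE[OF x]]] r
      by (simp add: Apow[OF DmE[OF x]] Tpow[OF x] norm_power)
    also have "\<dots> \<le> K * N ((D ^^ m) x)" by (rule K(2)[OF DmE[OF x]])
    also have "\<dots> \<le> K * (e ^ m * N x)"
      by (intro mult_left_mono op_bound_le[OF op_bound_pow[OF D(1)]] x K(1))
    finally show "N ((T ^^ m) x) \<le> K * (e / r) ^ m * N x"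
      using r by (simp add: power_divide field_simps)
  qed
  from invertible_op_comp[OF invC this]
  have "invertible_op (\<lambda>x. C (x - T x))"
    using op_bound_mem[OF op_bound_minus[OF op_bound_id T]] by blast
  then show ?thesis
  proof (rule invertible_op_cong)
    fix x assume x: "x \<in> E"
    show "C x - D x = C (x - T x)"
      using op_bound_diff[OF C x op_bound_mem[OF T x]] B(3)[OF DE[OF x]] by (simp add: T_def)
  qed
qed

text \<open>The symbols of \<open>M\<close> and \<open>\<phi>\<close> differ by at most \<open>C\<^sup>3 e\<close>.  At an interior point of the spectrum this compares two values;
  on a boundary circle it compares them almost everywhere, and the
  continuity of the symbol of \<open>\<phi>\<close> gives the inequality at every point.\<close>

lemma laurent_far_from:
  assumes M: "multiplier_bound M c" and \<phi>: "\<phi> \<in> conv_symbols"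
    and D: "multiplier_bound (\<lambda>x. M x - conv \<phi> x) e"
    and far: "\<And>w. w \<in> symbol_range (hat M) (shift_spectrum E N) \<Longrightarrow> \<delta> \<le> cmod (w - l)"
    and \<alpha>: "\<alpha> \<in> shift_spectrum E N"
  shows "\<delta> - modulation_bound ^ 3 * e \<le> cmod (laurent \<phi> \<alpha> - l)"
proof -
  let ?C = "modulation_bound ^ 3 * e"
  have \<phi>F: "\<phi> \<in> finseq" using \<phi> by (rule conv_symbols_finseq)
  define r where "r = cmod \<alpha>"
  have r: "of_real r \<in> shift_spectrum E N" unfolding r_def by (rule cmod_mem_shift_spectrum[OF \<alpha>])
  define f where "f = circle_symbol (hat M) r"
  have f: "symbol_function M r f" unfolding f_def by (rule circle_symbol_symbol_function[OF M r])
  define D' where "D' = (\<lambda>x. M x - conv \<phi> x)"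
  have Dm: "multiplier_bound D' e" using D by (simp add: D'_def)
  have hatD: "hat M n = hat D' n + \<phi> n" for n
    using conv_commute[OF \<phi>F finseq_single, of 0]
    by (simp add: D'_def hat_def unit_seq_eq_single cseq_apply)
  have supp: "r \<noteq> 0 \<or> (\<forall>n. \<phi> n \<noteq> 0 \<longrightarrow> 0 \<le> n)"
  proof (cases "r = 0")
    case True
    then have "hat M n = 0" "hat D' n = 0" if "n < 0" for n
      using hat_nonneg_support[OF M] hat_nonneg_support[OF Dm] r that by force+
    then show ?thesis using hatD by (metis add_0 linorder_not_less)
  qed simp
  define g where "g z = f z - laurent \<phi> (of_real r * z)" for z
  have g: "symbol_function D' r g"
    unfolding g_def D'_def by (rule symbol_function_diff_conv[OF M f \<phi>F supp])
  have key: "\<delta> - ?C \<le> cmod (u - v - l)" if u: "\<delta> \<le> cmod (u - l)" and v: "cmod v \<le> ?C" for u v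
    using norm_triangle_ineq2[of "u - l" v] u v by (simp add: algebra_simps)
  show ?thesis
  proof (cases "\<alpha> \<in> interior (shift_spectrum E N)")
    case True
    have "laurent (hat M) \<alpha> \<in> symbol_range (hat M) (shift_spectrum E N)"
      using True by (auto simp: symbol_range_def)
    then have u: "\<delta> \<le> cmod (laurent (hat M) \<alpha> - l)" by (rule far)
    have v: "cmod (laurent (hat D') \<alpha>) \<le> ?C"
      using symbol_function_le[OF Dm r g] laurent_interior_mem_essential_range[OF Dm True] g
      by (simp add: r_def)
    have "laurent (hat M) \<alpha> = laurent (hat D') \<alpha> + laurent \<phi> \<alpha>"
    proof -
      have "(\<lambda>n. cmod (hat D' n * \<alpha> powi n)) summable_on UNIV"
        using hat_summable_interior[OF Dm True] by (simp add: norm_mult norm_power_int)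
      then have 1: "(\<lambda>n. hat D' n * \<alpha> powi n) summable_on UNIV"
        by (rule abs_summable_summable)
      have 2: "(\<lambda>n. \<phi> n * \<alpha> powi n) summable_on UNIV"
        by (rule finite_nonzero_values_imp_summable_on)
          (use \<phi>F in \<open>auto simp: finseq_def elim!: rev_finite_subset\<close>)
      show ?thesis
        using infsum_add[OF 1 2] by (simp add: laurent_def hatD distrib_right)
    qed
    then show ?thesis using key[OF u v] by simp
  next
    case False
    have "sphere 0 r \<subseteq> frontier (shift_spectrum E N)"
    proof
      fix \<gamma> :: complex assume "\<gamma> \<in> sphere 0 r"
      then have \<gamma>: "cmod \<gamma> = cmod \<alpha>" by (simp add: r_def)
      have "\<gamma> \<in> shift_spectrum E N"
        using sphere_subset_shift_spectrum[OF \<alpha>] \<gamma> by (auto simp: subset_iff)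
      moreover have "\<gamma> \<notin> interior (shift_spectrum E N)"
      proof
        assume "\<gamma> \<in> interior (shift_spectrum E N)"
        then obtain e where e: "e > 0" "ball \<gamma> e \<subseteq> shift_spectrum E N" by (auto simp: mem_interior)
        obtain z where z: "cmod z = 1" "\<gamma> = z * \<alpha>"
        proof (cases "\<alpha> = 0")
          case True
          then show thesis using that[of 1] \<gamma> by simp
        next
          case False
          then show thesis using that[of "\<gamma> / \<alpha>"] \<gamma> by (simp add: norm_divide)
        qed
        have "y \<in> shift_spectrum E N" if "dist \<alpha> y < e" for y
        proof -
          have "dist \<gamma> (z * y) = cmod z * dist \<alpha> y"
            unfolding z(2) dist_norm by (simp add: norm_mult flip: right_diff_distrib)
          then have "z * y \<in> shift_spectrum E N" using e(2) that z(1) by (auto simp: subset_iff)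
          moreover have "cmod (inverse z) = 1" using z(1) by (simp add: norm_inverse)
          ultimately have "inverse z * (z * y) \<in> shift_spectrum E N"
            by (rule shift_spectrum_rotate)
          moreover have "inverse z * (z * y) = y"
          proof -
            have "z \<noteq> 0" using z(1) by auto
            then show ?thesis by simp
          qed
          ultimately show ?thesis by (simp only:)
        qed
        then have "\<alpha> \<in> interior (shift_spectrum E N)" using e(1) by (auto simp: mem_interior)
        then show False using False by contradiction
      qed
      ultimately show "\<gamma> \<in> frontier (shift_spectrum E N)"
        by (simp add: frontier_def closure_subset[THEN subsetD])
    qed
    then have sub: "essential_range circle_measure f \<subseteq> symbol_range (hat M) (shift_spectrum E N)"
      unfolding symbol_range_def f_def r_def by auto
    have fm: "f \<in> borel_measurable borel" and gm: "g \<in> borel_measurable borel"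
      using f g by (auto simp: symbol_function_def circle_Linf_def)
    have cont: "continuous_on (sphere 0 1) (\<lambda>z. laurent \<phi> (of_real r * z))"
    proof -
      have eq: "laurent \<phi> (of_real r * z) = (\<Sum>n | \<phi> n \<noteq> 0. \<phi> n * of_real r powi n * z powi n)" for z
        using \<phi>F laurent_eq_sum[of "{n. \<phi> n \<noteq> 0}" \<phi>]
        by (simp add: finseq_def power_int_mult_distrib mult.assoc)
      show ?thesis unfolding eq by (intro continuous_intros) auto
    qed
    let ?F = "sphere 0 1 \<inter> (\<lambda>z. laurent \<phi> (of_real r * z)) -` {y. \<delta> - ?C \<le> cmod (y - l)}"
    have "AE z in circle_measure. z \<in> ?F"
      using AE_circle_norm AE_essential_range[OF fm] AE_essential_range[OF gm]
    proof eventually_elim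
      case (elim z)
      have "\<delta> - ?C \<le> cmod (f z - g z - l)"
        using far sub elim(2) symbol_function_le[OF Dm r g elim(3)] by (intro key) auto
      then show ?case using elim(1) by (simp add: g_def)
    qed
    moreover have "closed ?F"
      by (rule continuous_closed_preimage[OF cont]) (auto intro!: closed_Collect_le continuous_intros)
    ultimately have F: "z \<in> ?F" if "cmod z = 1" for z using AE_circle_closedD that by blast
    obtain z0 where "cmod z0 = 1" "\<alpha> = of_real r * z0" unfolding r_def by (rule complex_polarE)
    then show ?thesis using F by auto
  qed
qed

lemma spectrum_subset_closure_symbol_range:
  assumes M: "M \<in> conv_closure E N" and ne: "shift_spectrum E N \<noteq> {}"
  shows "op_spectrum E N (graph_on E M) \<subseteq> closure (symbol_range (hat M) (shift_spectrum E N))"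
proof
  fix l assume l: "l \<in> op_spectrum E N (graph_on E M)"
  let ?S = "symbol_range (hat M) (shift_spectrum E N)"
  show "l \<in> closure ?S"
  proof (rule ccontr)
    assume "l \<notin> closure ?S"
    then obtain \<delta> where \<delta>: "\<delta> > 0" "\<And>w. w \<in> ?S \<Longrightarrow> \<delta> \<le> cmod (w - l)"
      by (auto simp: closure_approachable dist_norm not_less)
    obtain c where Mm: "multiplier_bound M c" using conv_closure_multiplier[OF M] by blast
    have Mb: "op_bound M c" using Mm by (simp add: multiplier_bound_def)
    define C3 where "C3 = modulation_bound ^ 3"
    have C3: "C3 \<ge> 1" using modulation_bound_ge_1 by (simp add: C3_def)
    (* With this e the symbols of M and \<phi> differ by at most \<delta> / 4 on the spectrum of the shift,
       so the symbol of \<phi> - l - v vanishes nowhere if |v| \<le> \<delta> / 2, while M - M_\<phi> has norm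
       less than \<delta> / 2. *)
    define e where "e = \<delta> / (4 * C3)"
    have e: "e > 0" "C3 * e = \<delta> / 4" "e \<le> \<delta> / 4"
      using \<delta>(1) C3 by (auto simp: e_def field_simps)
    obtain \<phi> where \<phi>: "\<phi> \<in> conv_symbols" "\<And>x. x \<in> E \<Longrightarrow> N (M x - conv \<phi> x) \<le> e * N x"
      using conv_closure_approx[OF M e(1)] by blast
    have \<phi>F: "\<phi> \<in> finseq" using \<phi>(1) by (rule conv_symbols_finseq)
    obtain c' where \<phi>b: "op_bound (conv \<phi>) c'" using \<phi>(1) by (auto simp: conv_symbols_def)
    obtain d where d: "multiplier_bound (\<lambda>x. M x - conv \<phi> x) d"
      using multiplier_bound_diff_conv[OF Mm \<phi>(1)] by blast
    then have D: "multiplier_bound (\<lambda>x. M x - conv \<phi> x) e"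
      using \<phi>(2) e(1) by (auto simp: multiplier_bound_def op_bound_def)
    have far: "3 * \<delta> / 4 \<le> cmod (laurent \<phi> \<alpha> - l)" if "\<alpha> \<in> shift_spectrum E N" for \<alpha>
      using laurent_far_from[OF Mm \<phi>(1) D \<delta>(2) that] e(2) by (simp add: C3_def)
    obtain \<alpha>0 where \<alpha>0: "\<alpha>0 \<in> shift_spectrum E N" using ne by blast
    define \<beta>0 where "\<beta>0 = \<alpha>0 powi s"
    have \<beta>0: "\<beta>0 \<in> sigma" "s = 1 \<or> \<beta>0 \<noteq> 0" using \<alpha>0 by (auto simp: \<beta>0_def shift_spectrum_iff)
    have far_sigma: "3 * \<delta> / 4 \<le> cmod (laurent \<phi> (\<beta> powi s) - l)" if \<beta>: "\<beta> \<in> sigma" for \<beta>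
    proof (cases "s = 1 \<or> \<beta> \<noteq> 0")
      case True
      then show ?thesis using \<beta> by (intro far) (auto simp: shift_spectrum_iff)
    next
      case False
      (* Here the point 0 of the spectrum of the inverse shift corresponds to infinity; it is a
         limit of points where the estimate is already known. *)
      then have s: "s = -1" and "\<beta> = 0" using s_cases by auto
      then obtain p where p: "\<phi> = poly_seq p" using conv_symbols_support \<beta> \<phi>(1) by blast
      define x where "x k = \<beta>0 / of_nat (Suc (Suc k))" for k
      have x_sigma: "x k \<in> sigma" "x k \<noteq> 0" for k
      proof -
        show "x k \<noteq> 0" using \<beta>0(2) s by (simp add: x_def del: of_nat_Suc)
        have "cmod (x k) < cmod \<beta>0"
        proof -
          have "cmod \<beta>0 > 0" using \<beta>0(2) s by simp
          then show ?thesis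
            unfolding x_def norm_divide norm_of_nat by (simp add: divide_less_eq del: of_nat_Suc)
        qed
        then show "x k \<in> sigma"
          by (rule sigma_contains_punctured_disc[OF s \<beta>0(1) \<open>x k \<noteq> 0\<close>])
      qed
      have "3 * \<delta> / 4 \<le> cmod (poly p (x k) - l)" for k
        using far[of "x k powi s"] x_sigma by (simp add: shift_spectrum_iff p laurent_poly_seq)
      moreover have "x \<longlonglongrightarrow> 0"
        using LIMSEQ_Suc[OF LIMSEQ_Suc[OF lim_const_over_n[of \<beta>0]]] unfolding x_def .
      then have "(\<lambda>k. cmod (poly p (x k) - l)) \<longlonglongrightarrow> cmod (poly p 0 - l)"
        by (intro tendsto_intros isCont_tendsto_compose[OF poly_isCont])
      ultimately have "3 * \<delta> / 4 \<le> cmod (poly p 0 - l)" by (intro LIMSEQ_le_const) auto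
      then show ?thesis using laurent_poly_seq[of p 0] by (simp add: \<open>\<beta> = 0\<close> p)
    qed
    have inv: "invertible_op (\<lambda>x. (conv \<phi> x - cscale l x) - cscale v x)" if v: "cmod v \<le> \<delta> / 2" for v
    proof -
      define u where "u = l + v"
      define \<psi> where "\<psi> = \<phi> - cscale u (single 0)"
      have "\<psi> \<in> conv_symbols" unfolding \<psi>_def
        by (intro conv_symbols_diff \<phi>(1) conv_symbols_cscale single_0_conv_symbols)
      moreover have "laurent \<psi> (\<beta> powi s) \<noteq> 0" if "\<beta> \<in> sigma" for \<beta>
      proof
        assume "laurent \<psi> (\<beta> powi s) = 0"
        then have "laurent \<phi> (\<beta> powi s) - l = v"
          using \<phi>F by (simp add: \<psi>_def laurent_diff laurent_cscale finseq_cscale u_def)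
        then show False using far_sigma[OF that] v \<delta>(1) by simp
      qed
      ultimately have "invertible_op (conv \<psi>)" using \<beta>0(1) by (intro invertible_op_conv) auto
      then show ?thesis
      proof (rule invertible_op_cong)
        fix x
        have "conv \<psi> x = conv \<phi> x - cscale u x" unfolding \<psi>_def by (rule conv_minus_scalar[OF \<phi>F])
        then show "(conv \<phi> x - cscale l x) - cscale v x = conv \<psi> x"
          unfolding u_def cseq.scale_left_distrib by (simp add: diff_diff_eq)
      qed
    qed
    let ?C = "\<lambda>x. conv \<phi> x - cscale l x" and ?D = "\<lambda>x. conv \<phi> x - M x"
    have Cb: "op_bound ?C (c' + cmod l * 1)"
      by (intro op_bound_minus \<phi>b op_bound_cmult op_bound_id)
    have Db: "op_bound ?D e"
    proof -
      have "op_bound (\<lambda>x. cscale (-1) (M x - conv \<phi> x)) (cmod (-1) * e)"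
        using D by (intro op_bound_cmult) (simp add: multiplier_bound_def)
      then show ?thesis by (simp flip: uminus_eq_cscale)
    qed
    have diff_diff_swap: "a - b - (c - d) = a - c - (b - d)" for a b c d :: cseq
      by (simp add: algebra_simps)
    have comm: "?D (?C x) = ?C (?D x)" if x: "x \<in> E" for x
    proof -
      note cE = op_bound_mem[OF \<phi>b x] and lE = cscale_mem[OF x, of l]
      have 1: "conv \<phi> (?C x) = conv \<phi> (conv \<phi> x) - cscale l (conv \<phi> x)"
        unfolding conv_diff_right conv_cscale_right ..
      have 2: "M (?C x) = conv \<phi> (M x) - cscale l (M x)"
        unfolding op_bound_diff[OF Mb cE lE] op_bound_cscale[OF Mb x]
          multiplier_conv_commute[OF Mm \<phi>(1) x] ..
      show ?thesis
        unfolding 1 2 conv_diff_right conv_cscale_right cseq.scale_right_diff_distrib by (rule diff_diff_swap)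
    qed
    have radius: "0 < \<delta> / 2" "e < \<delta> / 2" using \<delta>(1) e by simp_all
    have "invertible_op (\<lambda>x. ?C x - ?D x)"
    proof (rule invertible_op_perturbation[where C = ?C and D = ?D and r = "\<delta> / 2"])
      show "op_bound ?C (c' + cmod l * 1)" by (rule Cb)
      show "op_bound ?D e" by (rule Db)
      show "0 < \<delta> / 2" "e < \<delta> / 2" by (rule radius)+
      show "invertible_op (\<lambda>x. ?C x - cscale v x)" if "cmod v \<le> \<delta> / 2" for v
        using that by (rule inv)
      show "?D (?C x) = ?C (?D x)" if "x \<in> E" for x using that by (rule comm)
    qed
    then have "invertible_op (\<lambda>x. M x - cscale l x)"
    proof (rule invertible_op_cong)
      have "d - b = (a - b) - (a - d)" for a b d :: cseq by (simp add: algebra_simps)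
      then show "M x - cscale l x = ?C x - ?D x" for x .
    qed
    then have "l \<notin> op_spectrum E N (graph_on E M)"
      using not_in_spectrum_iff[of M l] multiplier_mem[OF Mm] by blast
    then show False using l by contradiction
  qed
qed

end

theorem theorem2:
  fixes E :: "cseq set" and N :: "cseq \<Rightarrow> real"
  assumes "shift_space E N"
    and "shift ` E \<subseteq> E \<or> unshift ` E \<subseteq> E"
  shows "(\<forall>M. multiplier E N M \<longrightarrow>
            closure (symbol_range (hat M) (shift_spectrum E N)) \<subseteq> op_spectrum E N (graph_on E M)) \<and>
         (shift_spectrum E N \<noteq> {} \<longrightarrow>
           (\<forall>M\<in>conv_closure E N.
            op_spectrum E N (graph_on E M) = closure (symbol_range (hat M) (shift_spectrum E N))))"
proof -
  interpret shift_space E N by fact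
  define s :: int where "s = (if translate 1 ` E \<subseteq> E then 1 else -1)"
  interpret bounded_shift_space E N s
    by standard (use assms(2) in \<open>auto simp: s_def shift_eq_translate unshift_eq_translate split: if_splits\<close>)
  show ?thesis
  proof (intro conjI allI impI ballI)
    fix M assume "multiplier E N M"
    then show "closure (symbol_range (hat M) (shift_spectrum E N)) \<subseteq> op_spectrum E N (graph_on E M)"
      using closure_symbol_range_subset_spectrum by (auto simp: multiplier_iff)
  next
    fix M assume ne: "shift_spectrum E N \<noteq> {}" and M: "M \<in> conv_closure E N"
    obtain c where "multiplier_bound M c" using conv_closure_multiplier[OF M] by blast
    then show "op_spectrum E N (graph_on E M) = closure (symbol_range (hat M) (shift_spectrum E N))"
      using closure_symbol_range_subset_spectrum spectrum_subset_closure_symbol_range[OF M ne] by blast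
  qed
qed

end
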